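(* Let $M$ be a smooth, closed, oriented, finite-dimensional manifold. For every $d$-Cauchy sequence $\{g_k\}$ in $\mathcal{M}$, there exists an element $[g_\infty]\in\widehat{\mathcal{M}_f}$ such that $\{g_k\}$ $\omega$-subconverges to $[g_\infty]$.
   Context: $\mathcal{S}$: smooth symmetric $(0,2)$-tensor fields on $M$; $\mathcal{M}\subset\mathcal{S}$: smooth Riemannian metrics, with the $L^2$ Riemannian metric $(h,k)_{\tilde g}=\int_M\operatorname{tr}(\tilde g^{-1}h\tilde g^{-1}k)\,\mu_{\tilde g}$ and its distance function $d$ on $\mathcal{M}$ (infimum of lengths $\int_0^1\sqrt{(g_t',g_t')_{g_t}}dt$ of piecewise $C^1$ paths in $\mathcal{M}$). Fix a reference metric $g\in\mathcal{M}$; "nullset", "a.e." refer to $\mu_g$; for a symmetric $(0,2)$-tensor $\tilde g$ put $\tilde G=g^{-1}\tilde g$. A semimetric is a section of $S^2T^*M$ that is positive semidefinite at each point. $\mathcal{M}_m$: semimetrics with measurable coefficients; $\mathcal{M}_f\subset\mathcal{M}_m$: those with finite volume $\int_M\mu_{\tilde g}<\infty$, $\mu_{\tilde g}=\sqrt{\det\tilde g}\,dx^1\cdots dx^n$. $X_{\tilde g}=\{x\in M\mid\tilde g(x)\text{ not positive definite}\}$; for a sequence in $\mathcal{M}$, $X_{\{g_k\}}=\{x\in M\mid\forall\delta>0\ \exists k:\det G_k(x)<\delta\}$. On $\mathcal{M}_m$: $g_0\sim g_1$ iff $X_{g_0},X_{g_1}$ differ at most by a nullset and $g_0=g_1$ a.e.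 on $M\setminus(X_{g_0}\cup X_{g_1})$. $\widehat{\mathcal{M}_f}=\mathcal{M}_f/{\sim}$. A sequence $\{g_k\}\subset\mathcal{M}$ $\omega$-converges to $[g_\infty]$ if for every representative $g_\infty$: (1) $\{g_k\}$ is $d$-Cauchy; (2) $X_{g_\infty}$ and $X_{\{g_k\}}$ differ at most by a nullset; (3) $g_k(x)\to g_\infty(x)$ for a.e. $x\in M\setminus X_{\{g_k\}}$; (4) $\sum_k d(g_k,g_{k+1})<\infty$. A $d$-Cauchy sequence $\omega$-subconverges to $[g_\infty]$ if it has a subsequence that $\omega$-converges to $[g_\infty]$. *)

theory Defs
  imports "HOL-Analysis.Analysis"
begin

section \<open>Smooth maps between Euclidean spaces\<close>

text \<open>\<open>dderivs [v\<^sub>1, \<dots>, v\<^sub>k] f\<close> is the iterated directional derivative of \<open>f\<close> in the directions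
  \<open>v\<^sub>k, \<dots>, v\<^sub>1\<close>.\<close>

primrec dderivs :: "'a::real_normed_vector list \<Rightarrow> ('a \<Rightarrow> 'b::real_normed_vector) \<Rightarrow> 'a \<Rightarrow> 'b" where
  "dderivs [] f = f"
| "dderivs (v # vs) f = (\<lambda>y. frechet_derivative (dderivs vs f) (at y) v)"

text \<open>Used for open \<open>S\<close> only.\<close>

definition smooth_on :: "'a::real_normed_vector set \<Rightarrow> ('a \<Rightarrow> 'b::real_normed_vector) \<Rightarrow> bool" where
  "smooth_on S f \<longleftrightarrow> (\<forall>vs. \<forall>y\<in>S. dderivs vs f differentiable (at y))"


section \<open>Closed oriented manifolds\<close>

text \<open>The manifold is the whole type \<open>'m\<close>, of dimension \<open>CARD('n)\<close>.  Charts are pairs of a domain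
  and a coordinate map.\<close>

type_synonym ('m, 'n) chart = "'m set \<times> ('m \<Rightarrow> real^'n)"

definition chart_dom :: "('m, 'n::finite) chart \<Rightarrow> 'm set" where
  "chart_dom c = fst c"

definition chart_map :: "('m, 'n::finite) chart \<Rightarrow> 'm \<Rightarrow> real^'n" where
  "chart_map c = snd c"

definition chart_img :: "('m, 'n::finite) chart \<Rightarrow> (real^'n) set" where
  "chart_img c = chart_map c ` chart_dom c"

definition chart_inv :: "('m, 'n::finite) chart \<Rightarrow> real^'n \<Rightarrow> 'm" where
  "chart_inv c = inv_into (chart_dom c) (chart_map c)"

definition is_chart :: "('m::topological_space, 'n::finite) chart \<Rightarrow> bool" where
  "is_chart c \<longleftrightarrow> open (chart_dom c) \<and> open (chart_img c) \<and>
     homeomorphism (chart_dom c) (chart_img c) (chart_map c) (chart_inv c)"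

definition transition :: "('m, 'n::finite) chart \<Rightarrow> ('m, 'n) chart \<Rightarrow> real^'n \<Rightarrow> real^'n" where
  "transition c c' = chart_map c' \<circ> chart_inv c"

text \<open>An orientation is given by an atlas whose transition maps preserve orientation.  The Hausdorff
  property is the class constraint; second countability follows from compactness.  The atlas need not
  be maximal, and the manifold need not be connected.\<close>

definition closed_oriented_manifold :: "('m::t2_space, 'n::finite) chart set \<Rightarrow> bool" where
  "closed_oriented_manifold A \<longleftrightarrow>
     compact (UNIV :: 'm set) \<and>
     (\<forall>c\<in>A. is_chart c) \<and> (\<Union>c\<in>A. chart_dom c) = UNIV \<and>
     (\<forall>c\<in>A. \<forall>c'\<in>A. smooth_on (chart_map c ` (chart_dom c \<inter> chart_dom c')) (transition c c')) \<and>
     (\<forall>c\<in>A. \<forall>c'\<in>A. \<forall>y \<in> chart_map c ` (chart_dom c \<inter> chart_dom c').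
        det (jacobian (transition c c') (at y)) > 0)"


section \<open>Sections of \<open>S\<^sup>2T\<^sup>*M\<close>\<close>

text \<open>A \<open>(0,2)\<close>-tensor at \<open>x\<close> is the family of its component matrices in the charts around \<open>x\<close>, related by
  the tensor transformation law.  Entries for charts not around \<open>x\<close> are set to \<open>0\<close>, so that equality
  of tensors is equality in HOL.\<close>

type_synonym ('m, 'n) tensor_field = "'m \<Rightarrow> ('m, 'n) chart \<Rightarrow> real^'n^'n"

definition sym_tensor_field :: "('m, 'n::finite) chart set \<Rightarrow> ('m, 'n) tensor_field \<Rightarrow> bool" where
  "sym_tensor_field A h \<longleftrightarrow>
     (\<forall>x c. \<not> (c \<in> A \<and> x \<in> chart_dom c) \<longrightarrow> h x c = 0) \<and>
     (\<forall>x. \<forall>c\<in>A. x \<in> chart_dom c \<longrightarrow> transpose (h x c) = h x c) \<and>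
     (\<forall>x. \<forall>c\<in>A. \<forall>c'\<in>A. x \<in> chart_dom c \<inter> chart_dom c' \<longrightarrow>
        (let J = jacobian (transition c c') (at (chart_map c x))
         in h x c = transpose J ** h x c' ** J))"

definition coords :: "('m, 'n::finite) chart \<Rightarrow> ('m, 'n) tensor_field \<Rightarrow> real^'n \<Rightarrow> real^'n^'n" where
  "coords c h y = h (chart_inv c y) c"

definition pos_def_at :: "('m, 'n::finite) chart set \<Rightarrow> ('m, 'n) tensor_field \<Rightarrow> 'm \<Rightarrow> bool" where
  "pos_def_at A h x \<longleftrightarrow>
     (\<forall>c\<in>A. x \<in> chart_dom c \<longrightarrow> (\<forall>v. v \<noteq> 0 \<longrightarrow> v \<bullet> (h x c *v v) > 0))"

definition pos_semidef_at :: "('m, 'n::finite) chart set \<Rightarrow> ('m, 'n) tensor_field \<Rightarrow> 'm \<Rightarrow> bool" where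
  "pos_semidef_at A h x \<longleftrightarrow>
     (\<forall>c\<in>A. x \<in> chart_dom c \<longrightarrow> (\<forall>v. v \<bullet> (h x c *v v) \<ge> 0))"

definition smooth_tensors :: "('m, 'n::finite) chart set \<Rightarrow> ('m, 'n) tensor_field set" where
  "smooth_tensors A =
     {h. sym_tensor_field A h \<and> (\<forall>c\<in>A. smooth_on (chart_img c) (coords c h))}"

definition metrics :: "('m, 'n::finite) chart set \<Rightarrow> ('m, 'n) tensor_field set" where
  "metrics A = {g \<in> smooth_tensors A. \<forall>x. pos_def_at A g x}"

text \<open>Measurable means Lebesgue measurable.\<close>

definition measurable_semimetrics :: "('m, 'n::finite) chart set \<Rightarrow> ('m, 'n) tensor_field set" where
  "measurable_semimetrics A =
     {h. sym_tensor_field A h \<and> (\<forall>x. pos_semidef_at A h x) \<and>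
         (\<forall>c\<in>A. coords c h \<in> borel_measurable (lebesgue_on (chart_img c)))}"

text \<open>Traces and determinants of endomorphisms of the tangent space at \<open>x\<close> are computed in some chart
  around \<open>x\<close>; they do not depend on which one.\<close>

definition chart_at :: "('m, 'n::finite) chart set \<Rightarrow> 'm \<Rightarrow> ('m, 'n) chart" where
  "chart_at A x = (SOME c. c \<in> A \<and> x \<in> chart_dom c)"

text \<open>\<open>rel_det A g h x\<close> is the determinant of \<open>g\<^sup>-\<^sup>1 h\<close> at \<open>x\<close>.\<close>

definition rel_det ::
    "('m, 'n::finite) chart set \<Rightarrow> ('m, 'n) tensor_field \<Rightarrow> ('m, 'n) tensor_field \<Rightarrow> 'm \<Rightarrow> real" where
  "rel_det A g h x = (let c = chart_at A x in det (matrix_inv (g x c) ** h x c))"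


section \<open>The volume measure\<close>

definition lebesgue_sets :: "('m, 'n::finite) chart set \<Rightarrow> 'm set set" where
  "lebesgue_sets A = {E. \<forall>c\<in>A. chart_map c ` (E \<inter> chart_dom c) \<in> sets lebesgue}"

definition chart_cover :: "('m, 'n::finite) chart set \<Rightarrow> ('m, 'n) chart list" where
  "chart_cover A = (SOME cs. set cs \<subseteq> A \<and> (\<Union>c\<in>set cs. chart_dom c) = UNIV)"

definition chart_piece :: "('m, 'n::finite) chart list \<Rightarrow> nat \<Rightarrow> 'm set" where
  "chart_piece cs i = chart_dom (cs ! i) - (\<Union>j<i. chart_dom (cs ! j))"

text \<open>The measure \<open>\<mu>\<^sub>h = sqrt (det h) dx\<^sup>1\<dots>dx\<^sup>n\<close>.  The manifold is cut into the disjoint pieces of a finite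
  chart cover, and each piece is measured in its chart.  By the change of variables formula and the
  tensor transformation law, the choice of the cover does not matter.\<close>

definition volume :: "('m, 'n::finite) chart set \<Rightarrow> ('m, 'n) tensor_field \<Rightarrow> 'm measure" where
  "volume A h = measure_of UNIV (lebesgue_sets A)
     (\<lambda>E. let cs = chart_cover A in
        \<Sum>i<length cs. \<integral>\<^sup>+ y \<in> chart_map (cs ! i) ` (E \<inter> chart_piece cs i).
          ennreal (sqrt (det (coords (cs ! i) h y))) \<partial>lebesgue)"

definition finite_volume_semimetrics :: "('m, 'n::finite) chart set \<Rightarrow> ('m, 'n) tensor_field set" where
  "finite_volume_semimetrics A =
     {h \<in> measurable_semimetrics A. emeasure (volume A h) UNIV < \<infinity>}"


section \<open>The \<open>L\<^sup>2\<close> metric and its distance function\<close>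

definition L2_inner ::
    "('m, 'n::finite) chart set \<Rightarrow> ('m, 'n) tensor_field \<Rightarrow> ('m, 'n) tensor_field \<Rightarrow>
     ('m, 'n) tensor_field \<Rightarrow> real" where
  "L2_inner A g h k =
     (\<integral>x. (let c = chart_at A x in
            trace (matrix_inv (g x c) ** h x c ** matrix_inv (g x c) ** k x c)) \<partial>volume A g)"

text \<open>Convergence in the Frechet space of smooth symmetric \<open>(0,2)\<close>-tensor fields: in each chart, the
  partial derivatives of all orders converge uniformly on compact sets.\<close>

definition smooth_tendsto ::
    "('m, 'n::finite) chart set \<Rightarrow> ('b \<Rightarrow> ('m, 'n) tensor_field) \<Rightarrow> ('m, 'n) tensor_field \<Rightarrow>
     'b filter \<Rightarrow> bool" where
  "smooth_tendsto A h l F \<longleftrightarrow>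
     (\<forall>c\<in>A. \<forall>K vs. compact K \<and> K \<subseteq> chart_img c \<longrightarrow>
        uniform_limit K (\<lambda>s. dderivs vs (coords c (h s))) (dderivs vs (coords c l)) F)"

definition C1_path_on ::
    "('m, 'n::finite) chart set \<Rightarrow> real \<Rightarrow> real \<Rightarrow> (real \<Rightarrow> ('m, 'n) tensor_field) \<Rightarrow> bool" where
  "C1_path_on A a b \<gamma> \<longleftrightarrow>
     (\<exists>\<gamma>'. \<forall>t\<in>{a..b}.
        \<gamma>' t \<in> smooth_tensors A \<and>
        smooth_tendsto A (\<lambda>s x c. (\<gamma> s x c - \<gamma> t x c) /\<^sub>R (s - t)) (\<gamma>' t) (at t within {a..b}) \<and>
        smooth_tendsto A \<gamma>' (\<gamma>' t) (at t within {a..b}))"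

text \<open>Piecewise \<open>C\<^sup>1\<close>: the path is \<open>C\<^sup>1\<close> (one-sidedly at the ends) on each closed interval between
  consecutive points of a finite set \<open>T\<close> of break points.\<close>

definition metric_path :: "('m, 'n::finite) chart set \<Rightarrow> (real \<Rightarrow> ('m, 'n) tensor_field) \<Rightarrow> bool" where
  "metric_path A \<gamma> \<longleftrightarrow>
     (\<forall>t\<in>{0..1}. \<gamma> t \<in> metrics A) \<and>
     (\<exists>T. finite T \<and> {0, 1} \<subseteq> T \<and> T \<subseteq> {0..1} \<and>
        (\<forall>a\<in>T. \<forall>b\<in>T. a < b \<and> T \<inter> {a<..<b} = {} \<longrightarrow> C1_path_on A a b \<gamma>))"

text \<open>Away from the break points, this pointwise derivative is the derivative in the Frechet space.\<close>

definition velocity :: "(real \<Rightarrow> ('m, 'n::finite) tensor_field) \<Rightarrow> real \<Rightarrow> ('m, 'n) tensor_field" where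
  "velocity \<gamma> t = (\<lambda>x c. vector_derivative (\<lambda>s. \<gamma> s x c) (at t within {0..1}))"

definition metric_path_length ::
    "('m, 'n::finite) chart set \<Rightarrow> (real \<Rightarrow> ('m, 'n) tensor_field) \<Rightarrow> real" where
  "metric_path_length A \<gamma> =
     integral {0..1} (\<lambda>t. sqrt (L2_inner A (\<gamma> t) (velocity \<gamma> t) (velocity \<gamma> t)))"

definition L2_dist ::
    "('m, 'n::finite) chart set \<Rightarrow> ('m, 'n) tensor_field \<Rightarrow> ('m, 'n) tensor_field \<Rightarrow> real" where
  "L2_dist A g0 g1 = Inf {metric_path_length A \<gamma> | \<gamma>. metric_path A \<gamma> \<and> \<gamma> 0 = g0 \<and> \<gamma> 1 = g1}"

definition L2_Cauchy :: "('m, 'n::finite) chart set \<Rightarrow> (nat \<Rightarrow> ('m, 'n) tensor_field) \<Rightarrow> bool" where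
  "L2_Cauchy A gs \<longleftrightarrow> (\<forall>e>0. \<exists>N. \<forall>m\<ge>N. \<forall>n\<ge>N. L2_dist A (gs m) (gs n) < e)"


section \<open>\<open>\<omega>\<close>-convergence\<close>

definition degenerate_set :: "('m, 'n::finite) chart set \<Rightarrow> ('m, 'n) tensor_field \<Rightarrow> 'm set" where
  "degenerate_set A h = {x. \<not> pos_def_at A h x}"

definition deflated_set ::
    "('m, 'n::finite) chart set \<Rightarrow> ('m, 'n) tensor_field \<Rightarrow> (nat \<Rightarrow> ('m, 'n) tensor_field) \<Rightarrow> 'm set"
  where
  "deflated_set A g gs = {x. \<forall>\<delta>>0. \<exists>k. rel_det A g (gs k) x < \<delta>}"

text \<open>In the following, \<open>g\<close> is the reference metric.\<close>

definition differ_by_nullset ::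
    "('m, 'n::finite) chart set \<Rightarrow> ('m, 'n) tensor_field \<Rightarrow> 'm set \<Rightarrow> 'm set \<Rightarrow> bool" where
  "differ_by_nullset A g X Y \<longleftrightarrow> (X - Y) \<union> (Y - X) \<in> null_sets (volume A g)"

definition semimetric_rel ::
    "('m, 'n::finite) chart set \<Rightarrow> ('m, 'n) tensor_field \<Rightarrow>
     (('m, 'n) tensor_field \<times> ('m, 'n) tensor_field) set" where
  "semimetric_rel A g =
     {(g0, g1). g0 \<in> measurable_semimetrics A \<and> g1 \<in> measurable_semimetrics A \<and>
        differ_by_nullset A g (degenerate_set A g0) (degenerate_set A g1) \<and>
        (AE x in volume A g. x \<notin> degenerate_set A g0 \<union> degenerate_set A g1 \<longrightarrow> g0 x = g1 x)}"

definition Mf_hat ::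
    "('m, 'n::finite) chart set \<Rightarrow> ('m, 'n) tensor_field \<Rightarrow> ('m, 'n) tensor_field set set" where
  "Mf_hat A g =
     finite_volume_semimetrics A //
       (semimetric_rel A g \<inter> finite_volume_semimetrics A \<times> finite_volume_semimetrics A)"

definition omega_converges ::
    "('m, 'n::finite) chart set \<Rightarrow> ('m, 'n) tensor_field \<Rightarrow> (nat \<Rightarrow> ('m, 'n) tensor_field) \<Rightarrow>
     ('m, 'n) tensor_field set \<Rightarrow> bool" where
  "omega_converges A g gs cls \<longleftrightarrow>
     (\<forall>ginf\<in>cls.
        L2_Cauchy A gs \<and>
        differ_by_nullset A g (degenerate_set A ginf) (deflated_set A g gs) \<and>
        (AE x in volume A g. x \<notin> deflated_set A g gs \<longrightarrow>
           (\<forall>c\<in>A. x \<in> chart_dom c \<longrightarrow> (\<lambda>k. gs k x c) \<longlonglongrightarrow> ginf x c)) \<and>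
        summable (\<lambda>k. L2_dist A (gs k) (gs (Suc k))))"

definition omega_subconverges ::
    "('m, 'n::finite) chart set \<Rightarrow> ('m, 'n) tensor_field \<Rightarrow> (nat \<Rightarrow> ('m, 'n) tensor_field) \<Rightarrow>
     ('m, 'n) tensor_field set \<Rightarrow> bool" where
  "omega_subconverges A g gs cls \<longleftrightarrow> (\<exists>r. strict_mono r \<and> omega_converges A g (gs \<circ> r) cls)"

end

theory Submission
  imports Defs
begin

text \<open>
  At a point \<open>x\<close>, write \<open>a\<close> for a moving inner product, \<open>N\<^sup>2 = tr (a\<^sup>-\<^sup>1 a' a\<^sup>-\<^sup>1 a')\<close> and
  \<open>D\<close> for the fourth root of \<open>det a\<close> relative to the reference metric.  Cauchy--Schwarz for the trace
  form gives \<open>|D'| \<le> (sqrt n / 4) D N\<close> and \<open>|(ln (u \<bullet> a u))'| \<le> N\<close> for every \<open>u \<noteq> 0\<close>.  The \<open>L\<^sup>2\<close> speed of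
  a path of metrics is the \<open>L\<^sup>2\<close> norm of \<open>x \<mapsto> D N\<close>, so by Minkowski's integral inequality the pointwise
  lengths \<open>\<phi>(x) = \<integral> D N dt\<close> have \<open>L\<^sup>2\<close> norm at most the length of the path.

  After passing to a subsequence, consecutive metrics are joined by paths of length at most \<open>4\<^sup>-\<^sup>k\<close>, and
  the pointwise lengths \<open>\<phi>\<^sub>k\<close> are summable almost everywhere.  Where the determinants stay bounded away
  from \<open>0\<close>, the functions \<open>ln (u \<bullet> a\<^sub>k u)\<close> then converge, so the metrics converge to a positive definite
  limit; elsewhere the limit is set to \<open>0\<close>.  Its volume density is at most
  \<open>2 D\<^sub>0\<^sup>2 + (n / 8) (\<Sum>k. \<phi>\<^sub>k)\<^sup>2\<close>, which is integrable.
\<close>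

section \<open>Positive definite matrices\<close>

text \<open>The distance controls only the product \<open>D N\<close>, never \<open>N\<close> by
  itself: where \<open>det a\<close> is close to \<open>0\<close>, a path of small length can still
  change the inner product considerably, and the metrics need not converge there at all. Logarithms
  of quadratic forms are therefore compared only with a margin: if \<open>D\<close> starts above
  \<open>\<delta>\<close> plus its largest possible loss, it stays above \<open>\<delta>\<close>,
  and \<open>N\<close> is at most \<open>D N / \<delta>\<close>. The fourth root is the right power
  because \<open>D^2\<close> is exactly the volume density relative to the reference metric. The
  rate \<open>4^-k\<close> leaves room for weights: \<open>2^k \<phi>_k^2\<close> still has
  integrals of order \<open>8^-k\<close>, and the sum of these functions dominates the square of the
  sum of the \<open>\<phi>_k\<close>; one integrable function thus gives both convergence almost
  everywhere and the volume bound. A second obstacle is the finite volume of a smooth metric: the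
  pieces of the chart cover may reach the edge of their charts, where the coordinate density can be
  unbounded. Change of variables for the transition maps settles this.\<close>

definition psd_matrix :: "real^'n^'n \<Rightarrow> bool" where
  "psd_matrix a \<longleftrightarrow> transpose a = a \<and> (\<forall>v. v \<bullet> (a *v v) \<ge> 0)"

definition pd_matrix :: "real^'n^'n \<Rightarrow> bool" where
  "pd_matrix a \<longleftrightarrow> transpose a = a \<and> (\<forall>v. v \<noteq> 0 \<longrightarrow> v \<bullet> (a *v v) > 0)"

lemma pd_imp_psd: "pd_matrix a \<Longrightarrow> psd_matrix a"
  unfolding pd_matrix_def psd_matrix_def by (metis inner_zero_left order.strict_implies_order order_refl)

lemma symmetric_quadratic_form_swap:
  fixes a :: "real^'n^'n"
  assumes "transpose a = a"
  shows "v \<bullet> (a *v w) = w \<bullet> (a *v v)"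
  by (metis assms dot_lmul_matrix inner_commute transpose_matrix_vector)

lemma quadratic_form_add:
  fixes a :: "real^'n^'n"
  assumes "transpose a = a"
  shows "(v + w) \<bullet> (a *v (v + w)) = v \<bullet> (a *v v) + 2 * (v \<bullet> (a *v w)) + w \<bullet> (a *v w)"
  using symmetric_quadratic_form_swap[OF assms, of v w]
  by (simp add: matrix_vector_right_distrib inner_add_left inner_add_right)

lemma quadratic_form_axis: "axis i 1 \<bullet> (a *v axis j 1) = a $ i $ j" for a :: "real^'n^'n"
  by (simp add: matrix_vector_mult_basis column_def inner_axis' )

lemma psd_Cauchy_Schwarz:
  fixes a :: "real^'n^'n"
  assumes "psd_matrix a"
  shows "(v \<bullet> (a *v w))\<^sup>2 \<le> (v \<bullet> (a *v v)) * (w \<bullet> (a *v w))"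
proof -
  have sym: "transpose a = a" and pos: "\<And>v. v \<bullet> (a *v v) \<ge> 0"
    using assms by (auto simp: psd_matrix_def)
  define p q r where "p = v \<bullet> (a *v v)" and "q = v \<bullet> (a *v w)" and "r = w \<bullet> (a *v w)"
  have quad: "p + 2 * t * q + t\<^sup>2 * r \<ge> 0" for t
    using pos[of "v + t *\<^sub>R w"] unfolding quadratic_form_add[OF sym] p_def q_def r_def
    by (simp add: matrix_vector_mult_scaleR power2_eq_square algebra_simps)
  show ?thesis
  proof (cases "r = 0")
    case True
    have "q = 0"
    proof (rule ccontr)
      assume "q \<noteq> 0"
      \<comment> \<open>With \<open>r = 0\<close> the quadratic is affine in \<open>t\<close>;
        unless its slope vanishes, this \<open>t\<close> drives it to \<open>-1\<close>.\<close>
      then have "p + 2 * (- (p + 1) / (2 * q)) * q = -1"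
        by (simp add: field_simps)
      with quad[of "- (p + 1) / (2 * q)"] True show False by simp
    qed
    then show ?thesis using True by (simp add: q_def r_def)
  next
    case False
    then have "r > 0" using pos[of w] by (simp add: r_def)
    \<comment> \<open>The quadratic is evaluated at its minimum \<open>t = - q / r\<close>.\<close>
    have "p + 2 * (- q / r) * q + (- q / r)\<^sup>2 * r = p - q\<^sup>2 / r"
      using False by (simp add: field_simps power2_eq_square)
    with quad[of "- q / r"] have "q\<^sup>2 / r \<le> p" by simp
    then show ?thesis using \<open>r > 0\<close> by (simp add: p_def q_def r_def field_simps)
  qed
qed

text \<open>Cholesky factorization: each step splits off a rank one matrix and clears one row.\<close>

lemma psd_matrix_factorization:
  fixes a :: "real^'n^'n"
  assumes "psd_matrix a"
  obtains w :: "real^'n^'n" where "a = transpose w ** w"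
proof -
  \<comment> \<open>The induction runs over the rows that may be nonzero. Requiring \<open>w\<close>
    to vanish outside \<open>I\<close> keeps row \<open>i\<close> free, where the new rank one
    factor is stored.\<close>
  have "\<exists>w :: real^'n^'n. a = transpose w ** w \<and> (\<forall>k. k \<notin> I \<longrightarrow> w $ k = 0)"
    if "finite I" "psd_matrix a" "\<And>i. i \<notin> I \<Longrightarrow> a $ i = 0" for I and a :: "real^'n^'n"
    using that
  proof (induction I arbitrary: a rule: finite_induct)
    case empty
    then have "a $ i = 0" for i by blast
    then have "a = 0" unfolding vec_eq_iff by simp
    then have "a = transpose 0 ** 0" by (simp add: matrix_matrix_mult_def vec_eq_iff)
    then show ?case by (metis zero_index)
  next
    case (insert i I a)
    have sym: "a $ j $ k = a $ k $ j" for j k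
      using insert.prems(1) unfolding psd_matrix_def by (metis transpose_def vec_lambda_beta)
    have CS: "(v \<bullet> (a *v axis i 1))\<^sup>2 \<le> (v \<bullet> (a *v v)) * (a $ i $ i)" for v
      using psd_Cauchy_Schwarz[OF insert.prems(1), of v "axis i 1"] by (simp add: quadratic_form_axis)
    have aii: "a $ i $ i \<ge> 0"
      using insert.prems(1) quadratic_form_axis[of i a i] unfolding psd_matrix_def by metis
    show ?case
    proof (cases "a $ i $ i = 0")
      case True
      \<comment> \<open>A zero on the diagonal forces its whole column to vanish by Cauchy--Schwarz,
        so there is nothing to split off.\<close>
      have "a $ j $ i = 0" for j
        using CS[of "axis j 1"] True by (simp add: quadratic_form_axis)
      then have "a $ i = 0" using sym by (simp add: vec_eq_iff)
      then have "\<And>j. j \<notin> I \<Longrightarrow> a $ j = 0" using insert.prems(2) by (metis insert_iff)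
      with insert.IH insert.prems(1) show ?thesis by blast
    next
      case False
      with aii have pos: "a $ i $ i > 0" by simp
      define r where "r = sqrt (a $ i $ i)"
      have r: "r > 0" "r * r = a $ i $ i" using pos by (auto simp: r_def)
      \<comment> \<open>The Schur complement of the pivot \<open>a $ i $ i\<close>. The identity
        \<open>bv\<close> turns its semidefiniteness into Cauchy--Schwarz against the axis vector of
        \<open>i\<close>.\<close>
      define b :: "real^'n^'n" where "b = (\<chi> j k. a $ j $ k - a $ i $ j * a $ i $ k / (a $ i $ i))"
      have bv: "v \<bullet> (b *v v) = v \<bullet> (a *v v) - (v \<bullet> (a *v axis i 1))\<^sup>2 / a $ i $ i" for v
      proof -
        have e: "v \<bullet> (a *v axis i 1) = (\<Sum>j\<in>UNIV. a $ i $ j * v $ j)"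
          by (simp add: matrix_vector_mult_basis column_def inner_vec_def sym mult.commute)
        have "v \<bullet> (b *v v) = (\<Sum>j\<in>UNIV. v $ j * (\<Sum>k\<in>UNIV. a $ j $ k * v $ k))
            - (\<Sum>j\<in>UNIV. v $ j * (\<Sum>k\<in>UNIV. (a $ i $ j * a $ i $ k / (a $ i $ i)) * v $ k))"
          by (simp add: b_def inner_vec_def matrix_vector_mult_def left_diff_distrib sum_subtractf right_diff_distrib)
        also have "(\<Sum>j\<in>UNIV. v $ j * (\<Sum>k\<in>UNIV. (a $ i $ j * a $ i $ k / (a $ i $ i)) * v $ k))
            = (\<Sum>j\<in>UNIV. a $ i $ j * v $ j)\<^sup>2 / a $ i $ i"
          by (simp add: power2_eq_square sum_product sum_distrib_left sum_divide_distrib mult_ac)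
        finally show ?thesis
          unfolding e by (simp add: inner_vec_def matrix_vector_mult_def)
      qed
      have "psd_matrix b"
        unfolding psd_matrix_def
      proof (intro conjI allI)
        show "transpose b = b"
          unfolding vec_eq_iff transpose_def b_def by (metis (lifting) mult.commute sym vec_lambda_beta)
        show "v \<bullet> (b *v v) \<ge> 0" for v
          using CS[of v] pos by (simp add: bv field_simps)
      qed
      moreover have "b $ j = 0" if "j \<notin> I" for j
      proof (cases "j = i")
        case True
        then show ?thesis using pos by (simp add: b_def vec_eq_iff)
      next
        case False
        then have "a $ j = 0" using insert.prems(2) that by simp
        then show ?thesis using sym[of i j] by (simp add: b_def vec_eq_iff)
      qed
      ultimately obtain w where w: "b = transpose w ** w" "\<And>k. k \<notin> I \<Longrightarrow> w $ k = 0"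
        using insert.IH by blast
      define w' :: "real^'n^'n" where "w' = (\<chi> k. if k = i then (1 / r) *\<^sub>R a $ i else w $ k)"
      have "transpose w' ** w' = a"
      proof -
        have "(\<Sum>l\<in>UNIV. w' $ l $ j * w' $ l $ k) = a $ j $ k" for j k
        proof -
          have "(\<Sum>l\<in>UNIV. w' $ l $ j * w' $ l $ k)
             = a $ i $ j * a $ i $ k / (r * r) + (\<Sum>l\<in>UNIV - {i}. w $ l $ j * w $ l $ k)"
            by (subst sum.remove[of _ i]) (auto simp: w'_def field_simps)
          also have "(\<Sum>l\<in>UNIV - {i}. w $ l $ j * w $ l $ k) = (\<Sum>l\<in>UNIV. w $ l $ j * w $ l $ k)"
            using w(2)[OF insert.hyps(2)] by (subst (2) sum.remove[of _ i]) auto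
          also have "\<dots> = b $ j $ k"
            by (simp add: w(1) matrix_matrix_mult_def transpose_def)
          finally show ?thesis by (simp add: b_def r)
        qed
        then show ?thesis by (simp add: matrix_matrix_mult_def transpose_def vec_eq_iff)
      qed
      moreover have "\<forall>k. k \<notin> insert i I \<longrightarrow> w' $ k = 0"
        using w(2) by (simp add: w'_def)
      ultimately show ?thesis by metis
    qed
  qed
  from this[of UNIV a] assms that show thesis by auto
qed

lemma matrix_inv_eqI:
  fixes a b :: "real^'n^'n"
  assumes "b ** a = mat 1"
  shows "matrix_inv a = b"
proof -
  have ab: "a ** b = mat 1" using assms by (simp add: matrix_left_right_inverse)
  have "a ** matrix_inv a = mat 1 \<and> matrix_inv a ** a = mat 1"
    unfolding matrix_inv_def by (rule someI[of _ b]) (simp add: ab assms)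
  then have "matrix_inv a = b ** a ** matrix_inv a" "b = b ** (a ** matrix_inv a)"
    using assms by simp_all
  then show ?thesis by (metis matrix_mul_assoc)
qed

lemma
  fixes a :: "real^'n^'n"
  assumes "det a \<noteq> 0"
  shows matrix_inv_mult_right: "a ** matrix_inv a = mat 1"
    and matrix_inv_mult_left: "matrix_inv a ** a = mat 1"
  using assms by (metis invertible_det_nz invertible_def matrix_inv_eqI)+

lemma det_psd_nonneg: "psd_matrix a \<Longrightarrow> det a \<ge> 0"
  by (metis psd_matrix_factorization det_mul det_transpose zero_le_square)

text \<open>By Cauchy--Schwarz, a vector on which the form vanishes lies in the kernel of
  \<open>a\<close>, which a nonzero determinant excludes. A limit of positive definite matrices is a
  priori only semidefinite; a lower bound on the determinants restores definiteness through this
  lemma.\<close>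

lemma psd_det_pos_imp_pd:
  fixes a :: "real^'n^'n"
  assumes "psd_matrix a" "det a > 0"
  shows "pd_matrix a"
  unfolding pd_matrix_def
proof (intro conjI allI impI)
  show "transpose a = a" using assms by (simp add: psd_matrix_def)
  fix v :: "real^'n" assume v: "v \<noteq> 0"
  show "v \<bullet> (a *v v) > 0"
  proof (rule ccontr)
    assume "\<not> v \<bullet> (a *v v) > 0"
    then have "v \<bullet> (a *v v) = 0" using assms(1) unfolding psd_matrix_def by (meson linorder_not_le order_antisym)
    then have "(w \<bullet> (a *v v))\<^sup>2 \<le> 0" for w using psd_Cauchy_Schwarz[OF assms(1), of w v] by simp
    then have "a *v v = 0" by (metis inner_eq_zero_iff power2_less_eq_zero_iff)
    then show False using v assms(2) by (metis invertible_det_nz invertible_eq_bij bij_def injD matrix_vector_mult_0_right less_irrefl)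
  qed
qed

lemma pd_det_pos:
  fixes a :: "real^'n^'n"
  assumes "pd_matrix a"
  shows "det a > 0"
proof -
  have "inj ((*v) a)"
  proof (rule injI)
    fix x y assume "a *v x = a *v y"
    then have "(x - y) \<bullet> (a *v (x - y)) = 0" by (simp add: matrix_vector_mult_diff_distrib)
    then show "x = y" using assms unfolding pd_matrix_def by (metis less_irrefl right_minus_eq)
  qed
  then have "det (matrix ((*v) a)) \<noteq> 0" by (subst det_nz_iff_inj) simp_all
  then have "det a \<noteq> 0" by simp
  with det_psd_nonneg[OF pd_imp_psd[OF assms]] show ?thesis by simp
qed

lemma pd_matrix_factorization:
  fixes a :: "real^'n^'n"
  assumes "pd_matrix a"
  obtains w w' :: "real^'n^'n" where "a = transpose w ** w" "w ** w' = mat 1" "w' ** w = mat 1"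
    "matrix_inv a = w' ** transpose w'"
proof -
  obtain w :: "real^'n^'n" where w: "a = transpose w ** w"
    using psd_matrix_factorization pd_imp_psd assms by metis
  have "det w \<noteq> 0" using pd_det_pos[OF assms] by (auto simp: w det_mul)
  then obtain w' where w': "w ** w' = mat 1" "w' ** w = mat 1"
    by (metis invertible_det_nz invertible_def)
  have "(w' ** transpose w') ** a = w' ** transpose (w ** w') ** w"
    by (simp add: w matrix_transpose_mul matrix_mul_assoc)
  then have "(w' ** transpose w') ** a = mat 1" by (simp add: w')
  then have "matrix_inv a = w' ** transpose w'"
    by (rule matrix_inv_eqI)
  then show thesis using that w w' by blast
qed

text \<open>The inner product on nested vectors is the Frobenius product, which opens trace
  expressions to Cauchy--Schwarz.\<close>

lemma trace_transpose_mult: "trace (transpose x ** y) = x \<bullet> y" for x y :: "real^'n^'n"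
proof -
  have "trace (transpose x ** y) = (\<Sum>i\<in>UNIV. \<Sum>k\<in>UNIV. x $ k $ i * y $ k $ i)"
    by (simp add: trace_def matrix_matrix_mult_def transpose_def)
  also have "\<dots> = (\<Sum>k\<in>UNIV. \<Sum>i\<in>UNIV. x $ k $ i * y $ k $ i)" by (rule sum.swap)
  finally show ?thesis by (simp add: inner_vec_def)
qed

text \<open>With \<open>a\<^sup>-\<^sup>1 = w' w'\<^sup>T\<close>, the tensor norm of \<open>b\<close> is the Frobenius norm of \<open>w'\<^sup>T b w'\<close>.\<close>

lemma
  fixes a b :: "real^'n^'n"
  assumes a: "pd_matrix a" and b: "transpose b = b"
  shows trace_square_nonneg: "trace (matrix_inv a ** b ** matrix_inv a ** b) \<ge> 0"
    and trace_le_trace_square: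
      "\<bar>trace (matrix_inv a ** b)\<bar> \<le> sqrt CARD('n) * sqrt (trace (matrix_inv a ** b ** matrix_inv a ** b))"
    and quadratic_form_le_trace_square:
      "\<bar>u \<bullet> (b *v u)\<bar> \<le> (u \<bullet> (a *v u)) * sqrt (trace (matrix_inv a ** b ** matrix_inv a ** b))"
proof -
  obtain w w' :: "real^'n^'n" where w: "a = transpose w ** w" "w ** w' = mat 1" "w' ** w = mat 1"
    "matrix_inv a = w' ** transpose w'"
    using pd_matrix_factorization[OF a] by metis
  define X where "X = transpose w' ** b ** w'"
  have symX: "transpose X = X"
    by (simp add: X_def matrix_transpose_mul b matrix_mul_assoc)
  have "trace (matrix_inv a ** b ** matrix_inv a ** b) = trace (w' ** (transpose w' ** b ** w' ** transpose w' ** b))"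
    by (simp add: w(4) matrix_mul_assoc)
  also have "\<dots> = trace (X ** X)"
    by (subst trace_mul_sym) (simp add: X_def matrix_mul_assoc)
  also have "\<dots> = (norm X)\<^sup>2" using trace_transpose_mult[of X X] symX by (simp add: dot_square_norm)
  finally have tr2: "trace (matrix_inv a ** b ** matrix_inv a ** b) = (norm X)\<^sup>2" .
  show "trace (matrix_inv a ** b ** matrix_inv a ** b) \<ge> 0" by (simp add: tr2)
  have "trace (matrix_inv a ** b) = trace (w' ** (transpose w' ** b))"
    by (simp add: w(4) matrix_mul_assoc)
  also have "\<dots> = trace X"
    by (subst trace_mul_sym) (simp add: X_def)
  \<comment> \<open>The trace is the Frobenius product with the identity, whose norm is the square
    root of the dimension; this is the source of \<open>sqrt CARD('n)\<close> in the later
    constants.\<close>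
  also have "\<dots> = mat 1 \<bullet> X" using trace_transpose_mult[of "mat 1" X] by simp
  finally have "\<bar>trace (matrix_inv a ** b)\<bar> \<le> norm (mat 1 :: real^'n^'n) * norm X"
    using Cauchy_Schwarz_ineq2 by metis
  moreover have "norm (mat 1 :: real^'n^'n) = sqrt CARD('n)"
    using trace_transpose_mult[of "mat 1 :: real^'n^'n" "mat 1"] by (simp add: norm_eq_sqrt_inner trace_I)
  ultimately show "\<bar>trace (matrix_inv a ** b)\<bar> \<le> sqrt CARD('n) * sqrt (trace (matrix_inv a ** b ** matrix_inv a ** b))"
    by (simp add: tr2)
  \<comment> \<open>In the coordinates \<open>z\<close> the inner product \<open>a\<close> becomes
    the standard one and \<open>b\<close> becomes \<open>X\<close>.\<close>
  define z where "z = w *v u"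
  have u: "u = w' *v z" by (simp add: z_def matrix_vector_mul_assoc w(3))
  have adj: "p \<bullet> (transpose m *v q) = (m *v p) \<bullet> q" for p q and m :: "real^'n^'n"
    by (metis dot_lmul_matrix transpose_matrix_vector transpose_transpose inner_commute)
  note transpose_matrix_vector[simp del]
  have "u \<bullet> (b *v u) = z \<bullet> (X *v z)"
    by (simp add: u X_def matrix_vector_mul_assoc[symmetric] adj)
  moreover have "u \<bullet> (a *v u) = z \<bullet> z"
    by (simp add: w(1) matrix_vector_mul_assoc[symmetric] adj z_def)
  moreover have "\<bar>z \<bullet> (X *v z)\<bar> \<le> (z \<bullet> z) * norm X"
  proof -
    \<comment> \<open>The quadratic form is the Frobenius product of \<open>X\<close> with the rank
      one matrix of entries \<open>z $ i * z $ j\<close>, whose norm is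
      \<open>z \<bullet> z\<close>.\<close>
    have "z \<bullet> (X *v z) = (\<chi> i. z $ i *\<^sub>R z) \<bullet> X"
      by (simp add: inner_vec_def matrix_vector_mult_def sum_distrib_left mult_ac)
    then have "\<bar>z \<bullet> (X *v z)\<bar> \<le> norm (\<chi> i. z $ i *\<^sub>R z) * norm X"
      using Cauchy_Schwarz_ineq2 by metis
    also have "norm (\<chi> i. z $ i *\<^sub>R z) = z \<bullet> z"
    proof -
      have "(\<chi> i. z $ i *\<^sub>R z) \<bullet> (\<chi> i. z $ i *\<^sub>R z) = (\<Sum>i\<in>UNIV. (z $ i)\<^sup>2) * (z \<bullet> z)"
        by (simp add: inner_vec_def[of "\<chi> i. z $ i *\<^sub>R z"] power2_eq_square sum_distrib_right mult.assoc)
      also have "\<dots> = (z \<bullet> z)\<^sup>2" by (simp add: power2_eq_square inner_vec_def)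
      finally show ?thesis by (simp add: norm_eq_sqrt_inner)
    qed
    finally show ?thesis .
  qed
  ultimately show "\<bar>u \<bullet> (b *v u)\<bar> \<le> (u \<bullet> (a *v u)) * sqrt (trace (matrix_inv a ** b ** matrix_inv a ** b))"
    by (simp add: tr2)
qed

section \<open>Continuity of the matrix inverse and the derivative of the determinant\<close>

lemma matrix_inv_component:
  fixes a :: "real^'n^'n"
  assumes "det a \<noteq> 0"
  shows "matrix_inv a $ i $ j = det (\<chi> k l. if l = i then axis j 1 $ k else a $ k $ l) / det a"
proof -
  have "a ** matrix_inv a = mat 1" using assms by (rule matrix_inv_mult_right)
  then have "a *v (matrix_inv a *v axis j 1) = axis j 1" by (simp add: matrix_vector_mul_assoc)
  then have "matrix_inv a *v axis j 1 = (\<chi> k. det (\<chi> i l. if l = k then axis j 1 $ i else a $ i $ l) / det a)"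
    using cramer[OF assms] by simp
  then have "(matrix_inv a *v axis j 1) $ i = det (\<chi> k l. if l = i then axis j 1 $ k else a $ k $ l) / det a"
    by simp
  then show ?thesis by (simp add: matrix_vector_mult_basis column_def)
qed

lemma continuous_on_vec_entries:
  fixes f :: "'a::topological_space \<Rightarrow> real^'n^'m"
  shows "(\<And>i j. continuous_on S (\<lambda>x. f x $ i $ j)) \<Longrightarrow> continuous_on S f"
  unfolding continuous_on_def by (auto intro!: vec_tendstoI)

lemma continuous_on_det [continuous_intros]:
  fixes f :: "'a::topological_space \<Rightarrow> real^'n^'n"
  shows "continuous_on S f \<Longrightarrow> continuous_on S (\<lambda>x. det (f x))"
  unfolding det_def by (intro continuous_intros)

text \<open>\<open>matrix_inv\<close> is defined by choice, so its continuity is not visible from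
  the definition; Cramer's rule writes the entries as quotients of determinants.\<close>

lemma continuous_on_matrix_inv:
  fixes f :: "'a::topological_space \<Rightarrow> real^'n^'n"
  assumes f: "continuous_on S f" and nz: "\<And>x. x \<in> S \<Longrightarrow> det (f x) \<noteq> 0"
  shows "continuous_on S (\<lambda>x. matrix_inv (f x))"
proof (rule continuous_on_vec_entries)
  fix i j
  have entry: "continuous_on S (\<lambda>x. f x $ k $ l)" for k l
    using f by (intro continuous_intros)
  have "continuous_on S (\<lambda>x. (\<chi> k l. if l = i then axis j 1 $ k else f x $ k $ l) :: real^'n^'n)"
  proof (rule continuous_on_vec_entries)
    show "continuous_on S (\<lambda>x. (\<chi> k l. if l = i then axis j 1 $ k else f x $ k $ l :: real^'n^'n) $ k $ l)" for k l
      using entry by (cases "l = i") auto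
  qed
  then have "continuous_on S (\<lambda>x. det (\<chi> k l. if l = i then axis j 1 $ k else f x $ k $ l) / det (f x))"
    using f nz by (intro continuous_on_divide continuous_on_det) auto
  then show "continuous_on S (\<lambda>x. matrix_inv (f x) $ i $ j)"
    by (rule continuous_on_cong[THEN iffD1, rotated -1, OF _ refl]) (simp add: matrix_inv_component nz)
qed

lemma continuous_on_matrix_mult [continuous_intros]:
  fixes f :: "'a::topological_space \<Rightarrow> real^'n^'m" and g :: "'a \<Rightarrow> real^'k^'n"
  shows "continuous_on S f \<Longrightarrow> continuous_on S g \<Longrightarrow> continuous_on S (\<lambda>x. f x ** g x)"
  by (rule continuous_on_vec_entries) (simp add: matrix_matrix_mult_def, intro continuous_intros)

lemma continuous_on_trace [continuous_intros]:
  fixes f :: "'a::topological_space \<Rightarrow> real^'n^'n"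
  shows "continuous_on S f \<Longrightarrow> continuous_on S (\<lambda>x. trace (f x))"
  unfolding trace_def by (intro continuous_intros)

text \<open>Jacobi's formula. The product rule in the Leibniz expansion gives one determinant for
  each row \<open>i\<close>, with that row replaced by its derivative. Since
  \<open>b = (b ** matrix_inv A) ** A\<close>, the new row is a combination of the rows of
  \<open>A\<close>, and only the coefficient of row \<open>i\<close> survives in the
  determinant.\<close>

lemma det_has_real_derivative:
  fixes a :: "real \<Rightarrow> real^'n^'n"
  assumes a: "(a has_vector_derivative b) (at t within S)" and nz: "det (a t) \<noteq> 0"
  shows "((\<lambda>s. det (a s)) has_real_derivative det (a t) * trace (matrix_inv (a t) ** b)) (at t within S)"
proof -
  define A where "A = a t"
  have entry: "((\<lambda>s. a s $ i $ j) has_real_derivative b $ i $ j) (at t within S)" for i j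
    using bounded_linear.has_vector_derivative[OF bounded_linear_vec_nth
        bounded_linear.has_vector_derivative[OF bounded_linear_vec_nth a, of i], of j]
    by (simp add: has_real_derivative_iff_has_vector_derivative)
  have "((\<lambda>s. det (a s)) has_real_derivative
     (\<Sum>p | p permutes UNIV. of_int (sign p) * (\<Sum>i\<in>UNIV. b $ i $ p i * (\<Prod>j\<in>UNIV - {i}. A $ j $ p j))))
       (at t within S)"
    unfolding det_def A_def
    using entry unfolding has_field_derivative_def
    by (auto intro!: derivative_eq_intros ext simp: mult_ac sum_distrib_left sum_distrib_right)
  also have "(\<Sum>p | p permutes UNIV. of_int (sign p) * (\<Sum>i\<in>UNIV. b $ i $ p i * (\<Prod>j\<in>UNIV - {i}. A $ j $ p j)))
      = (\<Sum>i\<in>UNIV. \<Sum>p | p permutes UNIV. of_int (sign p) * (b $ i $ p i * (\<Prod>j\<in>UNIV - {i}. A $ j $ p j)))"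
    by (simp add: sum_distrib_left) (rule sum.swap)
  also have "\<dots> = (\<Sum>i\<in>UNIV. det (\<chi> k. if k = i then b $ i else A $ k))"
  proof (rule sum.cong[OF refl])
    fix i
    have "(\<Prod>k\<in>UNIV. (\<chi> k. if k = i then b $ i else A $ k) $ k $ p k)
        = b $ i $ p i * (\<Prod>j\<in>UNIV - {i}. A $ j $ p j)" for p
      by (subst prod.remove[of _ i]) auto
    then show "(\<Sum>p | p permutes UNIV. of_int (sign p) * (b $ i $ p i * (\<Prod>j\<in>UNIV - {i}. A $ j $ p j)))
        = det (\<chi> k. if k = i then b $ i else A $ k)"
      unfolding det_def by (simp only:)
  qed
  also have "\<dots> = (\<Sum>i\<in>UNIV. (b ** matrix_inv A) $ i $ i * det A)"
  proof (rule sum.cong[OF refl])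
    fix i
    have "b = (b ** matrix_inv A) ** A"
      using nz by (simp add: A_def matrix_mul_assoc[symmetric] matrix_inv_mult_left)
    moreover have "(m ** A) $ i = (\<Sum>k\<in>UNIV. m $ i $ k *s row k A)" for m :: "real^'n^'n"
      by (simp add: vec_eq_iff row_def matrix_matrix_mult_def)
    ultimately have bi: "b $ i = (\<Sum>k\<in>UNIV. (b ** matrix_inv A) $ i $ k *s row k A)"
      by metis
    have row: "row k A = A $ k" for k by (simp add: row_def vec_eq_iff)
    show "det (\<chi> k. if k = i then b $ i else A $ k) = (b ** matrix_inv A) $ i $ i * det A"
      using cramer_lemma_transpose[of i "(b ** matrix_inv A) $ i" A] unfolding bi[symmetric] unfolding row .
  qed
  also have "\<dots> = det A * trace (matrix_inv A ** b)"
    by (subst trace_mul_sym) (simp add: trace_def sum_distrib_left mult.commute)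
  finally show ?thesis by (simp add: A_def)
qed


section \<open>Paths of inner products\<close>

text \<open>The fourth root of the determinant is Lipschitz for the pointwise version of the \<open>L\<^sup>2\<close> metric.\<close>

definition det_root :: "real \<Rightarrow> real^'n^'n \<Rightarrow> real" where
  "det_root \<rho> a = sqrt (sqrt (det a / \<rho>))"

text \<open>This is \<open>(D N)^2\<close>, the density of the squared \<open>L^2\<close> speed with
  respect to the reference volume; \<open>\<rho>\<close> stands for the determinant of the reference
  metric in the chart in which \<open>a\<close> and \<open>b\<close> are written.\<close>

definition tensor_energy :: "real \<Rightarrow> real^'n^'n \<Rightarrow> real^'n^'n \<Rightarrow> real" where
  "tensor_energy \<rho> a b = sqrt (det a / \<rho>) * trace (matrix_inv a ** b ** matrix_inv a ** b)"

lemma tensor_energy_nonneg: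
  "pd_matrix a \<Longrightarrow> transpose b = b \<Longrightarrow> \<rho> > 0 \<Longrightarrow> tensor_energy \<rho> a b \<ge> 0"
  unfolding tensor_energy_def
  by (intro mult_nonneg_nonneg trace_square_nonneg) (auto dest: pd_det_pos)

text \<open>Integrability of the derivative comes from the fundamental theorem for the gauge
  integral itself, which tolerates the finitely many break points in \<open>T\<close>; domination by
  \<open>l\<close> then bounds the increment.\<close>

lemma increment_le_integral:
  fixes f :: "real \<Rightarrow> real"
  assumes "finite T" "continuous_on {0..1} f"
    and der: "\<And>t. t \<in> {0<..<1} - T \<Longrightarrow> (f has_real_derivative f' t) (at t)"
    and bound: "\<And>t. t \<in> {0<..<1} - T \<Longrightarrow> \<bar>f' t\<bar> \<le> l t"
    and l: "\<And>t. l t \<ge> 0" "l integrable_on {0..1}" and s: "s \<in> {0..1}"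
  shows "\<bar>f s - f 0\<bar> \<le> integral {0..1} l"
proof -
  \<comment> \<open>The default value \<open>0\<close> lets \<open>l\<close>, which is nonnegative,
    dominate \<open>h\<close> everywhere.\<close>
  define h where "h t = (if t \<in> {0<..<1} - T then f' t else 0)" for t
  have "(h has_integral (f s - f 0)) {0..s}"
  proof (rule fundamental_theorem_of_calculus_interior_strong[OF \<open>finite T\<close>])
    fix t assume "t \<in> {0<..<s} - T"
    then show "(f has_vector_derivative h t) (at t)"
      using der[of t] s by (simp add: h_def has_real_derivative_iff_has_vector_derivative)
  qed (use s assms(2) in \<open>auto elim: continuous_on_subset\<close>)
  then have "h integrable_on {0..s}" "f s - f 0 = integral {0..s} h"
    by (auto simp: integrable_on_def integral_unique)
  moreover have l': "l integrable_on {0..s}"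
    using l(2) s by (auto intro: integrable_on_subinterval)
  ultimately have "\<bar>f s - f 0\<bar> \<le> integral {0..s} l"
    using integral_norm_bound_integral[of h "{0..s}" l] bound l(1) by (auto simp: h_def)
  also have "\<dots> \<le> integral {0..1} l"
    using s l l' by (intro integral_subset_le) auto
  finally show ?thesis .
qed

text \<open>\<open>close_tensors \<rho> \<phi> a\<^sub>0 a\<^sub>1\<close> collects what is used about two inner products joined by a path
  of length \<open>\<phi>\<close> in the pointwise metric.\<close>

definition close_tensors :: "real \<Rightarrow> real \<Rightarrow> real^'n^'n \<Rightarrow> real^'n^'n \<Rightarrow> bool" where
  "close_tensors \<rho> \<phi> a0 a1 \<longleftrightarrow>
     \<bar>det_root \<rho> a1 - det_root \<rho> a0\<bar> \<le> sqrt CARD('n) / 4 * \<phi> \<and>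
     (\<forall>\<delta>>0. \<delta> + sqrt CARD('n) / 4 * \<phi> \<le> det_root \<rho> a0 \<longrightarrow>
       (\<forall>u. u \<noteq> 0 \<longrightarrow> \<bar>ln (u \<bullet> (a1 *v u)) - ln (u \<bullet> (a0 *v u))\<bar> \<le> \<phi> / \<delta>))"

text \<open>The bound on the fourth root of the determinant is proved for all times, not only for
  time \<open>1\<close>: it keeps \<open>det_root\<close> above \<open>\<delta>\<close> along the
  whole path, and this converts the bound \<open>N\<close> on the logarithmic derivative of a
  quadratic form into \<open>l / \<delta>\<close>.\<close>

lemma path_close_tensors:
  fixes a b :: "real \<Rightarrow> real^'n^'n"
  assumes T: "finite T" and cont: "continuous_on {0..1} a"
    and pd: "\<And>t. t \<in> {0..1} \<Longrightarrow> pd_matrix (a t)"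
    and der: "\<And>t. t \<in> {0<..<1} - T \<Longrightarrow> (a has_vector_derivative b t) (at t)"
    and sym: "\<And>t. t \<in> {0<..<1} - T \<Longrightarrow> transpose (b t) = b t"
    and \<rho>: "\<rho> > 0"
    and l: "\<And>t. l t \<ge> 0" "l integrable_on {0..1}"
      "\<And>t. t \<in> {0<..<1} - T \<Longrightarrow> l t = sqrt (tensor_energy \<rho> (a t) (b t))"
  shows "close_tensors \<rho> (integral {0..1} l) (a 0) (a 1)"
proof -
  let ?c = "sqrt CARD('n) / 4" and ?\<phi> = "integral {0..1} l"
  define N where "N t = sqrt (trace (matrix_inv (a t) ** b t ** matrix_inv (a t) ** b t))" for t
  have det: "det (a t) > 0" if "t \<in> {0..1}" for t using pd_det_pos pd that by blast
  have root_pos: "det_root \<rho> (a t) > 0" if "t \<in> {0..1}" for t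
    using det[OF that] \<rho> by (simp add: det_root_def)
  have l_eq: "l t = det_root \<rho> (a t) * N t" if "t \<in> {0<..<1} - T" for t
    using l(3)[OF that] by (simp add: tensor_energy_def det_root_def N_def real_sqrt_mult)
  have root: "\<bar>det_root \<rho> (a s) - det_root \<rho> (a 0)\<bar> \<le> ?c * ?\<phi>" if s: "s \<in> {0..1}" for s
  proof -
    \<comment> \<open>The derivative of the fourth root according to Jacobi's formula; the exponent
      contributes the factor \<open>1 / 4\<close>.\<close>
    define r where "r t = det_root \<rho> (a t) * trace (matrix_inv (a t) ** b t) / 4" for t
    have "\<bar>det_root \<rho> (a s) - det_root \<rho> (a 0)\<bar> \<le> integral {0..1} (\<lambda>t. ?c * l t)"
    proof (rule increment_le_integral[OF T, where f' = r])
      show "continuous_on {0..1} (\<lambda>t. det_root \<rho> (a t))"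
        unfolding det_root_def by (intro continuous_intros cont) (use \<rho> in auto)
    next
      fix t assume t: "t \<in> {0<..<1} - T"
      define D where "D = det (a t) / \<rho>"
      have D: "D > 0" using det[of t] t \<rho> by (simp add: D_def)
      have "((\<lambda>s. det (a s)) has_real_derivative det (a t) * trace (matrix_inv (a t) ** b t)) (at t)"
        using det_has_real_derivative[of a "b t" t UNIV] der[OF t] det[of t] t by simp
      then have d: "((\<lambda>s. det (a s) / \<rho>) has_real_derivative D * trace (matrix_inv (a t) ** b t)) (at t)"
        using DERIV_cdivide[of "\<lambda>s. det (a s)" _ t UNIV \<rho>] by (simp add: D_def)
      have "((\<lambda>s. sqrt (det (a s) / \<rho>)) has_real_derivative
          inverse (sqrt D) / 2 * (D * trace (matrix_inv (a t) ** b t))) (at t)"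
        using DERIV_chain2[OF DERIV_real_sqrt d] D by (simp add: D_def)
      from DERIV_chain2[OF DERIV_real_sqrt this] D
      have "((\<lambda>s. sqrt (sqrt (det (a s) / \<rho>))) has_real_derivative
          inverse (sqrt (sqrt D)) / 2 * (inverse (sqrt D) / 2 * (D * trace (matrix_inv (a t) ** b t)))) (at t)"
        by (simp add: D_def)
      moreover have "inverse (sqrt (sqrt D)) / 2 * (inverse (sqrt D) / 2 * (D * trace (matrix_inv (a t) ** b t))) = r t"
      proof -
        have "D = sqrt D * sqrt D" "sqrt D = sqrt (sqrt D) * sqrt (sqrt D)" using D by auto
        then have "inverse (sqrt (sqrt D)) * (inverse (sqrt D) * D) = sqrt (sqrt D)"
          using D by (metis (no_types, opaque_lifting) inverse_eq_divide mult.assoc mult.left_neutral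
              less_irrefl real_sqrt_gt_0_iff left_inverse)
        then have "inverse (sqrt (sqrt D)) / 2 * (inverse (sqrt D) / 2 * (D * x)) = sqrt (sqrt D) * x / 4" for x
          by (metis (no_types, opaque_lifting) divide_divide_eq_left mult.assoc numeral_Bit0 mult_2 times_divide_eq_left
              times_divide_eq_right numeral_times_numeral semiring_norm(13) semiring_norm(12))
        then show ?thesis by (simp add: r_def D_def det_root_def)
      qed
      ultimately show "((\<lambda>t. det_root \<rho> (a t)) has_real_derivative r t) (at t)"
        by (simp add: det_root_def)
      have "\<bar>trace (matrix_inv (a t) ** b t)\<bar> \<le> sqrt CARD('n) * N t"
        unfolding N_def using t by (intro trace_le_trace_square pd sym) auto
      then show "\<bar>r t\<bar> \<le> ?c * l t"
        using root_pos[of t] t by (simp add: r_def abs_mult l_eq)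
    next
      show "(\<lambda>t. ?c * l t) integrable_on {0..1}"
        using integrable_on_cmult_left[OF l(2), of ?c] by simp
    qed (use l s in auto)
    also have "\<dots> = ?c * ?\<phi>" by (rule integral_mult_right)
    finally show ?thesis .
  qed
  have log: "\<bar>ln (u \<bullet> (a 1 *v u)) - ln (u \<bullet> (a 0 *v u))\<bar> \<le> ?\<phi> / \<delta>"
    if \<delta>: "\<delta> > 0" "\<delta> + ?c * ?\<phi> \<le> det_root \<rho> (a 0)" and u: "u \<noteq> 0" for \<delta> u
  proof -
    have pos: "u \<bullet> (a t *v u) > 0" if "t \<in> {0..1}" for t
      using pd[OF that] u by (auto simp: pd_matrix_def)
    have lin: "bounded_linear (\<lambda>m :: real^'n^'n. u \<bullet> (m *v u))"
      by (rule linear_conv_bounded_linear[THEN iffD1])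
         (auto intro!: linearI simp: matrix_vector_mult_add_rdistrib inner_add_right scaleR_matrix_vector_assoc[symmetric])
    have "\<bar>ln (u \<bullet> (a 1 *v u)) - ln (u \<bullet> (a 0 *v u))\<bar> \<le> integral {0..1} (\<lambda>t. 1 / \<delta> * l t)"
    proof (rule increment_le_integral[OF T, where f' = "\<lambda>t. (u \<bullet> (b t *v u)) / (u \<bullet> (a t *v u))"])
      show "continuous_on {0..1} (\<lambda>t. ln (u \<bullet> (a t *v u)))"
        using pos by (intro continuous_on_ln bounded_linear.continuous_on[OF lin] cont) (metis less_irrefl)
    next
      fix t assume t: "t \<in> {0<..<1} - T"
      then have t': "t \<in> {0..1}" by auto
      have "((\<lambda>s. u \<bullet> (a s *v u)) has_real_derivative u \<bullet> (b t *v u)) (at t)"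
        using bounded_linear.has_vector_derivative[OF lin der[OF t]]
        by (simp add: has_real_derivative_iff_has_vector_derivative)
      from DERIV_chain2[OF DERIV_ln this] pos[OF t']
      show "((\<lambda>t. ln (u \<bullet> (a t *v u))) has_real_derivative (u \<bullet> (b t *v u)) / (u \<bullet> (a t *v u))) (at t)"
        by (simp add: divide_inverse mult.commute)
      have "\<bar>u \<bullet> (b t *v u)\<bar> \<le> (u \<bullet> (a t *v u)) * N t"
        unfolding N_def using t by (intro quadratic_form_le_trace_square pd sym) auto
      then have "\<bar>(u \<bullet> (b t *v u)) / (u \<bullet> (a t *v u))\<bar> \<le> N t"
        using pos[OF t'] by (simp add: abs_divide field_simps)
      also have "N t \<le> 1 / \<delta> * l t"
      proof -
        have "\<delta> \<le> det_root \<rho> (a t)" using \<delta> root[OF t'] by linarith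
        moreover have "N t \<ge> 0" unfolding N_def using t by (simp add: trace_square_nonneg pd sym)
        ultimately have "\<delta> * N t \<le> det_root \<rho> (a t) * N t" by (rule mult_right_mono)
        then show ?thesis using \<delta> by (simp add: l_eq[OF t] field_simps)
      qed
      finally show "\<bar>(u \<bullet> (b t *v u)) / (u \<bullet> (a t *v u))\<bar> \<le> 1 / \<delta> * l t" .
    next
      show "(\<lambda>t. 1 / \<delta> * l t) integrable_on {0..1}"
        using integrable_on_cmult_left[OF l(2), of "1 / \<delta>"] by simp
    qed (use l \<delta> in auto)
    also have "\<dots> = 1 / \<delta> * ?\<phi>" by (rule integral_mult_right)
    finally show ?thesis by simp
  qed
  show ?thesis unfolding close_tensors_def using root[of 1] log by auto
qed

lemma summable_diff_imp_convergent:
  fixes f :: "nat \<Rightarrow> real"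
  assumes "summable (\<lambda>n. f (Suc n) - f n)"
  shows "convergent f"
proof -
  have "(\<lambda>m. \<Sum>n<m. f (Suc n) - f n) \<longlonglongrightarrow> (\<Sum>n. f (Suc n) - f n)"
    using assms by (rule summable_LIMSEQ)
  then have "(\<lambda>m. (f m - f 0) + f 0) \<longlonglongrightarrow> (\<Sum>n. f (Suc n) - f n) + f 0"
    unfolding sum_lessThan_telescope by (rule tendsto_add[OF _ tendsto_const])
  then show ?thesis by (auto simp: convergent_def)
qed

text \<open>Once \<open>\<phi> k\<close> is small, the determinant condition in
  \<open>close_tensors\<close> holds with a fixed \<open>\<delta>\<close>, so the logarithms of each
  quadratic form have summable increments. Convergence of the logarithms excludes the limit
  \<open>0\<close>, whence the limit form is positive definite.\<close>

lemma close_tensors_convergent: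
  fixes a :: "nat \<Rightarrow> real^'n^'n"
  assumes pd: "\<And>k. pd_matrix (a k)" and \<rho>: "\<rho> > 0"
    and sum: "summable \<phi>" and close: "\<And>k. close_tensors \<rho> (\<phi> k) (a k) (a (Suc k))"
    and \<epsilon>: "\<epsilon> > 0" "\<And>k. det (a k) / \<rho> \<ge> \<epsilon>"
  obtains L where "a \<longlonglongrightarrow> L" "pd_matrix L"
proof -
  let ?c = "sqrt CARD('n) / 4"
  \<comment> \<open>Half of the lower bound for the fourth root serves as \<open>\<delta>\<close>;
    the other half absorbs the loss along a single step.\<close>
  define \<delta> where "\<delta> = sqrt (sqrt \<epsilon>) / 2"
  have \<delta>: "\<delta> > 0" using \<epsilon>(1) by (simp add: \<delta>_def)
  have root: "det_root \<rho> (a k) \<ge> 2 * \<delta>" for k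
    using \<epsilon>(2)[of k] by (simp add: \<delta>_def det_root_def)
  have "(\<lambda>k. ?c * \<phi> k) \<longlonglongrightarrow> ?c * 0"
    by (intro tendsto_mult tendsto_const summable_LIMSEQ_zero sum)
  then have ev: "\<forall>\<^sub>F k in sequentially. ?c * \<phi> k < \<delta>"
    by (rule order_tendstoD(2)) (simp add: \<delta>)
  have lim: "\<exists>y>0. (\<lambda>k. u \<bullet> (a k *v u)) \<longlonglongrightarrow> y" if u: "u \<noteq> 0" for u
  proof -
    define f where "f k = ln (u \<bullet> (a k *v u))" for k
    have "\<forall>\<^sub>F k in sequentially. norm (f (Suc k) - f k) \<le> 1 / \<delta> * \<phi> k"
      using ev
    proof eventually_elim
      case (elim k)
      then have "\<delta> + ?c * \<phi> k \<le> det_root \<rho> (a k)" using root[of k] by linarith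
      then show ?case using close[of k] \<delta> u unfolding close_tensors_def by (simp add: f_def)
    qed
    then have "summable (\<lambda>k. f (Suc k) - f k)"
      by (rule summable_comparison_test_ev) (intro summable_mult sum)
    then obtain y where "f \<longlonglongrightarrow> y" using summable_diff_imp_convergent convergent_def by blast
    then have "(\<lambda>k. exp (f k)) \<longlonglongrightarrow> exp y" by (rule tendsto_exp)
    moreover have "exp (f k) = u \<bullet> (a k *v u)" for k
      using pd[of k] u by (simp add: f_def pd_matrix_def)
    ultimately show ?thesis by (intro exI[of _ "exp y"]) simp
  qed
  have sym: "transpose (a k) = a k" for k using pd by (simp add: pd_matrix_def)
  have entry: "\<exists>y. (\<lambda>k. a k $ i $ j) \<longlonglongrightarrow> y" for i j
  proof -
    have q: "\<exists>y. (\<lambda>k. u \<bullet> (a k *v u)) \<longlonglongrightarrow> y" for u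
      using lim[of u] by (cases "u = 0") auto
    obtain x y z where xyz: "(\<lambda>k. (axis i 1 + axis j 1) \<bullet> (a k *v (axis i 1 + axis j 1))) \<longlonglongrightarrow> x"
      "(\<lambda>k. axis i 1 \<bullet> (a k *v axis i 1)) \<longlonglongrightarrow> y" "(\<lambda>k. axis j 1 \<bullet> (a k *v axis j 1)) \<longlonglongrightarrow> z"
      using q by metis
    \<comment> \<open>Polarization: the entries of a symmetric matrix are combinations of values of
      its quadratic form.\<close>
    have "a k $ i $ j = ((axis i 1 + axis j 1) \<bullet> (a k *v (axis i 1 + axis j 1))
        - axis i 1 \<bullet> (a k *v axis i 1) - axis j 1 \<bullet> (a k *v axis j 1)) / 2" for k
      unfolding quadratic_form_add[OF sym] by (simp add: quadratic_form_axis)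
    then show ?thesis using xyz by (auto intro!: exI[of _ "(x - y - z) / 2"] tendsto_intros simp del: eq_divide_eq_numeral1)
  qed
  define L :: "real^'n^'n" where "L = (\<chi> i j. lim (\<lambda>k. a k $ i $ j))"
  have "(\<lambda>k. a k $ i $ j) \<longlonglongrightarrow> L $ i $ j" for i j
    using entry[of i j] by (simp add: L_def convergent_def convergent_LIMSEQ_iff[symmetric])
  then have aL: "a \<longlonglongrightarrow> L" by (intro vec_tendstoI)
  have "pd_matrix L"
    unfolding pd_matrix_def
  proof (intro conjI allI impI)
    have "L $ j $ i = L $ i $ j" for i j
    proof -
      have "a k $ j $ i = a k $ i $ j" for k using sym[of k] by (metis transpose_def vec_lambda_beta)
      then show ?thesis by (simp add: L_def)
    qed
    then show "transpose L = L" by (simp add: transpose_def vec_eq_iff)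
    fix u :: "real^'n" assume u: "u \<noteq> 0"
    obtain y where y: "y > 0" "(\<lambda>k. u \<bullet> (a k *v u)) \<longlonglongrightarrow> y" using lim[OF u] by blast
    have "(\<lambda>k. u \<bullet> (a k *v u)) \<longlonglongrightarrow> u \<bullet> (L *v u)"
      unfolding inner_vec_def matrix_vector_mult_def
      by (auto intro!: tendsto_intros aL)
    with y show "u \<bullet> (L *v u) > 0" using LIMSEQ_unique by blast
  qed
  with aL that show thesis by blast
qed


section \<open>Integration\<close>

text \<open>At time \<open>t\<close>, the approximations use the value at the largest multiple of \<open>1 / (m + 1)\<close> below \<open>t\<close>.\<close>

lemma measurable_Caratheodory:
  fixes F :: "real \<Rightarrow> 'a \<Rightarrow> real"
  assumes U: "open U"
    and meas: "\<And>t. t \<in> U \<Longrightarrow> F t \<in> borel_measurable M"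
    and cont: "\<And>x. x \<in> space M \<Longrightarrow> continuous_on U (\<lambda>t. F t x)"
  shows "(\<lambda>(t, x). if t \<in> U then F t x else 0) \<in> borel_measurable (borel \<Otimes>\<^sub>M M)"
proof -
  define q :: "nat \<Rightarrow> real \<Rightarrow> real" where "q m t = real_of_int \<lfloor>real (Suc m) * t\<rfloor> / real (Suc m)" for m t
  have q_lim: "(\<lambda>m. q m t) \<longlonglongrightarrow> t" for t
  proof (rule LIMSEQ_I)
    fix e :: real assume "e > 0"
    then obtain N where N: "inverse (real (Suc N)) < e" using reals_Archimedean by blast
    have "norm (q m t - t) < e" if "m \<ge> N" for m
    proof -
      have "\<bar>real_of_int \<lfloor>n * t\<rfloor> / n - t\<bar> \<le> 1 / n" if "n > 0" for n :: real
      proof -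
        have "n * t - 1 \<le> real_of_int \<lfloor>n * t\<rfloor>" "real_of_int \<lfloor>n * t\<rfloor> \<le> n * t" by linarith+
        then have "t - 1 / n \<le> real_of_int \<lfloor>n * t\<rfloor> / n" "real_of_int \<lfloor>n * t\<rfloor> / n \<le> t"
          using divide_right_mono[of "n * t - 1" _ n] divide_right_mono[of _ "n * t" n] that
          by (simp_all add: diff_divide_distrib)
        then show ?thesis using that by (simp add: abs_le_iff)
      qed
      then have "\<bar>q m t - t\<bar> \<le> 1 / real (Suc m)" unfolding q_def by simp
      also have "\<dots> \<le> inverse (real (Suc N))" using that by (simp add: field_simps)
      finally show ?thesis using N by simp
    qed
    then show "\<exists>N. \<forall>m\<ge>N. norm (q m t - t) < e" by blast
  qed
  \<comment> \<open>Rounding can lead out of \<open>U\<close>. The value \<open>0\<close> used in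
    that case does no harm, because \<open>U\<close> is open and the rounded times eventually lie in
    it.\<close>
  define G where "G = (\<lambda>m (t, x). if t \<in> U then (if q m t \<in> U then F (q m t) x else 0) else 0)"
  have U_meas [measurable]: "U \<in> sets borel" using U by simp
  have "G m \<in> borel_measurable (borel \<Otimes>\<^sub>M M)" for m
  proof -
    \<comment> \<open>For fixed \<open>m\<close> the rounded time takes only the countably many
      values \<open>i / (m + 1)\<close>, so \<open>G m\<close> is glued from countably many
      measurable functions of the point.\<close>
    define H where "H = (\<lambda>i (p :: real \<times> 'a). if real_of_int i / real (Suc m) \<in> U
        then F (real_of_int i / real (Suc m)) (snd p) else 0)"
    have H: "H i \<in> borel_measurable (borel \<Otimes>\<^sub>M M)" for i :: int
    proof (cases "real_of_int i / real (Suc m) \<in> U")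
      case True
      then show ?thesis using measurable_compose[OF measurable_snd meas[OF True]] by (simp add: H_def)
    qed (simp add: H_def)
    have "(\<lambda>p. H \<lfloor>real (Suc m) * fst p\<rfloor> p) \<in> borel_measurable (borel \<Otimes>\<^sub>M M)"
      by (rule measurable_compose_countable[OF H]) measurable
    then have "(\<lambda>p. if fst p \<in> U then H \<lfloor>real (Suc m) * fst p\<rfloor> p else 0) \<in> borel_measurable (borel \<Otimes>\<^sub>M M)"
      by measurable
    also have "(\<lambda>p. if fst p \<in> U then H \<lfloor>real (Suc m) * fst p\<rfloor> p else 0) = G m"
      by (auto simp: G_def H_def q_def fun_eq_iff)
    finally show ?thesis .
  qed
  then show ?thesis
  proof (rule borel_measurable_LIMSEQ_metric)
    fix p assume p: "p \<in> space (borel \<Otimes>\<^sub>M M :: (real \<times> 'a) measure)"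
    obtain t x where tx: "p = (t, x)" by force
    show "(\<lambda>m. G m p) \<longlonglongrightarrow> (case p of (t, x) \<Rightarrow> if t \<in> U then F t x else 0)"
    proof (cases "t \<in> U")
      case True
      have "isCont (\<lambda>t. F t x) t"
        using cont[of x] p tx True U by (auto simp: space_pair_measure continuous_on_eq_continuous_at)
      then have "(\<lambda>m. F (q m t) x) \<longlonglongrightarrow> F t x" using q_lim by (rule isCont_tendsto_compose)
      moreover have "\<forall>\<^sub>F m in sequentially. q m t \<in> U"
        using q_lim U True by (rule topological_tendstoD)
      then have "\<forall>\<^sub>F m in sequentially. F (q m t) x = G m p"
        by eventually_elim (simp add: G_def tx True)
      ultimately show ?thesis using True tx by (auto elim: Lim_transform_eventually)
    qed (simp add: G_def tx)
  qed
qed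

lemma ennreal_square_le_imp_le:
  fixes x y :: ennreal
  assumes "x\<^sup>2 \<le> y\<^sup>2"
  shows "x \<le> y"
proof (cases y)
  case (real s)
  then have "x \<noteq> top" using assms by (auto simp: ennreal_power top_unique)
  then obtain r where "x = ennreal r" "r \<ge> 0" by (cases x) auto
  with real assms show ?thesis by (simp add: ennreal_power power2_le_iff_abs_le)
qed simp

text \<open>Writing the square of an integral as a double integral reduces Minkowski's integral inequality
  to Cauchy--Schwarz.\<close>

lemma nn_integral_square_le:
  fixes f :: "real \<Rightarrow> 'a \<Rightarrow> ennreal" and L :: "real \<Rightarrow> ennreal"
  assumes "sigma_finite_measure M"
    and f [measurable]: "(\<lambda>(t, x). f t x) \<in> borel_measurable (borel \<Otimes>\<^sub>M M)"
    and L [measurable]: "L \<in> borel_measurable borel"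
    and le: "\<And>t. (\<integral>\<^sup>+x. (f t x)\<^sup>2 \<partial>M) \<le> (L t)\<^sup>2"
  shows "(\<integral>\<^sup>+x. (\<integral>\<^sup>+t. f t x \<partial>lborel)\<^sup>2 \<partial>M) \<le> (\<integral>\<^sup>+t. L t \<partial>lborel)\<^sup>2"
proof -
  interpret M: sigma_finite_measure M by fact
  interpret pair_sigma_finite lborel M by standard
  have f1 [measurable]: "(\<lambda>(t, x). f t x) \<in> borel_measurable (lborel \<Otimes>\<^sub>M M)"
    using f by (simp cong: measurable_cong_sets sets_pair_measure_cong)
  have fx [measurable]: "f t \<in> borel_measurable M" for t
    using measurable_compose[OF measurable_Pair1'[of t lborel M] f1] by simp
  have ft [measurable]: "(\<lambda>t. f t x) \<in> borel_measurable lborel" if "x \<in> space M" for x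
    using measurable_compose[OF measurable_Pair2'[OF that, of lborel] f1] by simp
  have prod: "(\<integral>\<^sup>+x. f t x * f s x \<partial>M) \<le> L t * L s" for t s
  proof -
    have "(\<integral>\<^sup>+x. f t x * f s x \<partial>M)\<^sup>2 \<le> (\<integral>\<^sup>+x. (f t x)\<^sup>2 \<partial>M) * (\<integral>\<^sup>+x. (f s x)\<^sup>2 \<partial>M)"
      by (rule Cauchy_Schwarz_nn_integral) measurable
    also have "\<dots> \<le> (L t)\<^sup>2 * (L s)\<^sup>2" by (intro mult_mono le) auto
    finally have "(\<integral>\<^sup>+x. f t x * f s x \<partial>M)\<^sup>2 \<le> (L t * L s)\<^sup>2" by (simp add: power_mult_distrib)
    then show ?thesis by (rule ennreal_square_le_imp_le)
  qed
  have "(\<integral>\<^sup>+x. (\<integral>\<^sup>+t. f t x \<partial>lborel)\<^sup>2 \<partial>M) = (\<integral>\<^sup>+x. \<integral>\<^sup>+t. f t x * (\<integral>\<^sup>+s. f s x \<partial>lborel) \<partial>lborel \<partial>M)"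
    by (intro nn_integral_cong) (simp add: power2_eq_square nn_integral_multc)
  also have "\<dots> = (\<integral>\<^sup>+t. \<integral>\<^sup>+x. f t x * (\<integral>\<^sup>+s. f s x \<partial>lborel) \<partial>M \<partial>lborel)"
    by (rule Fubini'[of "\<lambda>t x. f t x * (\<integral>\<^sup>+s. f s x \<partial>lborel)"]) measurable
  also have "\<dots> = (\<integral>\<^sup>+t. \<integral>\<^sup>+s. \<integral>\<^sup>+x. f t x * f s x \<partial>M \<partial>lborel \<partial>lborel)"
  proof (rule nn_integral_cong)
    fix t
    have "(\<integral>\<^sup>+x. f t x * (\<integral>\<^sup>+s. f s x \<partial>lborel) \<partial>M) = (\<integral>\<^sup>+x. \<integral>\<^sup>+s. f t x * f s x \<partial>lborel \<partial>M)"
      by (intro nn_integral_cong) (simp add: nn_integral_cmult)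
    also have "\<dots> = (\<integral>\<^sup>+s. \<integral>\<^sup>+x. f t x * f s x \<partial>M \<partial>lborel)"
      by (rule Fubini'[of "\<lambda>s x. f t x * f s x"]) measurable
    finally show "(\<integral>\<^sup>+x. f t x * (\<integral>\<^sup>+s. f s x \<partial>lborel) \<partial>M) = (\<integral>\<^sup>+s. \<integral>\<^sup>+x. f t x * f s x \<partial>M \<partial>lborel)" .
  qed
  also have "\<dots> \<le> (\<integral>\<^sup>+t. \<integral>\<^sup>+s. L t * L s \<partial>lborel \<partial>lborel)"
    by (intro nn_integral_mono prod)
  also have "\<dots> = (\<integral>\<^sup>+t. L t \<partial>lborel)\<^sup>2"
    by (simp add: nn_integral_cmult nn_integral_multc power2_eq_square)
  finally show ?thesis .
qed


section \<open>Change of variables\<close>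

text \<open>The library states the change of variables formula for well-ordered index types, so it is
  carried over to an arbitrary finite index type through a well-ordered copy.\<close>

typedef 'n ordered_copy = "UNIV :: 'n set" by simp

instantiation ordered_copy :: (finite) wellorder
begin

definition position :: "'a \<Rightarrow> nat" where "position = (SOME f. inj f)"

definition less_eq_ordered_copy :: "'a ordered_copy \<Rightarrow> 'a ordered_copy \<Rightarrow> bool" where
  "x \<le> y \<longleftrightarrow> position (Rep_ordered_copy x) \<le> position (Rep_ordered_copy y)"

definition less_ordered_copy :: "'a ordered_copy \<Rightarrow> 'a ordered_copy \<Rightarrow> bool" where
  "x < y \<longleftrightarrow> position (Rep_ordered_copy x) < position (Rep_ordered_copy y)"

instance
proof
  have "\<exists>f :: 'a \<Rightarrow> nat. inj f" using finite_imp_inj_to_nat_seg[of "UNIV :: 'a set"] by auto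
  then have "inj (position :: 'a \<Rightarrow> nat)" unfolding position_def by (rule someI_ex)
  then show "x \<le> y \<Longrightarrow> y \<le> x \<Longrightarrow> x = y" for x y :: "'a ordered_copy"
    by (simp add: less_eq_ordered_copy_def inj_eq Rep_ordered_copy_inject)
  show "P x" if "\<And>x. (\<And>y. y < x \<Longrightarrow> P y) \<Longrightarrow> P x" for P and x :: "'a ordered_copy"
    using that by (induction "position (Rep_ordered_copy x)" arbitrary: x rule: less_induct)
      (metis less_ordered_copy_def)
qed (auto simp: less_eq_ordered_copy_def less_ordered_copy_def)

end

instance ordered_copy :: (finite) finite
proof
  have "(UNIV :: 'a ordered_copy set) = range Abs_ordered_copy"
    by (metis Abs_ordered_copy_cases surj_def)
  then show "finite (UNIV :: 'a ordered_copy set)" by (metis finite finite_imageI)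
qed

definition to_copy :: "real^'n \<Rightarrow> real^'n::finite ordered_copy" where
  "to_copy x = (\<chi> i. x $ Rep_ordered_copy i)"

definition of_copy :: "real^'n::finite ordered_copy \<Rightarrow> real^'n" where
  "of_copy x = (\<chi> i. x $ Abs_ordered_copy i)"

lemma to_of_copy [simp]: "to_copy (of_copy x) = x" "of_copy (to_copy y) = y"
  by (simp_all add: to_copy_def of_copy_def vec_eq_iff Abs_ordered_copy_inverse Rep_ordered_copy_inverse)

lemma linear_to_copy: "linear to_copy" and linear_of_copy: "linear of_copy"
  by (auto intro!: linearI simp: to_copy_def of_copy_def vec_eq_iff)

lemma bij_Rep_ordered_copy: "bij Rep_ordered_copy"
  by (metis Abs_ordered_copy_inverse Rep_ordered_copy_inject UNIV_I bijI' )

lemma prod_Basis_vec: "(\<Prod>b\<in>Basis. x \<bullet> b) = (\<Prod>i\<in>UNIV. x $ i)" for x :: "real^'n"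
proof -
  have "(Basis :: (real^'n) set) = range (\<lambda>i. axis i 1)" by (auto simp: Basis_vec_def)
  moreover have "inj (\<lambda>i. axis i (1 :: real) :: real^'n)" by (auto intro: injI simp: axis_eq_axis)
  ultimately show ?thesis
    using prod.reindex[of "\<lambda>i. axis i (1 :: real)" UNIV "\<lambda>b. x \<bullet> b"] by (simp add: inner_axis o_def)
qed

lemma borel_measurable_to_copy [measurable]: "to_copy \<in> borel_measurable borel"
  and borel_measurable_of_copy [measurable]: "of_copy \<in> borel_measurable borel"
  using linear_continuous_on[OF linear_to_copy[unfolded linear_conv_bounded_linear]]
    linear_continuous_on[OF linear_of_copy[unfolded linear_conv_bounded_linear]]
  by (auto intro: borel_measurable_continuous_onI)

text \<open>Relabelling coordinates carries boxes to boxes with the same side lengths, and the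
  values on boxes determine \<open>lborel\<close>.\<close>

lemma distr_lborel_to_copy: "distr lborel borel to_copy = (lborel :: (real^'n::finite ordered_copy) measure)"
proof (rule lborel_eqI[symmetric])
  fix l u :: "real^'n ordered_copy"
  assume le: "\<And>b. b \<in> Basis \<Longrightarrow> l \<bullet> b \<le> u \<bullet> b"
  have le': "l $ i \<le> u $ i" for i
  proof -
    have "axis i 1 \<in> (Basis :: (real^'n ordered_copy) set)" by (auto simp: Basis_vec_def)
    from le[OF this] show ?thesis by (simp add: inner_axis)
  qed
  have box: "to_copy -` box l u = box (of_copy l) (of_copy u)"
  proof -
    have "(\<forall>i. l $ i < to_copy x $ i \<and> to_copy x $ i < u $ i)
        \<longleftrightarrow> (\<forall>i. of_copy l $ i < x $ i \<and> x $ i < of_copy u $ i)" for x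
      unfolding to_copy_def of_copy_def
      by simp (metis Abs_ordered_copy_inverse Rep_ordered_copy_inverse UNIV_I)
    then show ?thesis by (auto simp: mem_box_cart)
  qed
  have "emeasure (distr lborel borel to_copy) (box l u) = emeasure lborel (box (of_copy l) (of_copy u))"
    by (simp add: emeasure_distr box)
  also have "\<dots> = ennreal (\<Prod>b\<in>Basis. (of_copy u - of_copy l) \<bullet> b)"
    using le' by (subst emeasure_lborel_box) (auto simp: Basis_vec_def inner_axis of_copy_def)
  also have "(\<Prod>b\<in>Basis. (of_copy u - of_copy l) \<bullet> b) = (\<Prod>i\<in>UNIV. (u - l) $ Abs_ordered_copy i)"
    unfolding prod_Basis_vec by (simp add: of_copy_def)
  also have "\<dots> = (\<Prod>j\<in>UNIV. (u - l) $ j)"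
    by (rule prod.reindex_bij_betw)
      (metis Abs_ordered_copy_inject Rep_ordered_copy_inverse UNIV_I bijI')
  finally show "emeasure (distr lborel borel to_copy) (box l u) = (\<Prod>b\<in>Basis. (u - l) \<bullet> b)"
    unfolding prod_Basis_vec by simp
qed simp

text \<open>Conjugation with the relabelling is a sign preserving bijection between the permutations
  of the two index types, so the Leibniz sums agree term by term.\<close>

lemma det_ordered_copy:
  fixes m :: "real^'n^'n"
  shows "det (\<chi> i j. m $ Rep_ordered_copy i $ Rep_ordered_copy j) = det m"
proof -
  let ?R = "Rep_ordered_copy :: 'n ordered_copy \<Rightarrow> 'n"
  define f where "f p = map_permutation UNIV ?R p" for p
  have f: "f p = ?R \<circ> p \<circ> inv ?R" for p
    using bij_Rep_ordered_copy by (auto simp: f_def map_permutation_def restrict_id_def fun_eq_iff bij_def)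
  have fR: "f p (?R i) = ?R (p i)" for p i
    by (simp add: f inv_f_f[OF bij_is_inj[OF bij_Rep_ordered_copy]])
  have "bij_betw f {p. p permutes UNIV} {p. p permutes UNIV}"
  proof (rule bij_betwI[where g = "\<lambda>p. inv ?R \<circ> p \<circ> ?R"])
    show "f \<in> {p. p permutes UNIV} \<rightarrow> {p. p permutes UNIV}"
      using map_permutation_permutes[OF bij_Rep_ordered_copy] by (auto simp: f_def)
    show "(\<lambda>p. inv ?R \<circ> p \<circ> ?R) \<in> {p. p permutes UNIV} \<rightarrow> {p. p permutes UNIV}"
      using bij_Rep_ordered_copy by (auto simp: permutes_univ bij_iff[symmetric] intro!: bij_comp bij_imp_bij_inv)
  qed (auto simp: f fun_eq_iff inv_f_f[OF bij_is_inj[OF bij_Rep_ordered_copy]]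
      surj_f_inv_f[OF bij_is_surj[OF bij_Rep_ordered_copy]])
  then have "det m = (\<Sum>p | p permutes (UNIV :: 'n ordered_copy set).
      of_int (sign (f p)) * (\<Prod>i\<in>UNIV. m $ i $ f p i))"
    unfolding det_def by (rule sum.reindex_bij_betw[symmetric])
  also have "\<dots> = (\<Sum>p | p permutes (UNIV :: 'n ordered_copy set).
      of_int (sign p) * (\<Prod>i\<in>UNIV. m $ ?R i $ ?R (p i)))"
  proof (rule sum.cong[OF refl])
    fix p :: "'n ordered_copy \<Rightarrow> 'n ordered_copy" assume "p \<in> {p. p permutes UNIV}"
    then have "sign (f p) = sign p"
      unfolding f_def using bij_Rep_ordered_copy by (intro sign_map_permutation) (auto simp: bij_def)
    moreover have "(\<Prod>i\<in>UNIV. m $ i $ f p i) = (\<Prod>i\<in>UNIV. m $ ?R i $ f p (?R i))"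
      using bij_Rep_ordered_copy by (rule prod.reindex_bij_betw[symmetric])
    ultimately show "of_int (sign (f p)) * (\<Prod>i\<in>UNIV. m $ i $ f p i) =
        of_int (sign p) * (\<Prod>i\<in>UNIV. m $ ?R i $ ?R (p i))" by (simp add: fR)
  qed
  finally show ?thesis by (simp add: det_def)
qed

text \<open>By change of variables the integral is the Lebesgue measure of the image of
  \<open>S\<close>, and a bounded image has finite measure. The lemma controls the Jacobian factor
  of the transition maps in the proof that metrics have finite volume.\<close>

lemma nn_integral_det_jacobian_finite:
  fixes T :: "real^'n::finite \<Rightarrow> real^'n"
  assumes S: "S \<in> sets borel"
    and der: "\<And>y. y \<in> S \<Longrightarrow> (T has_derivative T' y) (at y)"
    and inj: "inj_on T S"
    and meas: "(\<lambda>y. \<bar>det (matrix (T' y))\<bar> * indicator S y) \<in> borel_measurable borel"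
    and image: "T ` S \<in> sets borel" "bounded (T ` S)"
  shows "(\<integral>\<^sup>+y. ennreal (\<bar>det (matrix (T' y))\<bar> * indicator S y) \<partial>lborel) < \<infinity>"
proof -
  define R where "R = to_copy ` S"
  define V where "V = to_copy \<circ> T \<circ> of_copy"
  define V' where "V' x = to_copy \<circ> T' (of_copy x) \<circ> of_copy" for x
  have image_eq: "to_copy ` X = of_copy -` X" for X :: "(real^'n) set"
    by (auto intro: image_eqI[of _ _ "of_copy _"])
  have R: "R \<in> sets borel" unfolding R_def image_eq using S measurable_sets[OF borel_measurable_of_copy] by auto
  have VR: "V ` R = to_copy ` T ` S" by (auto simp: V_def R_def image_comp o_def)
  then have VR_meas: "V ` R \<in> sets borel"
    unfolding VR image_eq using image(1) measurable_sets[OF borel_measurable_of_copy] by auto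
  have VR_bdd: "bounded (V ` R)"
    unfolding VR using image(2) linear_to_copy by (rule bounded_linear_image[OF _ linear_conv_bounded_linear[THEN iffD1]])
  \<comment> \<open>The function integrated over the image is the constant \<open>1\<close>; it
    takes values in \<open>real^1\<close> because the change of variables formula is stated for
    vector-valued functions.\<close>
  have "(\<lambda>_. 1 :: real^1) absolutely_integrable_on (V ` R)"
    using VR_meas VR_bdd bounded_set_imp_lmeasurable[of "V ` R"]
    by (intro absolutely_integrable_on_const) auto
  moreover have derV: "(V has_derivative V' x) (at x within R)" if "x \<in> R" for x
  proof -
    have "of_copy x \<in> S" using that by (auto simp: R_def)
    then have "(V has_derivative V' x) (at x)"
      unfolding V_def V'_def
      by (intro diff_chain_at der linear_imp_has_derivative linear_to_copy linear_of_copy)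
    then show ?thesis by (rule has_derivative_at_withinI)
  qed
  moreover have "inj_on V R"
    using inj unfolding V_def R_def inj_on_def by (auto simp: o_def) (metis to_of_copy(2))
  ultimately have "(\<lambda>x. \<bar>det (matrix (V' x))\<bar> *\<^sub>R (1 :: real^1)) absolutely_integrable_on R"
    using absolutely_integrable_change_of_variables[of R V V' "\<lambda>_. 1 :: real^1"] R by simp
  then have "set_integrable lebesgue R (\<lambda>x. \<bar>det (matrix (V' x))\<bar> *\<^sub>R (1 :: real^1))" .
  then have "(\<integral>\<^sup>+x. ennreal (norm (indicat_real R x *\<^sub>R \<bar>det (matrix (V' x))\<bar> *\<^sub>R (1 :: real^1))) \<partial>lebesgue) < \<infinity>"
    unfolding set_integrable_def integrable_iff_bounded by simp
  also have "(\<lambda>x. ennreal (norm (indicat_real R x *\<^sub>R \<bar>det (matrix (V' x))\<bar> *\<^sub>R (1 :: real^1))))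
      = (\<lambda>x. ennreal (\<bar>det (matrix (T' (of_copy x)))\<bar> * indicator S (of_copy x)))"
  proof
    fix x :: "real^'n ordered_copy"
    have "matrix (V' x) = (\<chi> i j. matrix (T' (of_copy x)) $ Rep_ordered_copy i $ Rep_ordered_copy j)"
    proof -
      have e: "of_copy (axis j 1) = (axis (Rep_ordered_copy j) 1 :: real^'n)" for j
        by (auto simp: of_copy_def axis_def vec_eq_iff Rep_ordered_copy_inverse Abs_ordered_copy_inverse)
      then show ?thesis by (simp add: matrix_def V'_def e to_copy_def)
    qed
    then have "det (matrix (V' x)) = det (matrix (T' (of_copy x)))" by (simp add: det_ordered_copy)
    moreover have "x \<in> R \<longleftrightarrow> of_copy x \<in> S" by (simp add: R_def image_eq)
    moreover have "norm (1 :: real^1) = 1" by (simp add: norm_vec_def one_vec_def L2_set_def)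
    ultimately show "ennreal (norm (indicat_real R x *\<^sub>R \<bar>det (matrix (V' x))\<bar> *\<^sub>R (1 :: real^1)))
       = ennreal (\<bar>det (matrix (T' (of_copy x)))\<bar> * indicator S (of_copy x))"
      by (simp add: indicator_def)
  qed
  also have "(\<integral>\<^sup>+x. ennreal (\<bar>det (matrix (T' (of_copy x)))\<bar> * indicator S (of_copy x)) \<partial>lebesgue)
      = (\<integral>\<^sup>+x. ennreal (\<bar>det (matrix (T' (of_copy x)))\<bar> * indicator S (of_copy x)) \<partial>distr lborel borel to_copy)"
    using measurable_compose[OF borel_measurable_of_copy meas]
    by (subst nn_integral_completion) (auto simp: distr_lborel_to_copy)
  also have "\<dots> = (\<integral>\<^sup>+y. ennreal (\<bar>det (matrix (T' y))\<bar> * indicator S y) \<partial>lborel)"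
    using measurable_compose[OF borel_measurable_of_copy meas]
    by (subst nn_integral_distr) auto
  finally show ?thesis .
qed


section \<open>Charts and the volume measure\<close>

text \<open>Induction over nonnegative measurable functions: equality of the measures is the case of
  indicators, and suprema of monotone sequences commute with finite sums. The lemma splits integrals
  over the manifold into integrals over the pieces of the chart cover.\<close>

lemma nn_integral_sum_measure:
  fixes N :: "'i \<Rightarrow> 'a measure"
  assumes "finite I" and sets: "\<And>i. i \<in> I \<Longrightarrow> sets (N i) = sets M"
    and em: "\<And>E. E \<in> sets M \<Longrightarrow> emeasure M E = (\<Sum>i\<in>I. emeasure (N i) E)"
    and f: "f \<in> borel_measurable M"
  shows "nn_integral M f = (\<Sum>i\<in>I. nn_integral (N i) f)"
  using f
proof induction
  case (cong f g)
  have "nn_integral (N i) f = nn_integral (N i) g" if "i \<in> I" for i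
    using cong(3) sets_eq_imp_space_eq[OF sets[OF that]] by (intro nn_integral_cong) simp
  moreover have "nn_integral M f = nn_integral M g" using cong(3) by (rule nn_integral_cong)
  ultimately show ?case using cong by simp
next
  case (set E)
  then show ?case using em sets by simp
next
  case (mult u c)
  have "u \<in> borel_measurable (N i)" if "i \<in> I" for i
    using mult(2) sets[OF that] by (simp cong: measurable_cong_sets)
  then show ?case using mult by (simp add: nn_integral_cmult sum_distrib_left)
next
  case (add u v)
  have "u \<in> borel_measurable (N i)" "v \<in> borel_measurable (N i)" if "i \<in> I" for i
    using add(1,3) sets[OF that] by (simp_all cong: measurable_cong_sets)
  then show ?case using add by (simp add: nn_integral_add sum.distrib)
next
  case (seq U)
  have U: "U k \<in> borel_measurable (N i)" if "i \<in> I" for i k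
    using seq(1) sets[OF that] by (simp cong: measurable_cong_sets)
  have "nn_integral M (SUP k. U k) = (SUP k. nn_integral M (U k))"
    using seq by (subst nn_integral_monotone_convergence_SUP[symmetric]) (auto simp: image_comp SUP_apply[abs_def])
  also have "\<dots> = (SUP k. \<Sum>i\<in>I. nn_integral (N i) (U k))" by (simp only: seq.IH)
  also have "\<dots> = (\<Sum>i\<in>I. SUP k. nn_integral (N i) (U k))"
    using seq(3) by (intro ennreal_SUP_sum) (auto simp: incseq_def le_fun_def intro!: nn_integral_mono)
  also have "\<dots> = (\<Sum>i\<in>I. nn_integral (N i) (SUP k. U k))"
    using seq U by (intro sum.cong refl, subst nn_integral_monotone_convergence_SUP[symmetric])
      (auto simp: image_comp SUP_apply[abs_def])
  finally show ?case .
qed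

text \<open>\<open>matrix_inv a' ** b'\<close> is the conjugate of \<open>matrix_inv a ** b\<close>
  by \<open>J\<close>, and the trace is invariant under conjugation; the squared tensor norm is
  therefore independent of the chart.\<close>

lemma trace_congruence:
  fixes a b J :: "real^'n^'n"
  assumes J: "det J \<noteq> 0" and a: "det a \<noteq> 0"
    and a': "a' = transpose J ** a ** J" and b': "b' = transpose J ** b ** J"
  shows "trace (matrix_inv a' ** b' ** matrix_inv a' ** b') = trace (matrix_inv a ** b ** matrix_inv a ** b)"
proof -
  define K where "K = matrix_inv J"
  have JK: "J ** K = mat 1" "K ** J = mat 1"
    using J by (simp_all add: K_def matrix_inv_mult_left matrix_inv_mult_right)
  have JKt: "transpose K ** transpose J = mat 1"
    by (simp add: JK matrix_transpose_mul[symmetric] transpose_mat)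
  have "K ** matrix_inv a ** transpose K ** a' = K ** matrix_inv a ** (transpose K ** transpose J) ** a ** J"
    by (simp add: a' matrix_mul_assoc)
  also have "\<dots> = K ** (matrix_inv a ** a) ** J" by (simp add: JKt matrix_mul_assoc)
  also have "\<dots> = mat 1" using a by (simp add: matrix_inv_mult_left JK)
  finally have inv: "matrix_inv a' = K ** matrix_inv a ** transpose K" by (rule matrix_inv_eqI)
  define X where "X = matrix_inv a ** b"
  have "matrix_inv a' ** b' = K ** matrix_inv a ** (transpose K ** transpose J) ** b ** J"
    by (simp add: inv b' matrix_mul_assoc)
  then have e: "matrix_inv a' ** b' = K ** X ** J" by (simp add: JKt X_def matrix_mul_assoc)
  have "matrix_inv a' ** b' ** matrix_inv a' ** b' = K ** X ** J ** (K ** X ** J)"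
    unfolding e[symmetric] by (simp add: matrix_mul_assoc)
  also have "\<dots> = K ** X ** (J ** K) ** X ** J" by (simp add: matrix_mul_assoc)
  finally have "trace (matrix_inv a' ** b' ** matrix_inv a' ** b') = trace (K ** (X ** X ** J))"
    by (simp add: JK matrix_mul_assoc)
  also have "\<dots> = trace (X ** X ** (J ** K))"
    by (subst trace_mul_sym) (simp add: matrix_mul_assoc)
  finally show ?thesis by (simp add: JK X_def matrix_mul_assoc)
qed

section \<open>Charts and Lebesgue sets on the manifold\<close>

locale manifold =
  fixes A :: "('m::t2_space, 'n::finite) chart set"
  assumes manifold: "closed_oriented_manifold A"
begin

lemma compact_manifold: "compact (UNIV :: 'm set)"
  and chart: "c \<in> A \<Longrightarrow> is_chart c"
  and chart_exists: "\<exists>c\<in>A. x \<in> chart_dom c"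
  and smooth_transition: "c \<in> A \<Longrightarrow> c' \<in> A \<Longrightarrow>
    smooth_on (chart_map c ` (chart_dom c \<inter> chart_dom c')) (transition c c')"
  and det_jacobian_pos: "c \<in> A \<Longrightarrow> c' \<in> A \<Longrightarrow> x \<in> chart_dom c \<inter> chart_dom c' \<Longrightarrow>
    det (jacobian (transition c c') (at (chart_map c x))) > 0"
  using manifold unfolding closed_oriented_manifold_def by blast+

lemma
  assumes "c \<in> A"
  shows open_chart_dom: "open (chart_dom c)"
    and open_chart_img: "open (chart_img c)"
    and chart_inv_map: "x \<in> chart_dom c \<Longrightarrow> chart_inv c (chart_map c x) = x"
    and chart_map_inv: "y \<in> chart_img c \<Longrightarrow> chart_map c (chart_inv c y) = y"
    and chart_inv_in_dom: "y \<in> chart_img c \<Longrightarrow> chart_inv c y \<in> chart_dom c"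
    and chart_map_in_img: "x \<in> chart_dom c \<Longrightarrow> chart_map c x \<in> chart_img c"
    and continuous_chart_map: "continuous_on (chart_dom c) (chart_map c)"
    and continuous_chart_inv: "continuous_on (chart_img c) (chart_inv c)"
  using chart[OF assms] unfolding is_chart_def homeomorphism_def by blast+

text \<open>Images under a chart become preimages under its inverse, which is the form that
  measurability arguments need.\<close>

lemma chart_image_eq:
  assumes "c \<in> A"
  shows "chart_map c ` (E \<inter> chart_dom c) = {y \<in> chart_img c. chart_inv c y \<in> E}"
proof (intro equalityI subsetI)
  fix y assume "y \<in> chart_map c ` (E \<inter> chart_dom c)"
  then show "y \<in> {y \<in> chart_img c. chart_inv c y \<in> E}"
    using chart_inv_map[OF assms] chart_map_in_img[OF assms] by auto
next
  fix y assume "y \<in> {y \<in> chart_img c. chart_inv c y \<in> E}"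
  then show "y \<in> chart_map c ` (E \<inter> chart_dom c)"
    using chart_inv_in_dom[OF assms] chart_map_inv[OF assms] by (intro image_eqI[of _ _ "chart_inv c y"]) auto
qed

lemma chart_at: "chart_at A x \<in> A" "x \<in> chart_dom (chart_at A x)"
proof -
  have "\<exists>c. c \<in> A \<and> x \<in> chart_dom c" using chart_exists[of x] by blast
  then have "chart_at A x \<in> A \<and> x \<in> chart_dom (chart_at A x)"
    unfolding chart_at_def by (rule someI_ex)
  then show "chart_at A x \<in> A" "x \<in> chart_dom (chart_at A x)" by auto
qed

lemma open_chart_preimage:
  assumes "c \<in> A" "open W"
  shows "open {y \<in> chart_img c. chart_inv c y \<in> W}"
proof -
  have "{y \<in> chart_img c. chart_inv c y \<in> W} = chart_img c \<inter> chart_inv c -` W" by auto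
  then show ?thesis
    using continuous_open_preimage[OF continuous_chart_inv open_chart_img, OF assms(1) assms(1) assms(2)] by simp
qed

lemma borel_chart_preimage:
  assumes "c \<in> A" "B \<in> sets borel"
  shows "{y \<in> chart_img c. chart_inv c y \<in> B} \<in> sets borel"
proof -
  have "chart_inv c \<in> borel_measurable (restrict_space borel (chart_img c))"
    using continuous_chart_inv[OF assms(1)] by (rule borel_measurable_continuous_on_restrict)
  from measurable_sets[OF this assms(2)]
  have "chart_inv c -` B \<inter> chart_img c \<in> sets (restrict_space borel (chart_img c))"
    by (simp add: space_restrict_space)
  then have "chart_inv c -` B \<inter> chart_img c \<in> sets borel"
    using open_chart_img[OF assms(1)] by (subst (asm) sets_restrict_space_iff) auto
  moreover have "{y \<in> chart_img c. chart_inv c y \<in> B} = chart_inv c -` B \<inter> chart_img c" by auto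
  ultimately show ?thesis by simp
qed

lemma lebesgue_sets_iff:
  "E \<in> lebesgue_sets A \<longleftrightarrow> (\<forall>c\<in>A. {y \<in> chart_img c. chart_inv c y \<in> E} \<in> sets lebesgue)"
  unfolding lebesgue_sets_def by (simp add: chart_image_eq)

lemma sigma_algebra_lebesgue_sets: "sigma_algebra UNIV (lebesgue_sets A)"
  unfolding sigma_algebra_iff2
proof (intro conjI ballI allI impI)
  show "{} \<in> lebesgue_sets A" by (simp add: lebesgue_sets_iff)
next
  fix E assume E: "E \<in> lebesgue_sets A"
  show "UNIV - E \<in> lebesgue_sets A"
    unfolding lebesgue_sets_iff
  proof
    fix c assume c: "c \<in> A"
    then have "{y \<in> chart_img c. chart_inv c y \<in> E} \<in> sets lebesgue" "chart_img c \<in> sets lebesgue"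
      using E open_chart_img[OF c] by (simp_all add: lebesgue_sets_iff)
    then have "chart_img c - {y \<in> chart_img c. chart_inv c y \<in> E} \<in> sets lebesgue" by blast
    moreover have "{y \<in> chart_img c. chart_inv c y \<in> UNIV - E} = chart_img c - {y \<in> chart_img c. chart_inv c y \<in> E}"
      by auto
    ultimately show "{y \<in> chart_img c. chart_inv c y \<in> UNIV - E} \<in> sets lebesgue" by simp
  qed
next
  fix E :: "nat \<Rightarrow> 'm set" assume E: "range E \<subseteq> lebesgue_sets A"
  show "(\<Union>i. E i) \<in> lebesgue_sets A"
    unfolding lebesgue_sets_iff
  proof
    fix c assume c: "c \<in> A"
    have "{y \<in> chart_img c. chart_inv c y \<in> E i} \<in> sets lebesgue" for i
      using E c by (auto simp: image_subset_iff lebesgue_sets_iff)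
    then have "(\<Union>i. {y \<in> chart_img c. chart_inv c y \<in> E i}) \<in> sets lebesgue" by blast
    moreover have "{y \<in> chart_img c. chart_inv c y \<in> (\<Union>i. E i)} = (\<Union>i. {y \<in> chart_img c. chart_inv c y \<in> E i})"
      by auto
    ultimately show "{y \<in> chart_img c. chart_inv c y \<in> (\<Union>i. E i)} \<in> sets lebesgue" by simp
  qed
qed simp

text \<open>The measurable sets are the same for all tensor fields, so measurability passes freely
  from one volume measure to another.\<close>

lemma space_volume [simp]: "space (volume A h) = UNIV"
  and sets_volume [simp]: "sets (volume A h) = lebesgue_sets A"
  unfolding volume_def
  by (simp_all add: space_measure_of_conv sigma_algebra.sets_measure_of_eq[OF sigma_algebra_lebesgue_sets])

lemma borel_subset_lebesgue_sets: "B \<in> sets borel \<Longrightarrow> B \<in> lebesgue_sets A"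
proof -
  have "{S :: 'm set. open S} \<subseteq> lebesgue_sets A"
    using open_chart_preimage by (auto simp: lebesgue_sets_iff)
  from sigma_algebra.sigma_sets_subset[OF sigma_algebra_lebesgue_sets this]
  show "B \<in> sets borel \<Longrightarrow> B \<in> lebesgue_sets A" by (auto simp: borel_def)
qed

lemma measurable_volumeI:
  fixes f :: "'m \<Rightarrow> 'b::topological_space"
  assumes "\<And>c. c \<in> A \<Longrightarrow> (\<lambda>y. f (chart_inv c y)) \<in> borel_measurable (lebesgue_on (chart_img c))"
  shows "f \<in> borel_measurable (volume A h)"
proof (rule measurableI)
  fix B :: "'b set" assume B: "B \<in> sets borel"
  have "{y \<in> chart_img c. f (chart_inv c y) \<in> B} \<in> sets lebesgue" if "c \<in> A" for c
  proof -
    have "{y \<in> chart_img c. f (chart_inv c y) \<in> B}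
        = (\<lambda>y. f (chart_inv c y)) -` B \<inter> space (lebesgue_on (chart_img c))"
      by auto
    also have "\<dots> \<in> sets (lebesgue_on (chart_img c))" by (rule measurable_sets[OF assms[OF that] B])
    finally show ?thesis using open_chart_img[OF that] by (simp add: sets_restrict_space_iff)
  qed
  then show "f -` B \<inter> space (volume A h) \<in> sets (volume A h)" by (simp add: lebesgue_sets_iff)
qed simp

lemma measurable_chart_inv:
  assumes "c \<in> A" "sets N = lebesgue_sets A"
  shows "chart_inv c \<in> measurable (lebesgue_on (chart_img c)) N"
proof (rule measurableI)
  have N: "space N = UNIV"
    using assms(2) sets_eq_imp_space_eq[of N "volume A h" for h] by simp
  then show "chart_inv c x \<in> space N" for x by simp
  fix E assume "E \<in> sets N"
  have vimage_Int_chart: "chart_inv c -` E \<inter> chart_img c = {y \<in> chart_img c. chart_inv c y \<in> E}" by auto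
  from \<open>E \<in> sets N\<close> have "{y \<in> chart_img c. chart_inv c y \<in> E} \<in> sets lebesgue"
    using assms by (simp add: lebesgue_sets_iff)
  then show "chart_inv c -` E \<inter> space (lebesgue_on (chart_img c)) \<in> sets (lebesgue_on (chart_img c))"
    using open_chart_img[OF assms(1)] vimage_Int_chart by (simp add: sets_restrict_space_iff)
qed

section \<open>Tensors and determinants under a change of chart\<close>

lemma sym_tensor_transform:
  assumes "sym_tensor_field A h" "c \<in> A" "c' \<in> A" "x \<in> chart_dom c \<inter> chart_dom c'"
  shows "h x c = transpose (jacobian (transition c c') (at (chart_map c x))) ** h x c' **
    jacobian (transition c c') (at (chart_map c x))"
  using assms unfolding sym_tensor_field_def Let_def by blast

lemma det_tensor_transform:
  assumes "sym_tensor_field A h" "c \<in> A" "c' \<in> A" "x \<in> chart_dom c \<inter> chart_dom c'"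
  shows "det (h x c) = (det (jacobian (transition c c') (at (chart_map c x))))\<^sup>2 * det (h x c')"
  by (subst sym_tensor_transform[OF assms]) (simp add: det_mul power2_eq_square)

lemma metric_pd:
  assumes "h \<in> metrics A" "c \<in> A" "x \<in> chart_dom c"
  shows "pd_matrix (h x c)"
  using assms unfolding metrics_def smooth_tensors_def sym_tensor_field_def pos_def_at_def pd_matrix_def
  by blast

lemma metric_det_pos: "h \<in> metrics A \<Longrightarrow> c \<in> A \<Longrightarrow> x \<in> chart_dom c \<Longrightarrow> det (h x c) > 0"
  by (rule pd_det_pos[OF metric_pd])

lemma metric_sym: "h \<in> metrics A \<Longrightarrow> sym_tensor_field A h"
  by (simp add: metrics_def smooth_tensors_def)

text \<open>Both determinants acquire the same squared Jacobian factor under a change of chart, so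
  the quotient may be computed in any chart around \<open>x\<close>, not only in the chosen
  one.\<close>

lemma rel_det_eq:
  assumes g: "g \<in> metrics A" and h: "sym_tensor_field A h" and c: "c \<in> A" "x \<in> chart_dom c"
  shows "rel_det A g h x = det (h x c) / det (g x c)"
proof -
  let ?c = "chart_at A x"
  have "det (g x ?c) \<noteq> 0" using metric_det_pos[OF g chart_at, of x] by simp
  then have "det (matrix_inv (g x ?c)) * det (g x ?c) = 1"
    by (simp add: det_mul[symmetric] matrix_inv_mult_left)
  then have "rel_det A g h x = det (h x ?c) / det (g x ?c)"
    using metric_det_pos[OF g chart_at, of x]
    by (simp add: rel_det_def Let_def det_mul field_simps)
  also have "\<dots> = det (h x c) / det (g x c)"
    using det_jacobian_pos[OF chart_at(1)[of x] c(1), of x] chart_at[of x] c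
    by (simp add: det_tensor_transform[OF h chart_at(1) c(1)] det_tensor_transform[OF metric_sym[OF g] chart_at(1) c(1)])
  finally show ?thesis .
qed

lemma tensor_energy_chart:
  assumes g: "g \<in> metrics A" and h: "h \<in> metrics A" and k: "sym_tensor_field A k"
    and c: "c \<in> A" "x \<in> chart_dom c" "c' \<in> A" "x \<in> chart_dom c'"
  shows "tensor_energy (det (g x c)) (h x c) (k x c) = tensor_energy (det (g x c')) (h x c') (k x c')"
proof -
  have "det (h x c) / det (g x c) = det (h x c') / det (g x c')"
    using rel_det_eq[OF g metric_sym[OF h]] c by metis
  moreover have "trace (matrix_inv (h x c) ** k x c ** matrix_inv (h x c) ** k x c)
     = trace (matrix_inv (h x c') ** k x c' ** matrix_inv (h x c') ** k x c')"
    using det_jacobian_pos[of c c' x] metric_det_pos[OF h, of c' x] c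
    by (intro trace_congruence[where J = "jacobian (transition c c') (at (chart_map c x))"]
        sym_tensor_transform metric_sym h k) auto
  ultimately show ?thesis by (simp add: tensor_energy_def)
qed

lemma smooth_coords_continuous:
  assumes "h \<in> smooth_tensors A" "c \<in> A"
  shows "continuous_on (chart_img c) (coords c h)"
proof -
  have "coords c h differentiable (at y)" if "y \<in> chart_img c" for y
    using assms that unfolding smooth_tensors_def smooth_on_def by (metis (mono_tags, lifting) dderivs.simps(1) mem_Collect_eq)
  then show ?thesis
    by (simp add: continuous_at_imp_continuous_on differentiable_imp_continuous_within)
qed

lemma metric_coords_continuous: "h \<in> metrics A \<Longrightarrow> c \<in> A \<Longrightarrow> continuous_on (chart_img c) (coords c h)"
  by (rule smooth_coords_continuous) (simp add: metrics_def)

lemma metric_in_measurable_semimetrics: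
  assumes "h \<in> metrics A"
  shows "h \<in> measurable_semimetrics A"
proof -
  have "\<forall>x. pos_semidef_at A h x"
    using assms pd_imp_psd[OF metric_pd[OF assms]] by (auto simp: pos_semidef_at_def psd_matrix_def)
  moreover have "coords c h \<in> borel_measurable (lebesgue_on (chart_img c))" if "c \<in> A" for c
    using metric_coords_continuous[OF assms that] open_chart_img[OF that]
    by (intro continuous_imp_measurable_on_sets_lebesgue) auto
  ultimately show ?thesis using metric_sym[OF assms] by (simp add: measurable_semimetrics_def)
qed

section \<open>The volume as a sum of pushed-forward densities\<close>

lemma chart_cover: "set (chart_cover A) \<subseteq> A" "(\<Union>c\<in>set (chart_cover A). chart_dom c) = UNIV"
proof -
  have "UNIV \<subseteq> (\<Union>c\<in>A. chart_dom c)" using chart_exists by auto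
  then obtain C where "C \<subseteq> A" "finite C" "UNIV \<subseteq> (\<Union>c\<in>C. chart_dom c)"
    using compactE_image[OF compact_manifold, of A chart_dom] open_chart_dom by metis
  then obtain cs where "set cs \<subseteq> A \<and> (\<Union>c\<in>set cs. chart_dom c) = UNIV"
    using finite_list by (metis top.extremum_unique)
  then have "set (chart_cover A) \<subseteq> A \<and> (\<Union>c\<in>set (chart_cover A). chart_dom c) = UNIV"
    unfolding chart_cover_def by (rule someI)
  then show "set (chart_cover A) \<subseteq> A" "(\<Union>c\<in>set (chart_cover A). chart_dom c) = UNIV" by auto
qed

abbreviation "covering_chart i \<equiv> chart_cover A ! i"
abbreviation "covering_piece i \<equiv> chart_piece (chart_cover A) i"

lemma covering_chart: "i < length (chart_cover A) \<Longrightarrow> covering_chart i \<in> A"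
  using chart_cover(1) by auto

lemma covering_piece:
  assumes i: "i < length (chart_cover A)"
  shows "covering_piece i \<subseteq> chart_dom (covering_chart i)" "covering_piece i \<in> sets borel"
proof -
  show "covering_piece i \<subseteq> chart_dom (covering_chart i)" by (auto simp: chart_piece_def)
  have "chart_dom (covering_chart j) \<in> sets borel" if "j \<le> i" for j
    using open_chart_dom[OF covering_chart] that i by simp
  then show "covering_piece i \<in> sets borel" unfolding chart_piece_def by auto
qed

definition volume_density :: "('m, 'n) tensor_field \<Rightarrow> nat \<Rightarrow> real^'n \<Rightarrow> ennreal" where
  "volume_density h i y = ennreal (sqrt (det (coords (covering_chart i) h y)))
      * indicator (covering_piece i) (chart_inv (covering_chart i) y)"

text \<open>The contribution of one piece of the cover, built as a pushforward so that it is a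
  measure by construction.\<close>

definition volume_piece :: "('m, 'n) tensor_field \<Rightarrow> nat \<Rightarrow> 'm measure" where
  "volume_piece h i = distr (density (lebesgue_on (chart_img (covering_chart i))) (volume_density h i))
     (sigma UNIV (lebesgue_sets A)) (chart_inv (covering_chart i))"

lemma measurable_det_coords:
  assumes "h \<in> measurable_semimetrics A" "c \<in> A"
  shows "(\<lambda>y. det (coords c h y)) \<in> borel_measurable (lebesgue_on (chart_img c))"
proof -
  have "(det :: real^'n^'n \<Rightarrow> real) \<in> borel_measurable borel"
    by (intro borel_measurable_continuous_onI continuous_on_det continuous_on_id)
  with assms show ?thesis by (auto simp: measurable_semimetrics_def intro: measurable_compose)
qed

lemma measurable_volume_density:
  assumes h: "h \<in> measurable_semimetrics A" and i: "i < length (chart_cover A)"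
  shows "volume_density h i \<in> borel_measurable (lebesgue_on (chart_img (covering_chart i)))"
proof -
  have [measurable]: "(\<lambda>y. det (coords (covering_chart i) h y))
      \<in> borel_measurable (lebesgue_on (chart_img (covering_chart i)))"
    by (rule measurable_det_coords[OF h covering_chart[OF i]])
  have [measurable]: "chart_inv (covering_chart i)
      \<in> measurable (lebesgue_on (chart_img (covering_chart i))) (volume A h)"
    by (rule measurable_chart_inv[OF covering_chart[OF i]]) simp
  have [measurable]: "covering_piece i \<in> sets (volume A h)"
    using borel_subset_lebesgue_sets[OF covering_piece(2)[OF i]] by simp
  show ?thesis unfolding volume_density_def by measurable
qed

lemma sets_volume_piece: "sets (volume_piece h i) = lebesgue_sets A"
  unfolding volume_piece_def
  by (simp add: sigma_algebra.sets_measure_of_eq[OF sigma_algebra_lebesgue_sets])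

text \<open>\<open>measure_of\<close> keeps the given set function only if that function is
  countably additive. Additivity is inherited from the pieces, each of which is a pushforward
  measure with the prescribed values.\<close>

lemma emeasure_volume:
  assumes h: "h \<in> measurable_semimetrics A" and E: "E \<in> lebesgue_sets A"
  shows "emeasure (volume A h) E = (\<Sum>i<length (chart_cover A). emeasure (volume_piece h i) E)"
proof -
  let ?n = "length (chart_cover A)"
  have piece: "emeasure (volume_piece h i) E =
      (\<integral>\<^sup>+ y \<in> chart_map (covering_chart i) ` (E \<inter> covering_piece i).
          ennreal (sqrt (det (coords (covering_chart i) h y))) \<partial>lebesgue)"
    if i: "i < ?n" and E: "E \<in> lebesgue_sets A" for i E
  proof -
    let ?c = "covering_chart i"
    note c = covering_chart[OF i]
    have sigma: "sets (sigma UNIV (lebesgue_sets A)) = lebesgue_sets A"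
      by (simp add: sigma_algebra.sets_measure_of_eq[OF sigma_algebra_lebesgue_sets])
    have "emeasure (volume_piece h i) E
        = emeasure (density (lebesgue_on (chart_img ?c)) (volume_density h i))
            (chart_inv ?c -` E \<inter> chart_img ?c)"
      unfolding volume_piece_def using measurable_chart_inv[OF c sigma] E sigma
      by (subst emeasure_distr) auto
    also have "\<dots> = (\<integral>\<^sup>+y. volume_density h i y * indicator (chart_inv ?c -` E \<inter> chart_img ?c) y
        \<partial>lebesgue_on (chart_img ?c))"
      using measurable_sets[OF measurable_chart_inv[OF c sigma], of E] E sigma measurable_volume_density[OF h i]
      by (subst emeasure_density) auto
    also have "\<dots> = (\<integral>\<^sup>+y. volume_density h i y * indicator (chart_inv ?c -` E \<inter> chart_img ?c) y
        * indicator (chart_img ?c) y \<partial>lebesgue)"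
      using open_chart_img[OF c] by (subst nn_integral_restrict_space) auto
    also have "\<dots> = (\<integral>\<^sup>+ y \<in> chart_map ?c ` (E \<inter> covering_piece i).
          ennreal (sqrt (det (coords ?c h y))) \<partial>lebesgue)"
    proof (rule nn_integral_cong)
      fix y
      have "E \<inter> covering_piece i = (E \<inter> covering_piece i) \<inter> chart_dom ?c"
        using covering_piece(1)[OF i] by auto
      then have "chart_map ?c ` (E \<inter> covering_piece i)
          = {y \<in> chart_img ?c. chart_inv ?c y \<in> E \<inter> covering_piece i}"
        using chart_image_eq[OF c] by metis
      then show "volume_density h i y * indicator (chart_inv ?c -` E \<inter> chart_img ?c) y
        * indicator (chart_img ?c) y = ennreal (sqrt (det (coords ?c h y)))
          * indicator (chart_map ?c ` (E \<inter> covering_piece i)) y"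
        by (auto simp: volume_density_def indicator_def)
    qed
    finally show ?thesis .
  qed
  show ?thesis
  proof (rule emeasure_measure_of[OF volume_def[unfolded Let_def], THEN trans])
    show "positive (sets (volume A h)) (\<lambda>E. \<Sum>i<?n. \<integral>\<^sup>+ y \<in> chart_map (covering_chart i) ` (E \<inter> covering_piece i).
          ennreal (sqrt (det (coords (covering_chart i) h y))) \<partial>lebesgue)"
      by (simp add: positive_def)
    show "countably_additive (sets (volume A h)) (\<lambda>E. \<Sum>i<?n. \<integral>\<^sup>+ y \<in> chart_map (covering_chart i) ` (E \<inter> covering_piece i).
          ennreal (sqrt (det (coords (covering_chart i) h y))) \<partial>lebesgue)"
    proof (rule countably_additiveI)
      fix F :: "nat \<Rightarrow> 'm set"
      assume F: "range F \<subseteq> sets (volume A h)" "disjoint_family F" "\<Union> (range F) \<in> sets (volume A h)"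
      then have F': "F k \<in> lebesgue_sets A" "\<Union> (range F) \<in> lebesgue_sets A" for k by auto
      have "(\<Sum>k. \<Sum>i<?n. emeasure (volume_piece h i) (F k)) = (\<Sum>i<?n. \<Sum>k. emeasure (volume_piece h i) (F k))"
        by (intro suminf_sum summableI)
      also have "\<dots> = (\<Sum>i<?n. emeasure (volume_piece h i) (\<Union> (range F)))"
        using F by (intro sum.cong refl suminf_emeasure) (auto simp: sets_volume_piece)
      finally show "(\<Sum>k. \<Sum>i<?n. \<integral>\<^sup>+ y \<in> chart_map (covering_chart i) ` (F k \<inter> covering_piece i).
          ennreal (sqrt (det (coords (covering_chart i) h y))) \<partial>lebesgue)
        = (\<Sum>i<?n. \<integral>\<^sup>+ y \<in> chart_map (covering_chart i) ` (\<Union> (range F) \<inter> covering_piece i).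
          ennreal (sqrt (det (coords (covering_chart i) h y))) \<partial>lebesgue)"
        using piece F' by simp
    qed
  qed (use piece E in auto)
qed

lemma nn_integral_volume:
  assumes h: "h \<in> measurable_semimetrics A" and f: "f \<in> borel_measurable (volume A h)"
  shows "nn_integral (volume A h) f = (\<Sum>i<length (chart_cover A).
    \<integral>\<^sup>+y. volume_density h i y * f (chart_inv (covering_chart i) y) \<partial>lebesgue_on (chart_img (covering_chart i)))"
proof -
  have "nn_integral (volume A h) f = (\<Sum>i<length (chart_cover A). nn_integral (volume_piece h i) f)"
    using emeasure_volume[OF h] f by (intro nn_integral_sum_measure) (auto simp: sets_volume_piece)
  also have "\<dots> = (\<Sum>i<length (chart_cover A).
    \<integral>\<^sup>+y. volume_density h i y * f (chart_inv (covering_chart i) y) \<partial>lebesgue_on (chart_img (covering_chart i)))"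
  proof (rule sum.cong[OF refl])
    fix i assume "i \<in> {..<length (chart_cover A)}"
    then have i: "i < length (chart_cover A)" by simp
    have sigma: "sets (sigma UNIV (lebesgue_sets A)) = lebesgue_sets A"
      by (simp add: sigma_algebra.sets_measure_of_eq[OF sigma_algebra_lebesgue_sets])
    have m: "chart_inv (covering_chart i) \<in> measurable
        (density (lebesgue_on (chart_img (covering_chart i))) (volume_density h i)) (sigma UNIV (lebesgue_sets A))"
      using measurable_chart_inv[OF covering_chart[OF i] sigma] by simp
    have f': "f \<in> borel_measurable (sigma UNIV (lebesgue_sets A))"
      using f by (metis measurable_cong_sets sets_volume sigma)
    have "nn_integral (volume_piece h i) f = (\<integral>\<^sup>+y. f (chart_inv (covering_chart i) y)
        \<partial>density (lebesgue_on (chart_img (covering_chart i))) (volume_density h i))"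
      unfolding volume_piece_def using m f' by (intro nn_integral_distr) auto
    also have "\<dots> = (\<integral>\<^sup>+y. volume_density h i y * f (chart_inv (covering_chart i) y) \<partial>lebesgue_on (chart_img (covering_chart i)))"
      using measurable_volume_density[OF h i] measurable_compose[OF m f'] by (intro nn_integral_density) auto
    finally show "nn_integral (volume_piece h i) f =
       (\<integral>\<^sup>+y. volume_density h i y * f (chart_inv (covering_chart i) y) \<partial>lebesgue_on (chart_img (covering_chart i)))" .
  qed
  finally show ?thesis .
qed

lemma measurable_volume_cong: "borel_measurable (volume A h) = borel_measurable (volume A k)"
  by (rule measurable_cong_sets) simp_all

lemma semimetric_psd:
  "h \<in> measurable_semimetrics A \<Longrightarrow> c \<in> A \<Longrightarrow> x \<in> chart_dom c \<Longrightarrow> psd_matrix (h x c)"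
  unfolding measurable_semimetrics_def sym_tensor_field_def pos_semidef_at_def psd_matrix_def by blast

lemma rel_det_measurable:
  assumes g: "g \<in> metrics A" and h: "h \<in> measurable_semimetrics A"
  shows "rel_det A g h \<in> borel_measurable (volume A k)"
proof (rule measurable_volumeI)
  fix c assume c: "c \<in> A"
  have "(\<lambda>y. det (coords c h y) / det (coords c g y)) \<in> borel_measurable (lebesgue_on (chart_img c))"
    using measurable_det_coords[OF h c] measurable_det_coords[OF metric_in_measurable_semimetrics[OF g] c]
    by (rule borel_measurable_divide)
  moreover have "rel_det A g h (chart_inv c y) = det (coords c h y) / det (coords c g y)"
    if "y \<in> chart_img c" for y
    using rel_det_eq[OF g _ c chart_inv_in_dom[OF c that], of h] h
    by (simp add: coords_def measurable_semimetrics_def)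
  ultimately show "(\<lambda>y. rel_det A g h (chart_inv c y)) \<in> borel_measurable (lebesgue_on (chart_img c))"
    by (subst measurable_cong) auto
qed

text \<open>The square root of \<open>rel_det\<close> is the Radon--Nikodym derivative of
  \<open>volume A h\<close> with respect to \<open>volume A g\<close>, so all volumes can be
  compared over one fixed measure.\<close>

lemma nn_integral_volume_density:
  assumes g: "g \<in> metrics A" and h: "h \<in> measurable_semimetrics A"
    and f: "f \<in> borel_measurable (volume A g)"
  shows "nn_integral (volume A h) f = (\<integral>\<^sup>+x. ennreal (sqrt (rel_det A g h x)) * f x \<partial>volume A g)"
proof -
  note gm = metric_in_measurable_semimetrics[OF g]
  have [measurable]: "rel_det A g h \<in> borel_measurable (volume A g)" by (rule rel_det_measurable[OF g h])
  have "volume_density h i y * f (chart_inv (covering_chart i) y) = volume_density g i y *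
      (ennreal (sqrt (rel_det A g h (chart_inv (covering_chart i) y))) * f (chart_inv (covering_chart i) y))"
    if "i < length (chart_cover A)" "y \<in> chart_img (covering_chart i)" for i y
  proof -
    let ?c = "covering_chart i"
    note c = covering_chart[OF that(1)] and d = chart_inv_in_dom[OF covering_chart[OF that(1)] that(2)]
    have pos: "det (coords ?c g y) > 0" unfolding coords_def by (rule metric_det_pos[OF g c d])
    have "rel_det A g h (chart_inv ?c y) = det (coords ?c h y) / det (coords ?c g y)"
      using rel_det_eq[OF g _ c d, of h] h by (simp add: coords_def measurable_semimetrics_def)
    then have "sqrt (det (coords ?c h y)) = sqrt (det (coords ?c g y)) * sqrt (rel_det A g h (chart_inv ?c y))"
      using pos by (simp add: real_sqrt_mult[symmetric])
    moreover have "rel_det A g h (chart_inv ?c y) \<ge> 0"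
      using pos det_psd_nonneg[OF semimetric_psd[OF h c d]]
        rel_det_eq[OF g _ c d, of h] h by (simp add: coords_def measurable_semimetrics_def)
    ultimately have "ennreal (sqrt (det (coords ?c h y)))
        = ennreal (sqrt (det (coords ?c g y))) * ennreal (sqrt (rel_det A g h (chart_inv ?c y)))"
      using pos by (simp add: ennreal_mult)
    then show ?thesis by (simp add: volume_density_def mult_ac)
  qed
  note density = this
  have f': "f \<in> borel_measurable (volume A h)" using f by (subst measurable_volume_cong[of h g])
  have "(\<lambda>x. ennreal (sqrt (rel_det A g h x)) * f x) \<in> borel_measurable (volume A g)"
    using f by measurable
  then show ?thesis
    unfolding nn_integral_volume[OF h f'] using density
    by (subst nn_integral_volume[OF gm]) (auto intro!: sum.cong nn_integral_cong)
qed

text \<open>A continuous function on an open chart may be unbounded near its edge. Closed coordinate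
  balls cover the manifold by finitely many compact sets, on which continuity yields bounds.\<close>

lemma compact_chart_cover:
  obtains J where "finite J" "\<And>c K. (c, K) \<in> J \<Longrightarrow> c \<in> A \<and> compact K \<and> K \<subseteq> chart_img c"
    "(\<Union>(c, K)\<in>J. chart_inv c ` K) = UNIV"
proof -
  have "\<exists>c r. c \<in> A \<and> x \<in> chart_dom c \<and> r > 0 \<and> cball (chart_map c x) r \<subseteq> chart_img c" for x
    using chart_exists[of x] open_chart_img chart_map_in_img open_contains_cball by metis
  then obtain c r where cr: "\<And>x. c x \<in> A" "\<And>x. x \<in> chart_dom (c x)" "\<And>x. r x > (0::real)"
    "\<And>x. cball (chart_map (c x) x) (r x) \<subseteq> chart_img (c x)" by metis
  define U where "U x = chart_dom (c x) \<inter> chart_map (c x) -` ball (chart_map (c x) x) (r x)" for x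
  have "open (U x)" for x
    unfolding U_def using continuous_chart_map[OF cr(1)] open_chart_dom[OF cr(1)]
    by (intro continuous_open_preimage) auto
  moreover have "x \<in> U x" for x using cr by (simp add: U_def)
  then have "UNIV \<subseteq> (\<Union>x\<in>UNIV. U x)" by blast
  ultimately obtain X where X: "finite X" "UNIV \<subseteq> (\<Union>x\<in>X. U x)"
    using compactE_image[OF compact_manifold, of UNIV U] by metis
  define J where "J = (\<lambda>x. (c x, cball (chart_map (c x) x) (r x))) ` X"
  show thesis
  proof (rule that[of J])
    show "finite J" using X by (simp add: J_def)
    show "c' \<in> A \<and> compact K \<and> K \<subseteq> chart_img c'" if "(c', K) \<in> J" for c' K
      using that cr unfolding J_def by (elim imageE) simp
    have sub: "U x \<subseteq> chart_inv (c x) ` cball (chart_map (c x) x) (r x)" for x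
    proof
      fix z assume "z \<in> U x"
      then have "z = chart_inv (c x) (chart_map (c x) z)" "chart_map (c x) z \<in> cball (chart_map (c x) x) (r x)"
        using chart_inv_map[OF cr(1), of z x] by (auto simp: U_def)
      then show "z \<in> chart_inv (c x) ` cball (chart_map (c x) x) (r x)" by (rule image_eqI)
    qed
    have "(\<Union>x\<in>X. U x) \<subseteq> (\<Union>x\<in>X. chart_inv (c x) ` cball (chart_map (c x) x) (r x))"
      by (rule UN_mono[OF order_refl sub])
    then have "UNIV \<subseteq> (\<Union>x\<in>X. chart_inv (c x) ` cball (chart_map (c x) x) (r x))"
      using X(2) by (rule order_trans[rotated])
    then show "(\<Union>(c, K)\<in>J. chart_inv c ` K) = UNIV" by (simp add: J_def top.extremum_unique)
  qed
qed

text \<open>The part of a piece that lies over a compact subset \<open>K\<close> of another chart is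
  treated by itself. There the density factors as the Jacobian determinant of the transition map
  times the density in the other chart. The latter is bounded on \<open>K\<close>, and the former
  has a finite integral by change of variables.\<close>

lemma finite_volume_metric:
  assumes h: "h \<in> metrics A"
  shows "emeasure (volume A h) UNIV < \<infinity>"
proof -
  obtain J where J: "finite J" "\<And>c K. (c, K) \<in> J \<Longrightarrow> c \<in> A \<and> compact K \<and> K \<subseteq> chart_img c"
    "(\<Union>(c, K)\<in>J. chart_inv c ` K) = UNIV" by (fact compact_chart_cover)
  note hm = metric_in_measurable_semimetrics[OF h]
  have local: "(\<integral>\<^sup>+y. volume_density h i y * indicator (chart_inv c ` K) (chart_inv (covering_chart i) y)
       \<partial>lebesgue_on (chart_img (covering_chart i))) < \<infinity>"
    if i: "i < length (chart_cover A)" and cK: "(c, K) \<in> J" for i c K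
  proof -
    let ?c = "covering_chart i"
    note c0 = covering_chart[OF i]
    from J(2)[OF cK] have c: "c \<in> A" and K: "compact K" "K \<subseteq> chart_img c" by auto
    have "compact (chart_inv c ` K)"
      using K continuous_on_subset[OF continuous_chart_inv[OF c]] by (intro compact_continuous_image) auto
    then have E: "covering_piece i \<inter> chart_inv c ` K \<in> sets borel"
      using covering_piece(2)[OF i] by (auto intro: borel_closed compact_imp_closed)
    have E_sub: "x \<in> chart_dom ?c \<inter> chart_dom c" "chart_map c x \<in> K"
      if "x \<in> covering_piece i \<inter> chart_inv c ` K" for x
      using that covering_piece(1)[OF i] K chart_inv_in_dom[OF c] chart_map_inv[OF c] by auto
    define T where "T = transition ?c c"
    \<comment> \<open>The part of the piece over \<open>K\<close>, seen in the covering chart;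
      \<open>T\<close> carries it injectively into \<open>K\<close>.\<close>
    define S where "S = {y \<in> chart_img ?c. chart_inv ?c y \<in> covering_piece i \<inter> chart_inv c ` K}"
    have S_borel: "S \<in> sets borel" unfolding S_def by (rule borel_chart_preimage[OF c0 E])
    have T: "T y = chart_map c (chart_inv ?c y)" for y by (simp add: T_def transition_def)
    have TS: "T ` S = {z \<in> chart_img c. chart_inv c z \<in> covering_piece i \<inter> chart_inv c ` K}"
    proof safe
      fix y assume "y \<in> S"
      then have y: "chart_inv ?c y \<in> covering_piece i \<inter> chart_inv c ` K" by (simp add: S_def)
      note d = E_sub(1)[OF y]
      then show "T y \<in> chart_img c" "chart_inv c (T y) \<in> covering_piece i" "chart_inv c (T y) \<in> chart_inv c ` K"
        using y chart_map_in_img[OF c] chart_inv_map[OF c] by (auto simp: T)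
    next
      fix z w assume z: "z \<in> chart_img c" "chart_inv c z \<in> covering_piece i" "chart_inv c z = chart_inv c w" "w \<in> K"
      then have x: "chart_inv c z \<in> covering_piece i \<inter> chart_inv c ` K" by auto
      note d = E_sub(1)[OF this]
      show "z \<in> T ` S"
      proof (rule image_eqI)
        show "z = T (chart_map ?c (chart_inv c z))"
          using chart_inv_map[OF c0] chart_map_inv[OF c z(1)] d by (metis T IntD1)
        show "chart_map ?c (chart_inv c z) \<in> S"
          using d x chart_inv_map[OF c0] chart_map_in_img[OF c0] by (simp add: S_def)
      qed
    qed
    have TK: "T ` S \<subseteq> K" using E_sub(2) by (auto simp: S_def T)
    define J' where "J' y = jacobian T (at y)" for y
    have S_dom: "chart_inv ?c y \<in> chart_dom ?c \<inter> chart_dom c" "chart_map ?c (chart_inv ?c y) = y"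
      if "y \<in> S" for y using that E_sub chart_map_inv[OF c0] by (auto simp: S_def)
    have der: "(T has_derivative (*v) (J' y)) (at y)" if "y \<in> S" for y
    proof -
      have "y \<in> chart_map ?c ` (chart_dom ?c \<inter> chart_dom c)"
        using S_dom[OF that] by (metis image_eqI)
      then have "T differentiable (at y)"
        using smooth_transition[OF c0 c] unfolding smooth_on_def T_def by (metis dderivs.simps(1))
      then show ?thesis unfolding J'_def by (simp add: jacobian_works)
    qed
    have J'_pos: "det (J' y) > 0" if "y \<in> S" for y
      using det_jacobian_pos[OF c0 c S_dom(1)[OF that]] S_dom(2)[OF that] by (simp add: J'_def T_def)
    have dets: "det (coords ?c h y) = (det (J' y))\<^sup>2 * det (coords c h (T y))" if "y \<in> S" for y
      using det_tensor_transform[OF metric_sym[OF h] c0 c S_dom(1)[OF that]] S_dom[OF that]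
        chart_inv_map[OF c, of "chart_inv ?c y"]
      by (simp add: coords_def J'_def T T_def[symmetric])
    have T_img: "T y \<in> chart_img c" if "y \<in> S" for y using TK K that by auto
    have pos: "det (coords c h (T y)) > 0" if "y \<in> S" for y
      unfolding coords_def using metric_det_pos[OF h c chart_inv_in_dom[OF c T_img[OF that]]] .
    \<comment> \<open>Measurability of the Jacobian determinant is read off the transformation law:
      its absolute value is the square root of a quotient of positive continuous functions.\<close>
    have "continuous_on S (\<lambda>y. sqrt (det (coords ?c h y) / det (coords c h (T y))))"
    proof (intro continuous_intros continuous_on_compose2[OF metric_coords_continuous[OF h c]])
      show "continuous_on S (coords ?c h)"
        using metric_coords_continuous[OF h c0] by (rule continuous_on_subset) (auto simp: S_def)
      show "continuous_on S T"
        using der by (intro continuous_at_imp_continuous_on ballI has_derivative_continuous) auto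
    qed (use pos T_img in \<open>auto simp: less_imp_neq[symmetric]\<close>)
    then have "continuous_on S (\<lambda>y. \<bar>det (J' y)\<bar>)"
    proof (rule continuous_on_cong[THEN iffD1, rotated -1, OF _ refl])
      fix y assume y: "y \<in> S"
      have "det (coords ?c h y) / det (coords c h (T y)) = (det (J' y))\<^sup>2"
        using pos[OF y] by (simp add: dets[OF y])
      then show "sqrt (det (coords ?c h y) / det (coords c h (T y))) = \<bar>det (J' y)\<bar>" by simp
    qed
    from borel_measurable_continuous_on_indicator[OF S_borel this]
    have meas: "(\<lambda>y. \<bar>det (J' y)\<bar> * indicator S y) \<in> borel_measurable borel"
      by (simp add: mult.commute)
    have "inj_on T S"
    proof (rule inj_onI)
      fix y z assume yz: "y \<in> S" "z \<in> S" "T y = T z"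
      then have "chart_inv ?c y = chart_inv ?c z"
        using S_dom(1) chart_inv_map[OF c] unfolding T by (metis IntD2)
      then show "y = z" using S_dom(2) yz by metis
    qed
    then have fin: "(\<integral>\<^sup>+y. ennreal (\<bar>det (J' y)\<bar> * indicator S y) \<partial>lborel) < \<infinity>"
      using nn_integral_det_jacobian_finite[OF S_borel der] meas
        borel_chart_preimage[OF c E] bounded_subset[OF compact_imp_bounded[OF K(1)] TK]
      by (simp add: TS)
    have "continuous_on K (\<lambda>z. sqrt (det (coords c h z)))"
      using continuous_on_subset[OF metric_coords_continuous[OF h c] K(2)] by (intro continuous_intros)
    then have "bounded ((\<lambda>z. sqrt (det (coords c h z))) ` K)"
      using K(1) by (intro compact_imp_bounded compact_continuous_image)
    then obtain B where "\<forall>r\<in>(\<lambda>z. sqrt (det (coords c h z))) ` K. norm r \<le> B"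
      unfolding bounded_iff by blast
    then have B: "sqrt (det (coords c h z)) \<le> B" if "z \<in> K" for z
      using that by (metis abs_le_D1 image_eqI real_norm_def)
    have "(\<integral>\<^sup>+y. volume_density h i y * indicator (chart_inv c ` K) (chart_inv ?c y) \<partial>lebesgue_on (chart_img ?c))
        = (\<integral>\<^sup>+y. volume_density h i y * indicator (chart_inv c ` K) (chart_inv ?c y)
            * indicator (chart_img ?c) y \<partial>lebesgue)"
      using open_chart_img[OF c0] by (subst nn_integral_restrict_space) auto
    also have "\<dots> \<le> (\<integral>\<^sup>+y. ennreal B * ennreal (\<bar>det (J' y)\<bar> * indicator S y) \<partial>lebesgue)"
    proof (rule nn_integral_mono)
      fix y
      show "volume_density h i y * indicator (chart_inv c ` K) (chart_inv ?c y) * indicator (chart_img ?c) y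
          \<le> ennreal B * ennreal (\<bar>det (J' y)\<bar> * indicator S y)"
      proof (cases "y \<in> S")
        case True
        have TyK: "T y \<in> K" using TK True by auto
        then have "B \<ge> 0" using B[of "T y"] pos[OF True] by (meson order_trans real_sqrt_ge_0_iff less_imp_le)
        have "sqrt (det (coords ?c h y)) = \<bar>det (J' y)\<bar> * sqrt (det (coords c h (T y)))"
          by (simp add: dets[OF True] real_sqrt_mult)
        also have "\<dots> \<le> B * \<bar>det (J' y)\<bar>"
          using mult_left_mono[OF B[OF TyK], of "\<bar>det (J' y)\<bar>"] by (simp add: mult.commute)
        finally have "ennreal (sqrt (det (coords ?c h y))) \<le> ennreal B * ennreal \<bar>det (J' y)\<bar>"
          using \<open>B \<ge> 0\<close> by (simp add: ennreal_mult[symmetric] ennreal_leI)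
        then show ?thesis using True by (simp add: volume_density_def S_def indicator_def)
      next
        case False
        then show ?thesis by (auto simp: volume_density_def S_def indicator_def)
      qed
    qed
    also have "\<dots> = ennreal B * (\<integral>\<^sup>+y. ennreal (\<bar>det (J' y)\<bar> * indicator S y) \<partial>lborel)"
      using meas by (subst nn_integral_completion) (auto simp: nn_integral_cmult)
    also have "\<dots> < \<infinity>" using fin by (simp add: ennreal_mult_less_top)
    finally show ?thesis .
  qed
  have E_meas: "chart_inv c ` K \<in> lebesgue_sets A" if "(c, K) \<in> J" for c K
  proof -
    have "compact (chart_inv c ` K)"
      using J(2)[OF that] continuous_on_subset[OF continuous_chart_inv] by (intro compact_continuous_image) auto
    then show ?thesis by (intro borel_subset_lebesgue_sets borel_closed compact_imp_closed)
  qed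
  have "emeasure (volume A h) (chart_inv c ` K) < \<infinity>" if "(c, K) \<in> J" for c K
  proof -
    have "emeasure (volume A h) (chart_inv c ` K) = nn_integral (volume A h) (indicator (chart_inv c ` K))"
      using E_meas[OF that] by simp
    also have "\<dots> < \<infinity>"
      using local[OF _ that] borel_measurable_indicator[of _ "volume A h", unfolded sets_volume, OF E_meas[OF that]]
      by (subst nn_integral_volume[OF hm]) (auto simp: less_top)
    finally show ?thesis .
  qed
  then have fin: "(\<Sum>p\<in>J. emeasure (volume A h) (case p of (c, K) \<Rightarrow> chart_inv c ` K)) < \<infinity>"
    using J(1) by (auto simp: less_top)
  have "emeasure (volume A h) UNIV = emeasure (volume A h) (\<Union>p\<in>J. case p of (c, K) \<Rightarrow> chart_inv c ` K)"
    using J(3) by (simp add: case_prod_unfold)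
  also have "\<dots> \<le> (\<Sum>p\<in>J. emeasure (volume A h) (case p of (c, K) \<Rightarrow> chart_inv c ` K))"
    using J(1) E_meas by (intro emeasure_subadditive_finite) auto
  finally show ?thesis using fin by (rule le_less_trans)
qed

end


section \<open>Paths of metrics\<close>

text \<open>The identity for \<open>vs\<close> holds only on \<open>S\<close>, but openness of
  \<open>S\<close> allows differentiating it there. This gives the identity for one more direction
  and, since \<open>f\<close> and \<open>g\<close> are smooth, differentiability again.\<close>

lemma dderivs_linear_combination:
  fixes f g :: "'a::real_normed_vector \<Rightarrow> 'b::real_normed_vector"
  assumes S: "open S" and f: "smooth_on S f" and g: "smooth_on S g"
  shows "\<forall>y\<in>S. dderivs vs (\<lambda>y. \<alpha> *\<^sub>R f y + \<beta> *\<^sub>R g y) y = \<alpha> *\<^sub>R dderivs vs f y + \<beta> *\<^sub>R dderivs vs g y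
    \<and> dderivs vs (\<lambda>y. \<alpha> *\<^sub>R f y + \<beta> *\<^sub>R g y) differentiable (at y)"
proof (induction vs)
  have step: "(dderivs vs (\<lambda>y. \<alpha> *\<^sub>R f y + \<beta> *\<^sub>R g y) has_derivative
      (\<lambda>v. \<alpha> *\<^sub>R frechet_derivative (dderivs vs f) (at y) v + \<beta> *\<^sub>R frechet_derivative (dderivs vs g) (at y) v)) (at y)"
    if eq: "\<And>y. y \<in> S \<Longrightarrow> dderivs vs (\<lambda>y. \<alpha> *\<^sub>R f y + \<beta> *\<^sub>R g y) y = \<alpha> *\<^sub>R dderivs vs f y + \<beta> *\<^sub>R dderivs vs g y"
      and y: "y \<in> S" for vs y
  proof -
    have "(dderivs vs f has_derivative frechet_derivative (dderivs vs f) (at y)) (at y)"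
      "(dderivs vs g has_derivative frechet_derivative (dderivs vs g) (at y)) (at y)"
      using f g y unfolding smooth_on_def by (simp_all add: frechet_derivative_works[symmetric])
    then have "((\<lambda>y. \<alpha> *\<^sub>R dderivs vs f y + \<beta> *\<^sub>R dderivs vs g y) has_derivative
      (\<lambda>v. \<alpha> *\<^sub>R frechet_derivative (dderivs vs f) (at y) v + \<beta> *\<^sub>R frechet_derivative (dderivs vs g) (at y) v)) (at y)"
      by (intro derivative_intros)
    then show ?thesis
      by (rule has_derivative_transform_within_open[OF _ S y]) (simp add: eq)
  qed
  {
    case Nil
    show ?case using step[of "[]"] by (auto simp: differentiable_def)
  next
    case (Cons v vs)
    have "dderivs (v # vs) (\<lambda>y. \<alpha> *\<^sub>R f y + \<beta> *\<^sub>R g y) y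
        = \<alpha> *\<^sub>R dderivs (v # vs) f y + \<beta> *\<^sub>R dderivs (v # vs) g y" if "y \<in> S" for y
    proof -
      from Cons have "\<And>y. y \<in> S \<Longrightarrow> dderivs vs (\<lambda>y. \<alpha> *\<^sub>R f y + \<beta> *\<^sub>R g y) y = \<alpha> *\<^sub>R dderivs vs f y + \<beta> *\<^sub>R dderivs vs g y"
        by blast
      note e = frechet_derivative_at[OF step[OF this that], symmetric]
      show ?thesis by (simp add: e)
    qed
    then show ?case using step[of "v # vs"] by (auto simp: differentiable_def)
  }
qed

text \<open>Uniformity over \<open>K\<close> of the limit in time combines with continuity of the
  slice at \<open>t\<close>. Joint continuity is wanted because it gives bounds over whole time
  intervals by compactness.\<close>

lemma joint_continuous_on:
  fixes F :: "'c::metric_space \<Rightarrow> 'a::metric_space \<Rightarrow> 'b::metric_space"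
  assumes lim: "\<And>t. t \<in> I \<Longrightarrow> uniform_limit K F (F t) (at t within I)"
    and cont: "\<And>t. t \<in> I \<Longrightarrow> continuous_on K (F t)"
  shows "continuous_on (I \<times> K) (\<lambda>p. F (fst p) (snd p))"
  unfolding continuous_on_iff
proof (intro ballI allI impI)
  fix p :: "'c \<times> 'a" and e :: real
  assume p: "p \<in> I \<times> K" and e: "e > 0"
  obtain t y where ty: "p = (t, y)" "t \<in> I" "y \<in> K" using p by auto
  have "\<forall>\<^sub>F s in at t within I. \<forall>z\<in>K. dist (F s z) (F t z) < e / 2"
    using uniform_limitD[OF lim[OF ty(2)], of "e / 2"] e by simp
  then obtain d1 where d1: "d1 > 0" "\<And>s z. s \<in> I \<Longrightarrow> s \<noteq> t \<Longrightarrow> dist s t < d1 \<Longrightarrow> z \<in> K \<Longrightarrow> dist (F s z) (F t z) < e / 2"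
    unfolding eventually_at by metis
  have d1': "dist (F s z) (F t z) < e / 2" if "s \<in> I" "dist s t < d1" "z \<in> K" for s z
    using d1(2)[of s z] that e by (cases "s = t") auto
  obtain d2 where d2: "d2 > 0" "\<And>z. z \<in> K \<Longrightarrow> dist z y < d2 \<Longrightarrow> dist (F t z) (F t y) < e / 2"
    using cont[OF ty(2), unfolded continuous_on_iff, rule_format, OF ty(3) half_gt_zero[OF e]] by blast
  show "\<exists>d>0. \<forall>q\<in>I \<times> K. dist q p < d \<longrightarrow> dist (F (fst q) (snd q)) (F (fst p) (snd p)) < e"
  proof (intro exI[of _ "min d1 d2"] conjI ballI impI)
    show "min d1 d2 > 0" using d1 d2 by simp
    fix q assume q: "q \<in> I \<times> K" "dist q p < min d1 d2"
    then have "dist (fst q) t < d1" "dist (snd q) y < d2"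
      using dist_fst_le[of q p] dist_snd_le[of q p] ty(1) by auto
    then have "dist (F (fst q) (snd q)) (F t (snd q)) < e / 2" "dist (F t (snd q)) (F t y) < e / 2"
      using d1' d2 q by auto
    then show "dist (F (fst q) (snd q)) (F (fst p) (snd p)) < e"
      using dist_triangle[of "F (fst q) (snd q)" "F t y" "F t (snd q)"] by (simp add: ty(1))
  qed
qed

lemma has_vector_derivative_quotientI:
  fixes f :: "real \<Rightarrow> 'a::real_normed_vector"
  assumes "((\<lambda>s. (f s - f t) /\<^sub>R (s - t)) \<longlongrightarrow> D) (at t within S)"
  shows "(f has_vector_derivative D) (at t within S)"
  unfolding has_vector_derivative_def has_derivative_iff_norm
proof
  show "bounded_linear (\<lambda>x. x *\<^sub>R D)" by (rule bounded_linear_scaleR_left)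
  have "((\<lambda>s. norm ((f s - f t) /\<^sub>R (s - t) - D)) \<longlongrightarrow> 0) (at t within S)"
    using assms by (simp add: tendsto_norm_zero_iff LIM_zero_iff)
  moreover have "norm ((f s - f t) /\<^sub>R (s - t) - D) = norm (f s - f t - (s - t) *\<^sub>R D) / norm (s - t)"
    if "s \<noteq> t" for s
  proof -
    have "(f s - f t) /\<^sub>R (s - t) - D = (f s - f t - (s - t) *\<^sub>R D) /\<^sub>R (s - t)"
      using that by (simp add: scaleR_diff_right)
    then show ?thesis by (simp add: divide_inverse mult.commute)
  qed
  then have "\<forall>\<^sub>F s in at t within S. norm ((f s - f t) /\<^sub>R (s - t) - D) = norm (f s - f t - (s - t) *\<^sub>R D) / norm (s - t)"
    by (auto simp: eventually_at_filter)
  ultimately show "((\<lambda>s. norm (f s - f t - (s - t) *\<^sub>R D) / norm (s - t)) \<longlongrightarrow> 0) (at t within S)"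
    by (rule Lim_transform_eventually)
qed

lemma continuous_on_tensor_energy:
  fixes a b :: "'a::topological_space \<Rightarrow> real^'n^'n"
  assumes "continuous_on S \<rho>" "continuous_on S a" "continuous_on S b"
    and "\<And>x. x \<in> S \<Longrightarrow> \<rho> x \<noteq> 0" "\<And>x. x \<in> S \<Longrightarrow> det (a x) \<noteq> 0"
  shows "continuous_on S (\<lambda>x. tensor_energy (\<rho> x) (a x) (b x))"
  unfolding tensor_energy_def using assms
  by (intro continuous_intros continuous_on_matrix_inv) auto

section \<open>Linear combinations of tensor fields and continuously differentiable paths\<close>

context manifold
begin

lemma sym_tensor_field_zero:
  "sym_tensor_field A h \<Longrightarrow> \<not> (c \<in> A \<and> x \<in> chart_dom c) \<Longrightarrow> h x c = 0"
  unfolding sym_tensor_field_def by blast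

lemma sym_tensor_field_transpose:
  "sym_tensor_field A h \<Longrightarrow> c \<in> A \<Longrightarrow> x \<in> chart_dom c \<Longrightarrow> transpose (h x c) = h x c"
  unfolding sym_tensor_field_def by blast

lemma sym_tensor_field_linear_combination:
  assumes h: "sym_tensor_field A h" and k: "sym_tensor_field A k"
  shows "sym_tensor_field A (\<lambda>x c. \<alpha> *\<^sub>R h x c + \<beta> *\<^sub>R k x c)"
proof -
  have lin: "m ** (\<alpha> *\<^sub>R p + \<beta> *\<^sub>R q) ** m' = \<alpha> *\<^sub>R (m ** p ** m') + \<beta> *\<^sub>R (m ** q ** m')"
    for m m' p q :: "real^'n^'n"
    by (simp add: matrix_matrix_mult_def vec_eq_iff sum_distrib_left sum_distrib_right sum.distrib algebra_simps)
  have zero: "h x c = 0" "k x c = 0" if "\<not> (c \<in> A \<and> x \<in> chart_dom c)" for x c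
    using sym_tensor_field_zero[OF h that] sym_tensor_field_zero[OF k that] by auto
  have sym: "transpose (\<alpha> *\<^sub>R h x c + \<beta> *\<^sub>R k x c) = \<alpha> *\<^sub>R h x c + \<beta> *\<^sub>R k x c"
    if "c \<in> A" "x \<in> chart_dom c" for x c
  proof -
    have "transpose (h x c) = h x c" "transpose (k x c) = k x c"
      using h k that by (auto simp: sym_tensor_field_def)
    moreover have "transpose (\<alpha> *\<^sub>R p + \<beta> *\<^sub>R q) = \<alpha> *\<^sub>R transpose p + \<beta> *\<^sub>R transpose q" for p q :: "real^'n^'n"
      by (simp add: transpose_def vec_eq_iff)
    ultimately show ?thesis by simp
  qed
  have law: "\<alpha> *\<^sub>R h x c + \<beta> *\<^sub>R k x c = transpose J ** (\<alpha> *\<^sub>R h x c' + \<beta> *\<^sub>R k x c') ** J"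
    if "c \<in> A" "c' \<in> A" "x \<in> chart_dom c \<inter> chart_dom c'" "J = jacobian (transition c c') (at (chart_map c x))" for x c c' J
    unfolding lin sym_tensor_transform[OF h that(1-3), folded that(4), symmetric]
      sym_tensor_transform[OF k that(1-3), folded that(4), symmetric] ..
  show ?thesis
    unfolding sym_tensor_field_def Let_def
  proof (intro conjI allI ballI impI)
    show "\<alpha> *\<^sub>R h x c + \<beta> *\<^sub>R k x c = 0" if "\<not> (c \<in> A \<and> x \<in> chart_dom c)" for x c
      using zero[OF that] by simp
  qed (fact sym law[OF _ _ _ refl])+
qed

lemma smooth_tensors_linear_combination:
  assumes "h \<in> smooth_tensors A" "k \<in> smooth_tensors A"
  shows "(\<lambda>x c. \<alpha> *\<^sub>R h x c + \<beta> *\<^sub>R k x c) \<in> smooth_tensors A"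
proof -
  have "smooth_on (chart_img c) (coords c (\<lambda>x c. \<alpha> *\<^sub>R h x c + \<beta> *\<^sub>R k x c))" if "c \<in> A" for c
    using dderivs_linear_combination[OF open_chart_img[OF that], of "coords c h" "coords c k" _ \<alpha> \<beta>] assms that
    unfolding smooth_on_def[of _ "coords c (\<lambda>x c. \<alpha> *\<^sub>R h x c + \<beta> *\<^sub>R k x c)"]
    by (auto simp: coords_def[abs_def] smooth_tensors_def)
  then show ?thesis using assms sym_tensor_field_linear_combination by (simp add: smooth_tensors_def)
qed

text \<open>Positive definite forms make up a convex cone, so the segment stays among the metrics. A
  connecting path is needed because the infimum of an empty set of lengths would carry no
  information.\<close>

lemma straight_metric_path:
  assumes g0: "g0 \<in> metrics A" and g1: "g1 \<in> metrics A"
  obtains \<gamma> where "metric_path A \<gamma>" "\<gamma> 0 = g0" "\<gamma> 1 = g1"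
proof
  define \<gamma> where "\<gamma> t = (\<lambda>x c. (1 - t) *\<^sub>R g0 x c + t *\<^sub>R g1 x c)" for t :: real
  define d where "d = (\<lambda>x c. (-1) *\<^sub>R g0 x c + 1 *\<^sub>R g1 x c)"
  have smooth: "g0 \<in> smooth_tensors A" "g1 \<in> smooth_tensors A"
    using assms by (auto simp: metrics_def)
  have d: "d \<in> smooth_tensors A" unfolding d_def by (rule smooth_tensors_linear_combination[OF smooth])
  have metric: "\<gamma> t \<in> metrics A" if t: "t \<in> {0..1}" for t
  proof -
    have "pos_def_at A (\<gamma> t) x" for x
      unfolding pos_def_at_def
    proof (intro ballI impI allI)
      fix c and v :: "real^'n" assume c: "c \<in> A" "x \<in> chart_dom c" and v: "v \<noteq> 0"
      have "v \<bullet> (g0 x c *v v) > 0" "v \<bullet> (g1 x c *v v) > 0"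
        using metric_pd[OF g0 c] metric_pd[OF g1 c] v by (auto simp: pd_matrix_def)
      moreover have "v \<bullet> (\<gamma> t x c *v v) = (1 - t) * (v \<bullet> (g0 x c *v v)) + t * (v \<bullet> (g1 x c *v v))"
        by (simp add: \<gamma>_def matrix_vector_mult_add_rdistrib scaleR_matrix_vector_assoc[symmetric] inner_add_right)
      ultimately show "v \<bullet> (\<gamma> t x c *v v) > 0"
        using t by (cases "t = 0") (auto intro: add_nonneg_pos)
    qed
    then show ?thesis
      using smooth_tensors_linear_combination[OF smooth, of "1 - t" t]
      unfolding metrics_def \<gamma>_def by blast
  qed
  \<comment> \<open>The difference quotients of an affine path do not depend on \<open>s\<close>, so
    they equal their limit in the Frechet space for all \<open>s \<noteq> t\<close>.\<close>
  have quot: "(\<lambda>x c. (\<gamma> s x c - \<gamma> t x c) /\<^sub>R (s - t)) = d" if "s \<noteq> t" for s t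
  proof (intro ext)
    fix x c
    have "\<gamma> s x c - \<gamma> t x c = (s - t) *\<^sub>R d x c" by (simp add: \<gamma>_def d_def algebra_simps)
    then show "(\<gamma> s x c - \<gamma> t x c) /\<^sub>R (s - t) = d x c" using that by simp
  qed
  have "C1_path_on A 0 1 \<gamma>"
    unfolding C1_path_on_def smooth_tendsto_def
  proof (intro exI[of _ "\<lambda>t. d"] ballI conjI allI impI d uniform_limit_const)
    fix t c and K :: "(real^'n) set" and vs
    show "uniform_limit K (\<lambda>s. dderivs vs (coords c (\<lambda>x c. (\<gamma> s x c - \<gamma> t x c) /\<^sub>R (s - t))))
        (dderivs vs (coords c d)) (at t within {0..1})"
    proof (rule uniform_limitI)
      fix e :: real assume "e > 0"
      then show "\<forall>\<^sub>F s in at t within {0..1}. \<forall>y\<in>K. dist (dderivs vs (coords c (\<lambda>x c. (\<gamma> s x c - \<gamma> t x c) /\<^sub>R (s - t))) y)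
          (dderivs vs (coords c d) y) < e"
        by (auto simp: eventually_at_filter quot)
    qed
  qed
  then show "metric_path A \<gamma>"
    unfolding metric_path_def using metric by (auto intro!: exI[of _ "{0, 1}"])
  show "\<gamma> 0 = g0" "\<gamma> 1 = g1" by (auto simp: \<gamma>_def)
qed

text \<open>The empty list of directions extracts uniform convergence of the components themselves
  from Frechet convergence. Joint continuity of the path is deduced from a bound on its difference
  quotients.\<close>

lemma C1_path_facts:
  assumes path: "C1_path_on A a b \<gamma>" and smooth: "\<forall>t\<in>{a..b}. \<gamma> t \<in> smooth_tensors A"
  obtains \<gamma>' where "\<And>t. t \<in> {a..b} \<Longrightarrow> \<gamma>' t \<in> smooth_tensors A"
    "\<And>t x c. t \<in> {a..b} \<Longrightarrow> c \<in> A \<Longrightarrow> x \<in> chart_dom c \<Longrightarrow>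
       ((\<lambda>s. \<gamma> s x c) has_vector_derivative \<gamma>' t x c) (at t within {a..b})"
    "\<And>c K. c \<in> A \<Longrightarrow> compact K \<Longrightarrow> K \<subseteq> chart_img c \<Longrightarrow>
       continuous_on ({a..b} \<times> K) (\<lambda>p. coords c (\<gamma> (fst p)) (snd p))"
    "\<And>c K. c \<in> A \<Longrightarrow> compact K \<Longrightarrow> K \<subseteq> chart_img c \<Longrightarrow>
       continuous_on ({a..b} \<times> K) (\<lambda>p. coords c (\<gamma>' (fst p)) (snd p))"
proof -
  obtain \<gamma>' where \<gamma>': "\<And>t. t \<in> {a..b} \<Longrightarrow> \<gamma>' t \<in> smooth_tensors A"
    and quot: "\<And>t. t \<in> {a..b} \<Longrightarrow> smooth_tendsto A (\<lambda>s x c. (\<gamma> s x c - \<gamma> t x c) /\<^sub>R (s - t)) (\<gamma>' t) (at t within {a..b})"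
    and cont: "\<And>t. t \<in> {a..b} \<Longrightarrow> smooth_tendsto A \<gamma>' (\<gamma>' t) (at t within {a..b})"
  proof -
    obtain \<gamma>' where "\<forall>t\<in>{a..b}. \<gamma>' t \<in> smooth_tensors A \<and>
        smooth_tendsto A (\<lambda>s x c. (\<gamma> s x c - \<gamma> t x c) /\<^sub>R (s - t)) (\<gamma>' t) (at t within {a..b}) \<and>
        smooth_tendsto A \<gamma>' (\<gamma>' t) (at t within {a..b})"
      using path unfolding C1_path_on_def by blast
    then show thesis by (intro that[of \<gamma>']) auto
  qed
  have quot0: "uniform_limit K (\<lambda>s y. (coords c (\<gamma> s) y - coords c (\<gamma> t) y) /\<^sub>R (s - t)) (coords c (\<gamma>' t)) (at t within {a..b})"
    if "t \<in> {a..b}" "c \<in> A" "compact K" "K \<subseteq> chart_img c" for t c K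
    using quot[OF that(1), unfolded smooth_tendsto_def, rule_format, of c K "[]"] that(2-4)
    by (simp add: coords_def[abs_def])
  have cont0: "uniform_limit K (\<lambda>s. coords c (\<gamma>' s)) (coords c (\<gamma>' t)) (at t within {a..b})"
    if "t \<in> {a..b}" "c \<in> A" "compact K" "K \<subseteq> chart_img c" for t c K
    using cont[OF that(1), unfolded smooth_tendsto_def, rule_format, of c K "[]"] that(2-4) by simp
  show thesis
  proof (rule that[of \<gamma>'])
    fix t x c assume t: "t \<in> {a..b}" and c: "c \<in> A" "x \<in> chart_dom c"
    have "((\<lambda>s. (coords c (\<gamma> s) (chart_map c x) - coords c (\<gamma> t) (chart_map c x)) /\<^sub>R (s - t))
        \<longlongrightarrow> coords c (\<gamma>' t) (chart_map c x)) (at t within {a..b})"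
      using quot0[OF t c(1), of "{chart_map c x}"] chart_map_in_img[OF c] by simp
    then show "((\<lambda>s. \<gamma> s x c) has_vector_derivative \<gamma>' t x c) (at t within {a..b})"
      by (intro has_vector_derivative_quotientI) (simp add: coords_def chart_inv_map[OF c])
  next
    fix c and K :: "(real^'n) set" assume K: "c \<in> A" "compact K" "K \<subseteq> chart_img c"
    have c': "continuous_on K (coords c (\<gamma>' t))" if "t \<in> {a..b}" for t
      using smooth_coords_continuous[OF \<gamma>'[OF that] K(1)] K(3) by (rule continuous_on_subset)
    show "continuous_on ({a..b} \<times> K) (\<lambda>p. coords c (\<gamma>' (fst p)) (snd p))"
      by (rule joint_continuous_on) (use cont0 K c' in auto)
    show "continuous_on ({a..b} \<times> K) (\<lambda>p. coords c (\<gamma> (fst p)) (snd p))"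
    proof (rule joint_continuous_on)
      fix t assume t: "t \<in> {a..b}"
      show "continuous_on K (coords c (\<gamma> t))"
        using smooth_coords_continuous[OF bspec[OF smooth t] K(1)] K(3) by (rule continuous_on_subset)
      show "uniform_limit K (\<lambda>s. coords c (\<gamma> s)) (coords c (\<gamma> t)) (at t within {a..b})"
      proof (rule uniform_limitI)
        fix e :: real assume e: "e > 0"
        have "bounded (coords c (\<gamma>' t) ` K)"
          using c'[OF t] K(2) by (intro compact_imp_bounded compact_continuous_image)
        then obtain C where C: "C > 0" "\<And>y. y \<in> K \<Longrightarrow> norm (coords c (\<gamma>' t) y) \<le> C"
          unfolding bounded_pos by blast
        \<comment> \<open>Near \<open>t\<close> the difference quotients lie within \<open>1\<close>
          of a derivative bounded by \<open>C\<close> on \<open>K\<close>, so \<open>C + 1\<close>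
          serves as a Lipschitz constant at \<open>t\<close>, uniformly over
          \<open>K\<close>.\<close>
        have "((\<lambda>s. \<bar>s - t\<bar> * (C + 1)) \<longlongrightarrow> \<bar>t - t\<bar> * (C + 1)) (at t within {a..b})"
          by (intro tendsto_intros)
        then have "\<forall>\<^sub>F s in at t within {a..b}. \<bar>s - t\<bar> * (C + 1) < e"
          by (rule order_tendstoD(2)) (simp add: e)
        moreover have "\<forall>\<^sub>F s in at t within {a..b}. \<forall>y\<in>K.
            dist ((coords c (\<gamma> s) y - coords c (\<gamma> t) y) /\<^sub>R (s - t)) (coords c (\<gamma>' t) y) < 1"
          using uniform_limitD[OF quot0[OF t K]] by simp
        moreover have "\<forall>\<^sub>F s in at t within {a..b}. s \<noteq> t" by (simp add: eventually_at_filter)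
        ultimately show "\<forall>\<^sub>F s in at t within {a..b}. \<forall>y\<in>K. dist (coords c (\<gamma> s) y) (coords c (\<gamma> t) y) < e"
        proof eventually_elim
          case (elim s)
          show ?case
          proof
            fix y assume y: "y \<in> K"
            let ?q = "(coords c (\<gamma> s) y - coords c (\<gamma> t) y) /\<^sub>R (s - t)"
            have "norm ?q \<le> norm (?q - coords c (\<gamma>' t) y) + norm (coords c (\<gamma>' t) y)"
              by (metis diff_add_cancel norm_triangle_ineq)
            then have "norm ?q \<le> C + 1" using elim(2) y C(2)[OF y] by (force simp: dist_norm)
            moreover have "coords c (\<gamma> s) y - coords c (\<gamma> t) y = (s - t) *\<^sub>R ?q" using elim(3) by simp
            then have "dist (coords c (\<gamma> s) y) (coords c (\<gamma> t) y) = \<bar>s - t\<bar> * norm ?q"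
              unfolding dist_norm by (metis norm_scaleR)
            ultimately have "dist (coords c (\<gamma> s) y) (coords c (\<gamma> t) y) \<le> \<bar>s - t\<bar> * (C + 1)"
              by (simp add: mult_left_mono)
            then show "dist (coords c (\<gamma> s) y) (coords c (\<gamma> t) y) < e" using elim(1) by linarith
          qed
        qed
      qed
    qed
  qed (use \<gamma>' in auto)
qed

end


lemma consecutive_points:
  fixes T :: "real set"
  assumes T: "finite T" "{0, 1} \<subseteq> T" and t: "t \<in> {0..1}"
  obtains a b where "a \<in> T" "b \<in> T" "a < b" "T \<inter> {a<..<b} = {}" "t \<in> {a..b}"
proof (cases "t = 1")
  case True
  \<comment> \<open>At \<open>t = 1\<close> no break point lies further to the right, so
    \<open>1\<close> itself has to be the right end of the interval.\<close>
  define a where "a = Max {s \<in> T. s < 1}"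
  have "a \<in> {s \<in> T. s < 1}" unfolding a_def using T by (intro Max_in) auto
  moreover have "s \<le> a" if "s \<in> T" "s < 1" for s unfolding a_def using T that by (intro Max_ge) auto
  ultimately show thesis using T True by (intro that[of a 1]) force+
next
  case False
  define a where "a = Max {s \<in> T. s \<le> t}"
  define b where "b = Min {s \<in> T. s > t}"
  have a: "a \<in> {s \<in> T. s \<le> t}" unfolding a_def using T t by (intro Max_in) auto
  have a': "s \<le> a" if "s \<in> T" "s \<le> t" for s unfolding a_def using T that by (intro Max_ge) auto
  have b: "b \<in> {s \<in> T. s > t}" unfolding b_def using T t False by (intro Min_in) auto
  have b': "b \<le> s" if "s \<in> T" "s > t" for s unfolding b_def using T that by (intro Min_le) auto
  show thesis
  proof (rule that[of a b])
    show "T \<inter> {a<..<b} = {}"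
    proof (rule equals0I)
      fix s assume "s \<in> T \<inter> {a<..<b}"
      then show False using a'[of s] b'[of s] by (cases "s \<le> t") auto
    qed
  qed (use a b in auto)
qed

section \<open>Pointwise energy along a path of metrics\<close>

context manifold
begin

definition energy :: "('m, 'n) tensor_field \<Rightarrow> ('m, 'n) tensor_field \<Rightarrow> ('m, 'n) tensor_field \<Rightarrow> 'm \<Rightarrow> real" where
  "energy g h k x = (let c = chart_at A x in tensor_energy (det (g x c)) (h x c) (k x c))"

lemma energy_chart:
  assumes "g \<in> metrics A" "h \<in> metrics A" "k \<in> smooth_tensors A" "c \<in> A" "x \<in> chart_dom c"
  shows "energy g h k x = tensor_energy (det (g x c)) (h x c) (k x c)"
  unfolding energy_def Let_def using assms chart_at[of x]
  by (intro tensor_energy_chart) (auto simp: smooth_tensors_def)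

lemma energy_nonneg:
  assumes "g \<in> metrics A" "h \<in> metrics A" "k \<in> smooth_tensors A"
  shows "energy g h k x \<ge> 0"
  unfolding energy_def Let_def using assms chart_at[of x]
  by (intro tensor_energy_nonneg metric_pd metric_det_pos sym_tensor_field_transpose) (auto simp: smooth_tensors_def)

lemma measurable_energy:
  assumes "g \<in> metrics A" "h \<in> metrics A" "k \<in> smooth_tensors A"
  shows "energy g h k \<in> borel_measurable (volume A m)"
proof (rule measurable_volumeI)
  fix c assume c: "c \<in> A"
  have "continuous_on (chart_img c) (\<lambda>y. tensor_energy (det (coords c g y)) (coords c h y) (coords c k y))"
    using metric_coords_continuous[OF assms(1) c] metric_coords_continuous[OF assms(2) c]
      smooth_coords_continuous[OF assms(3) c] metric_det_pos[OF assms(1) c] metric_det_pos[OF assms(2) c]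
      chart_inv_in_dom[OF c]
    by (intro continuous_on_tensor_energy continuous_intros) (auto simp: coords_def less_imp_neq[symmetric])
  also have "?this \<longleftrightarrow> continuous_on (chart_img c) (\<lambda>y. energy g h k (chart_inv c y))"
    using energy_chart[OF assms c chart_inv_in_dom[OF c]] by (intro continuous_on_cong) (auto simp: coords_def)
  finally show "(\<lambda>y. energy g h k (chart_inv c y)) \<in> borel_measurable (lebesgue_on (chart_img c))"
    using open_chart_img[OF c] by (intro continuous_imp_measurable_on_sets_lebesgue) auto
qed

lemma finite_measure_volume: "g \<in> metrics A \<Longrightarrow> finite_measure (volume A g)"
  using finite_volume_metric by (intro finite_measureI) (auto simp: less_top)

text \<open>The bound \<open>B\<close> makes the energy integrable over the finite measure.
  Otherwise the Bochner integral in \<open>L2_inner\<close> would be \<open>0\<close> by convention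
  and say nothing about the nonnegative integral.\<close>

lemma nn_integral_energy:
  assumes g: "g \<in> metrics A" and h: "h \<in> metrics A" and k: "k \<in> smooth_tensors A"
    and B: "\<And>x. energy g h k x \<le> B"
  shows "(\<integral>\<^sup>+x. ennreal (energy g h k x) \<partial>volume A g) = ennreal (L2_inner A h k k)" and "L2_inner A h k k \<ge> 0"
proof -
  let ?q = "\<lambda>x. trace (matrix_inv (h x (chart_at A x)) ** k x (chart_at A x)
      ** matrix_inv (h x (chart_at A x)) ** k x (chart_at A x))"
  \<comment> \<open>With \<open>h\<close> as its own reference metric the determinant factor is
    \<open>1\<close>, so measurability and sign of the trace follow from the lemmas on
    \<open>energy\<close>.\<close>
  have q: "energy h h k = ?q"
    using metric_det_pos[OF h chart_at] by (auto simp: energy_def tensor_energy_def Let_def fun_eq_iff less_imp_neq[symmetric])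
  have meas: "?q \<in> borel_measurable (volume A m)" for m
    using measurable_energy[OF h h k] q by metis
  have pos: "?q x \<ge> 0" for x using energy_nonneg[OF h h k, of x] q by metis
  have "(\<integral>\<^sup>+x. ennreal (?q x) \<partial>volume A h) = (\<integral>\<^sup>+x. ennreal (sqrt (rel_det A g h x)) * ennreal (?q x) \<partial>volume A g)"
    using meas by (intro nn_integral_volume_density[OF g metric_in_measurable_semimetrics[OF h]]) auto
  also have "\<dots> = (\<integral>\<^sup>+x. ennreal (energy g h k x) \<partial>volume A g)"
  proof (rule nn_integral_cong)
    fix x
    have "rel_det A g h x = det (h x (chart_at A x)) / det (g x (chart_at A x))"
      by (rule rel_det_eq[OF g metric_sym[OF h] chart_at])
    then show "ennreal (sqrt (rel_det A g h x)) * ennreal (?q x) = ennreal (energy g h k x)"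
      using pos[of x] metric_det_pos[OF g chart_at, of x] metric_det_pos[OF h chart_at, of x]
      by (simp add: energy_def Let_def tensor_energy_def ennreal_mult)
  qed
  finally have eq: "(\<integral>\<^sup>+x. ennreal (?q x) \<partial>volume A h) = (\<integral>\<^sup>+x. ennreal (energy g h k x) \<partial>volume A g)" .
  have "(\<integral>\<^sup>+x. ennreal (energy g h k x) \<partial>volume A g) \<le> (\<integral>\<^sup>+x. ennreal B \<partial>volume A g)"
    by (intro nn_integral_mono ennreal_leI B)
  also have "\<dots> < \<infinity>" using finite_volume_metric[OF g] by (simp add: ennreal_mult_less_top)
  finally have fin: "(\<integral>\<^sup>+x. ennreal (energy g h k x) \<partial>volume A g) < \<infinity>" .
  have "L2_inner A h k k = enn2real (\<integral>\<^sup>+x. ennreal (?q x) \<partial>volume A h)"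
    unfolding L2_inner_def Let_def using meas pos by (intro integral_eq_nn_integral) auto
  then show "(\<integral>\<^sup>+x. ennreal (energy g h k x) \<partial>volume A g) = ennreal (L2_inner A h k k)" "L2_inner A h k k \<ge> 0"
    using fin eq by (auto simp: less_top)
qed

lemma C1_path_bounded_energy:
  assumes g: "g \<in> metrics A" and C1: "C1_path_on A a b \<gamma>" and ab: "{a..b} \<subseteq> {0..1}"
    and metric: "\<forall>t\<in>{0..1}. \<gamma> t \<in> metrics A"
  shows "\<And>t. t \<in> {a<..<b} \<Longrightarrow> velocity \<gamma> t \<in> smooth_tensors A"
    and "\<And>x c. c \<in> A \<Longrightarrow> x \<in> chart_dom c \<Longrightarrow> continuous_on {a..b} (\<lambda>t. \<gamma> t x c)"
    and "\<And>t x c. t \<in> {a<..<b} \<Longrightarrow> c \<in> A \<Longrightarrow> x \<in> chart_dom c \<Longrightarrow>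
      ((\<lambda>s. \<gamma> s x c) has_vector_derivative velocity \<gamma> t x c) (at t)"
    and "\<And>x c. c \<in> A \<Longrightarrow> x \<in> chart_dom c \<Longrightarrow> continuous_on {a<..<b} (\<lambda>t. velocity \<gamma> t x c)"
    and "bounded {energy g (\<gamma> t) (velocity \<gamma> t) x | t x. t \<in> {a<..<b}}"
proof -
  have smooth: "\<forall>t\<in>{a..b}. \<gamma> t \<in> smooth_tensors A"
    using metric ab by (auto simp: metrics_def)
  obtain \<gamma>' where \<gamma>': "\<And>t. t \<in> {a..b} \<Longrightarrow> \<gamma>' t \<in> smooth_tensors A"
    and der: "\<And>t x c. t \<in> {a..b} \<Longrightarrow> c \<in> A \<Longrightarrow> x \<in> chart_dom c \<Longrightarrow>
       ((\<lambda>s. \<gamma> s x c) has_vector_derivative \<gamma>' t x c) (at t within {a..b})"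
    and cont: "\<And>c K. c \<in> A \<Longrightarrow> compact K \<Longrightarrow> K \<subseteq> chart_img c \<Longrightarrow>
       continuous_on ({a..b} \<times> K) (\<lambda>p. coords c (\<gamma> (fst p)) (snd p))"
    and cont': "\<And>c K. c \<in> A \<Longrightarrow> compact K \<Longrightarrow> K \<subseteq> chart_img c \<Longrightarrow>
       continuous_on ({a..b} \<times> K) (\<lambda>p. coords c (\<gamma>' (fst p)) (snd p))"
    by (fact C1_path_facts[OF C1 smooth])
  have der_at: "((\<lambda>s. \<gamma> s x c) has_vector_derivative \<gamma>' t x c) (at t)"
    if "t \<in> {a<..<b}" "c \<in> A" "x \<in> chart_dom c" for t x c
    using der[of t c x] that at_within_Icc_at[of a t b] by auto
  have velocity: "velocity \<gamma> t = \<gamma>' t" if t: "t \<in> {a<..<b}" for t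
  proof (intro ext)
    fix x c
    have t': "at t within {0..1} = at t" using t ab by (intro at_within_Icc_at) auto
    have "((\<lambda>s. \<gamma> s x c) has_vector_derivative \<gamma>' t x c) (at t)"
    proof (cases "c \<in> A \<and> x \<in> chart_dom c")
      case True
      then show ?thesis using der_at[OF t] by blast
    next
      case False
      \<comment> \<open>In charts not around \<open>x\<close> all tensors are \<open>0\<close> by
        convention. The derivative has to be computed there as well, since tensor fields are
        compared as functions.\<close>
      have zero: "\<gamma>' t x c = 0" using \<gamma>'[of t] t False by (auto simp: smooth_tensors_def intro: sym_tensor_field_zero)
      have "0 = \<gamma> s x c" if "s \<in> {a<..<b}" for s
        using bspec[OF smooth, of s] that sym_tensor_field_zero[OF _ False] by (auto simp: smooth_tensors_def)
      then have "((\<lambda>s. \<gamma> s x c) has_vector_derivative 0) (at t)"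
        using t by (intro has_vector_derivative_transform_within_open[OF has_vector_derivative_const[of 0], of "{a<..<b}" t]) auto
      then show ?thesis by (simp add: zero)
    qed
    then show "velocity \<gamma> t x c = \<gamma>' t x c" unfolding velocity_def t' by (rule vector_derivative_at)
  qed
  show "velocity \<gamma> t \<in> smooth_tensors A" if "t \<in> {a<..<b}" for t
    using velocity[OF that] \<gamma>' that by auto
  show "continuous_on {a..b} (\<lambda>t. \<gamma> t x c)" if "c \<in> A" "x \<in> chart_dom c" for x c
    using der[OF _ that] has_vector_derivative_continuous continuous_on_eq_continuous_within by blast
  show "((\<lambda>s. \<gamma> s x c) has_vector_derivative velocity \<gamma> t x c) (at t)"
    if "t \<in> {a<..<b}" "c \<in> A" "x \<in> chart_dom c" for t x c
    using der_at[OF that] velocity[OF that(1)] by simp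
  show "continuous_on {a<..<b} (\<lambda>t. velocity \<gamma> t x c)" if c: "c \<in> A" "x \<in> chart_dom c" for x c
  proof -
    have "continuous_on {a<..<b} (\<lambda>t. coords c (\<gamma>' (fst (t, chart_map c x))) (snd (t, chart_map c x)))"
      using chart_map_in_img[OF c]
      by (intro continuous_on_compose2[OF cont'[of c "{chart_map c x}"]] continuous_intros c) auto
    then show ?thesis
      by (rule continuous_on_cong[THEN iffD1, rotated -1, OF _ refl])
        (simp add: velocity coords_def chart_inv_map[OF c])
  qed
  obtain J where J: "finite J" "\<And>c K. (c, K) \<in> J \<Longrightarrow> c \<in> A \<and> compact K \<and> K \<subseteq> chart_img c"
    "(\<Union>(c, K)\<in>J. chart_inv c ` K) = UNIV" by (fact compact_chart_cover)
  \<comment> \<open>\<open>E\<close> is built from \<open>\<gamma>'\<close> rather than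
    \<open>velocity\<close>: the two agree inside the interval, but \<open>\<gamma>'\<close> is also
    continuous up to its endpoints, as the compactness argument requires.\<close>
  define E where "E c p = tensor_energy (det (coords c g (snd p))) (coords c (\<gamma> (fst p)) (snd p)) (coords c (\<gamma>' (fst p)) (snd p))"
    for c and p :: "real \<times> (real^'n)"
  have "bounded (E c ` ({a..b} \<times> K))" if "(c, K) \<in> J" for c K
  proof -
    from J(2)[OF that] have c: "c \<in> A" and K: "compact K" "K \<subseteq> chart_img c" by auto
    have "continuous_on ({a..b} \<times> K) (E c)"
      unfolding E_def
    proof (intro continuous_on_tensor_energy cont cont' c K continuous_on_det)
      show "continuous_on ({a..b} \<times> K) (\<lambda>p. coords c g (snd p))"
        using K by (intro continuous_on_compose2[OF metric_coords_continuous[OF g c]] continuous_intros) auto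
      fix p assume "p \<in> {a..b} \<times> K"
      then have p: "fst p \<in> {0..1}" "chart_inv c (snd p) \<in> chart_dom c"
        using ab K chart_inv_in_dom[OF c] by auto
      show "det (coords c g (snd p)) \<noteq> 0" "det (coords c (\<gamma> (fst p)) (snd p)) \<noteq> 0"
        using metric_det_pos[OF g c p(2)] metric_det_pos[OF bspec[OF metric p(1)] c p(2)] by (simp_all add: coords_def)
    qed
    then show ?thesis using K by (intro compact_imp_bounded compact_continuous_image compact_Times) auto
  qed
  then have "bounded (\<Union>p\<in>J. E (fst p) ` ({a..b} \<times> snd p))"
    using J(1) by (intro bounded_UN) auto
  then show "bounded {energy g (\<gamma> t) (velocity \<gamma> t) x | t x. t \<in> {a<..<b}}"
  proof (rule bounded_subset, safe)
    fix t x assume t: "t \<in> {a<..<b}"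
    have "x \<in> (\<Union>(c, K)\<in>J. chart_inv c ` K)" using J(3) by simp
    then obtain c K y where y: "(c, K) \<in> J" "y \<in> K" "x = chart_inv c y" by auto
    from J(2)[OF y(1)] have c: "c \<in> A" and K: "K \<subseteq> chart_img c" by auto
    have x: "x \<in> chart_dom c" using y K chart_inv_in_dom[OF c] by auto
    have "energy g (\<gamma> t) (velocity \<gamma> t) x = E c (t, y)"
      using energy_chart[OF g bspec[OF metric] \<gamma>' c x, of t t] t ab velocity[OF t] y(3) by (auto simp: E_def coords_def)
    moreover have "E c (t, y) \<in> E c ` ({a..b} \<times> K)" using t y by auto
    ultimately show "energy g (\<gamma> t) (velocity \<gamma> t) x \<in> (\<Union>p\<in>J. E (fst p) ` ({a..b} \<times> snd p))"
      using y(1) by force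
  qed
qed

text \<open>The conclusions on the intervals between consecutive break points are glued together.
  There are finitely many such intervals, so a single \<open>B\<close> bounds the energy at all
  times away from the break points.\<close>

lemma metric_path_facts:
  assumes g: "g \<in> metrics A" and path: "metric_path A \<gamma>"
  obtains T B where "finite T"
    "\<And>t. t \<in> {0<..<1} - T \<Longrightarrow> velocity \<gamma> t \<in> smooth_tensors A"
    "\<And>x c. c \<in> A \<Longrightarrow> x \<in> chart_dom c \<Longrightarrow> continuous_on {0..1} (\<lambda>t. \<gamma> t x c)"
    "\<And>t x c. t \<in> {0<..<1} - T \<Longrightarrow> c \<in> A \<Longrightarrow> x \<in> chart_dom c \<Longrightarrow>
      ((\<lambda>s. \<gamma> s x c) has_vector_derivative velocity \<gamma> t x c) (at t)"
    "\<And>x c. c \<in> A \<Longrightarrow> x \<in> chart_dom c \<Longrightarrow> continuous_on ({0<..<1} - T) (\<lambda>t. velocity \<gamma> t x c)"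
    "\<And>t x. t \<in> {0<..<1} - T \<Longrightarrow> energy g (\<gamma> t) (velocity \<gamma> t) x \<le> B"
proof -
  have metric: "\<forall>t\<in>{0..1}. \<gamma> t \<in> metrics A" using path by (simp add: metric_path_def)
  obtain T where T: "finite T" "{0, 1} \<subseteq> T" "T \<subseteq> {0..1}"
    and C1: "\<forall>a\<in>T. \<forall>b\<in>T. a < b \<and> T \<inter> {a<..<b} = {} \<longrightarrow> C1_path_on A a b \<gamma>"
    using path unfolding metric_path_def by blast
  define P where "P = {(a, b). a \<in> T \<and> b \<in> T \<and> a < b \<and> T \<inter> {a<..<b} = {}}"
  have P: "C1_path_on A a b \<gamma>" "{a..b} \<subseteq> {0..1}" if "(a, b) \<in> P" for a b
    using that C1 T(3) by (auto simp: P_def)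
  note facts = C1_path_bounded_energy[OF g P metric]
  have "P \<subseteq> T \<times> T" by (auto simp: P_def)
  then have "finite P" by (rule finite_subset) (simp add: T(1))
  have cover: "\<exists>a b. (a, b) \<in> P \<and> t \<in> {a..b}" if t: "t \<in> {0..1}" for t
  proof -
    obtain a b where "a \<in> T" "b \<in> T" "a < b" "T \<inter> {a<..<b} = {}" "t \<in> {a..b}"
      by (fact consecutive_points[OF T(1,2) t])
    then have "(a, b) \<in> P \<and> t \<in> {a..b}" by (simp add: P_def)
    then show ?thesis by blast
  qed
  have cover': "\<exists>a b. (a, b) \<in> P \<and> t \<in> {a<..<b}" if t: "t \<in> {0<..<1} - T" for t
  proof -
    obtain a b where ab: "(a, b) \<in> P" "t \<in> {a..b}" using cover[of t] t by auto
    moreover have "a \<in> T" "b \<in> T" using ab(1) by (auto simp: P_def)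
    ultimately show ?thesis using t by (metis DiffD2 atLeastAtMost_iff greaterThanLessThan_iff order_le_less)
  qed
  have "bounded (\<Union>p\<in>P. {energy g (\<gamma> t) (velocity \<gamma> t) x | t x. t \<in> {fst p<..<snd p}})"
    using \<open>finite P\<close> facts(5) by (intro bounded_UN) auto
  then obtain B where B: "\<forall>r\<in>(\<Union>p\<in>P. {energy g (\<gamma> t) (velocity \<gamma> t) x | t x. t \<in> {fst p<..<snd p}}). norm r \<le> B"
    unfolding bounded_iff by blast
  show thesis
  proof (rule that[of T B])
    show "velocity \<gamma> t \<in> smooth_tensors A" if "t \<in> {0<..<1} - T" for t
      using cover'[OF that] facts(1) by blast
    show "((\<lambda>s. \<gamma> s x c) has_vector_derivative velocity \<gamma> t x c) (at t)"
      if "t \<in> {0<..<1} - T" "c \<in> A" "x \<in> chart_dom c" for t x c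
      using cover'[OF that(1)] facts(3) that by blast
    show "energy g (\<gamma> t) (velocity \<gamma> t) x \<le> B" if t: "t \<in> {0<..<1} - T" for t x
    proof -
      obtain a b where ab: "(a, b) \<in> P" "t \<in> {a<..<b}" using cover'[OF t] by auto
      then have "energy g (\<gamma> t) (velocity \<gamma> t) x \<in> (\<Union>p\<in>P. {energy g (\<gamma> t) (velocity \<gamma> t) x | t x. t \<in> {fst p<..<snd p}})"
        by force
      then show ?thesis using B by fastforce
    qed
    show "continuous_on {0..1} (\<lambda>t. \<gamma> t x c)" if c: "c \<in> A" "x \<in> chart_dom c" for x c
    proof -
      have "continuous_on (\<Union>p\<in>P. {fst p..snd p}) (\<lambda>t. \<gamma> t x c)"
      proof (rule continuous_on_closed_Union[OF \<open>finite P\<close>])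
        fix p assume "p \<in> P"
        then have "(fst p, snd p) \<in> P" by simp
        from facts(2)[OF this this c] show "continuous_on {fst p..snd p} (\<lambda>t. \<gamma> t x c)" .
      qed simp
      moreover have "(\<Union>p\<in>P. {fst p..snd p}) = {0..1}"
      proof (intro equalityI subsetI)
        fix t :: real assume "t \<in> {0..1}"
        then obtain a b where "(a, b) \<in> P" "t \<in> {a..b}" using cover by blast
        then show "t \<in> (\<Union>p\<in>P. {fst p..snd p})" by (intro UN_I[of "(a, b)"]) simp_all
      next
        fix t assume "t \<in> (\<Union>p\<in>P. {fst p..snd p})"
        then obtain p where p: "p \<in> P" "t \<in> {fst p..snd p}" by blast
        then have "(fst p, snd p) \<in> P" by simp
        from P(2)[OF this] p(2) show "t \<in> {0..1}" by blast
      qed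
      ultimately show ?thesis by simp
    qed
    show "continuous_on ({0<..<1} - T) (\<lambda>t. velocity \<gamma> t x c)" if c: "c \<in> A" "x \<in> chart_dom c" for x c
    proof (intro continuous_at_imp_continuous_on ballI)
      fix t assume "t \<in> {0<..<1} - T"
      then obtain a b where ab: "(a, b) \<in> P" "t \<in> {a<..<b}" using cover' by blast
      have "continuous_on {a<..<b} (\<lambda>t. velocity \<gamma> t x c)" by (rule facts(4)[OF ab(1) ab(1) c])
      then show "isCont (\<lambda>t. velocity \<gamma> t x c) t"
        using ab(2) by (simp add: continuous_on_eq_continuous_at)
    qed
  qed (use T in auto)
qed

end


text \<open>Path lengths are gauge integrals, while the integral inequality is proved for
  nonnegative Lebesgue integrals; this is the passage between the two.\<close>

lemma bounded_integral_unit_interval: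
  fixes f :: "real \<Rightarrow> real"
  assumes meas: "f \<in> borel_measurable borel" and pos: "\<And>t. f t \<ge> 0" and bound: "\<And>t. f t \<le> C"
    and zero: "\<And>t. t \<notin> {0..1} \<Longrightarrow> f t = 0"
  shows "f integrable_on {0..1}" and "ennreal (integral {0..1} f) = (\<integral>\<^sup>+t. ennreal (f t) \<partial>lborel)"
proof -
  have C: "integrable lborel (\<lambda>t. C * indicator {0..1::real} t)" by simp
  have "norm (f t) \<le> norm (C * indicator {0..1} t)" for t
    using pos[of t] bound[of t] zero[of t] by (cases "t \<in> {0..1}") auto
  then have int: "integrable lborel f"
    using meas by (intro Bochner_Integration.integrable_bound[OF C] AE_I2) auto
  have "(\<lambda>t. if t \<in> {0..1} then f t else 0) = f" using zero by auto
  then have "(f has_integral (integral\<^sup>L lborel f)) {0..1}"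
    using has_integral_integral_lborel[OF int] has_integral_restrict_UNIV[of "{0..1}" f] by metis
  moreover have "(\<integral>\<^sup>+t. ennreal (f t) \<partial>lborel) = ennreal (integral\<^sup>L lborel f)"
    using int pos by (intro nn_integral_eq_integral) auto
  ultimately show "f integrable_on {0..1}" "ennreal (integral {0..1} f) = (\<integral>\<^sup>+t. ennreal (f t) \<partial>lborel)"
    by (auto simp: integral_unique)
qed

section \<open>Pointwise length and \<open>L^2\<close> length of a path\<close>

context manifold
begin

lemma metric_path_estimate:
  assumes g: "g \<in> metrics A" and path: "metric_path A \<gamma>"
  obtains \<phi> where "\<phi> \<in> borel_measurable (volume A g)" "\<And>x. \<phi> x \<ge> 0"
    "metric_path_length A \<gamma> \<ge> 0"
    "(\<integral>\<^sup>+x. ennreal ((\<phi> x)\<^sup>2) \<partial>volume A g) \<le> ennreal ((metric_path_length A \<gamma>)\<^sup>2)"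
    "\<And>x. close_tensors (det (g x (chart_at A x))) (\<phi> x) (\<gamma> 0 x (chart_at A x)) (\<gamma> 1 x (chart_at A x))"
proof -
  obtain T B where T: "finite T"
    and smooth: "\<And>t. t \<in> {0<..<1} - T \<Longrightarrow> velocity \<gamma> t \<in> smooth_tensors A"
    and cont: "\<And>x c. c \<in> A \<Longrightarrow> x \<in> chart_dom c \<Longrightarrow> continuous_on {0..1} (\<lambda>t. \<gamma> t x c)"
    and der: "\<And>t x c. t \<in> {0<..<1} - T \<Longrightarrow> c \<in> A \<Longrightarrow> x \<in> chart_dom c \<Longrightarrow>
      ((\<lambda>s. \<gamma> s x c) has_vector_derivative velocity \<gamma> t x c) (at t)"
    and cont': "\<And>x c. c \<in> A \<Longrightarrow> x \<in> chart_dom c \<Longrightarrow> continuous_on ({0<..<1} - T) (\<lambda>t. velocity \<gamma> t x c)"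
    and B: "\<And>t x. t \<in> {0<..<1} - T \<Longrightarrow> energy g (\<gamma> t) (velocity \<gamma> t) x \<le> B"
    by (fact metric_path_facts[OF g path])
  have metric: "\<gamma> t \<in> metrics A" if "t \<in> {0..1}" for t using path that by (simp add: metric_path_def)
  \<comment> \<open>Removing the break points leaves an open set of times on which the energy is
    continuous in \<open>t\<close>, as the joint measurability of \<open>l\<close> requires. Outside
    \<open>U\<close> the speeds are set to \<open>0\<close>, which changes no integral over the unit
    interval.\<close>
  define U where "U = {0<..<1} - T"
  have U: "open U" "U \<subseteq> {0..1}" using T by (auto simp: U_def intro: open_Diff finite_imp_closed)
  define e where "e t = energy g (\<gamma> t) (velocity \<gamma> t)" for t
  define l where "l t x = (if t \<in> U then sqrt (e t x) else 0)" for t x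
  define L where "L t = (if t \<in> U then sqrt (L2_inner A (\<gamma> t) (velocity \<gamma> t) (velocity \<gamma> t)) else 0)" for t
  define \<phi> where "\<phi> x = integral {0..1} (\<lambda>t. l t x)" for x
  interpret M: finite_measure "volume A g" by (rule finite_measure_volume[OF g])
  have e_pos: "e t x \<ge> 0" if "t \<in> U" for t x
    unfolding e_def using that U by (intro energy_nonneg g metric smooth) (auto simp: U_def)
  have e_B: "e t x \<le> B" if "t \<in> U" for t x using B that by (simp add: e_def U_def)
  have e_meas: "e t \<in> borel_measurable (volume A g)" if "t \<in> U" for t
    unfolding e_def using that U by (intro measurable_energy g metric smooth) (auto simp: U_def)
  have e_cont: "continuous_on U (\<lambda>t. e t x)" for x
    unfolding e_def energy_def Let_def
  proof (intro continuous_on_tensor_energy continuous_on_const)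
    show "continuous_on U (\<lambda>t. \<gamma> t x (chart_at A x))"
      using cont[OF chart_at] U(2) by (rule continuous_on_subset)
    show "continuous_on U (\<lambda>t. velocity \<gamma> t x (chart_at A x))"
      unfolding U_def by (rule cont'[OF chart_at])
    show "det (g x (chart_at A x)) \<noteq> 0" using metric_det_pos[OF g chart_at, of x] by simp
    show "det (\<gamma> t x (chart_at A x)) \<noteq> 0" if "t \<in> U" for t
      using metric_det_pos[OF metric chart_at, of t x] that U by auto
  qed
  have l_meas: "(\<lambda>(t, x). l t x) \<in> borel_measurable (borel \<Otimes>\<^sub>M volume A g)"
    unfolding l_def using U(1) e_meas e_cont
    by (intro measurable_Caratheodory) (auto intro!: continuous_intros)
  have l_pos: "l t x \<ge> 0" for t x using e_pos by (simp add: l_def)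
  have l_bound: "l t x \<le> sqrt \<bar>B\<bar>" for t x
    using e_B[of t x] by (auto simp: l_def)
  have l_zero: "l t x = 0" if "t \<notin> {0..1}" for t x using that U by (auto simp: l_def)
  have l_meas_t: "(\<lambda>t. l t x) \<in> borel_measurable borel" for x
    using measurable_compose[OF measurable_Pair2'[of x "volume A g" borel] l_meas] by simp
  note l_int = bounded_integral_unit_interval[OF l_meas_t l_pos l_bound l_zero]
  have l_meas': "(\<lambda>(t, x). ennreal (l t x)) \<in> borel_measurable (borel \<Otimes>\<^sub>M volume A g)"
    using l_meas by (simp add: case_prod_unfold)
  have e_int: "(\<integral>\<^sup>+x. ennreal (e t x) \<partial>volume A g) = ennreal ((L t)\<^sup>2)" if t: "t \<in> U" for t
  proof -
    have t': "t \<in> {0..1}" "t \<in> {0<..<1} - T" using t U by (auto simp: U_def)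
    show ?thesis
      using nn_integral_energy[OF g metric[OF t'(1)] smooth[OF t'(2)] B[OF t'(2)]] t by (simp add: e_def L_def)
  qed
  have L_pos: "L t \<ge> 0" for t
  proof (cases "t \<in> U")
    case True
    then have t': "t \<in> {0..1}" "t \<in> {0<..<1} - T" using U by (auto simp: U_def)
    show ?thesis using nn_integral_energy(2)[OF g metric[OF t'(1)] smooth[OF t'(2)] B[OF t'(2)]] by (simp add: L_def)
  qed (simp add: L_def)
  have l_L: "(\<integral>\<^sup>+x. (ennreal (l t x))\<^sup>2 \<partial>volume A g) = (ennreal (L t))\<^sup>2" for t
  proof (cases "t \<in> U")
    case True
    then show ?thesis using e_int[OF True] e_pos[OF True] L_pos[of t] by (simp add: l_def ennreal_power)
  qed (simp add: l_def L_def)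
  \<comment> \<open>The speed is expressed through a spatial integral of \<open>l\<close>, so that
    its measurability in time is inherited from the joint measurability of \<open>l\<close>.\<close>
  have L_eq: "L t = sqrt (enn2real (\<integral>\<^sup>+x. (ennreal (l t x))\<^sup>2 \<partial>volume A g))" for t
    using L_pos[of t] by (simp add: l_L ennreal_power)
  have [measurable]: "(\<lambda>t. \<integral>\<^sup>+x. (ennreal (l t x))\<^sup>2 \<partial>volume A g) \<in> borel_measurable borel"
    using l_meas' by (intro M.borel_measurable_nn_integral) (simp add: case_prod_unfold)
  have L_meas: "L \<in> borel_measurable borel"
    unfolding L_eq by measurable
  have L_bound: "L t \<le> sqrt (\<bar>B\<bar> * measure (volume A g) UNIV)" for t
  proof -
    have "(ennreal (L t))\<^sup>2 \<le> (\<integral>\<^sup>+x. ennreal \<bar>B\<bar> \<partial>volume A g)"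
    proof (subst l_L[symmetric], rule nn_integral_mono)
      fix x
      have "(l t x)\<^sup>2 \<le> (sqrt \<bar>B\<bar>)\<^sup>2" using l_bound l_pos by (rule power_mono)
      then show "(ennreal (l t x))\<^sup>2 \<le> ennreal \<bar>B\<bar>"
        using l_pos[of t x] by (simp add: ennreal_power ennreal_leI)
    qed
    also have "\<dots> = ennreal (\<bar>B\<bar> * measure (volume A g) UNIV)"
      using M.emeasure_eq_measure[of UNIV] by (simp add: ennreal_mult)
    finally have "(L t)\<^sup>2 \<le> \<bar>B\<bar> * measure (volume A g) UNIV"
      using L_pos[of t] by (simp add: ennreal_power)
    then show ?thesis by (rule real_le_rsqrt)
  qed
  have L_zero: "L t = 0" if "t \<notin> {0..1}" for t using that U by (auto simp: L_def)
  note L_int = bounded_integral_unit_interval[OF L_meas L_pos L_bound L_zero]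
  have length: "metric_path_length A \<gamma> = integral {0..1} L"
    unfolding metric_path_length_def
  proof (rule integral_spike)
    show "negligible (insert 0 (insert 1 T))" using T by (intro negligible_finite) simp
    show "L t = sqrt (L2_inner A (\<gamma> t) (velocity \<gamma> t) (velocity \<gamma> t))" if "t \<in> {0..1} - insert 0 (insert 1 T)" for t
      using that by (auto simp: L_def U_def)
  qed
  have length_pos: "metric_path_length A \<gamma> \<ge> 0"
    unfolding length using L_int(1) L_pos by (rule integral_nonneg)
  have \<phi>_eq: "ennreal (\<phi> x) = (\<integral>\<^sup>+t. ennreal (l t x) \<partial>lborel)" for x
    unfolding \<phi>_def by (rule l_int(2))
  have \<phi>_pos: "\<phi> x \<ge> 0" for x
    unfolding \<phi>_def using l_int(1) l_pos by (rule integral_nonneg)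
  have "(\<lambda>(x, t). ennreal (l t x)) \<in> borel_measurable (volume A g \<Otimes>\<^sub>M lborel)"
    using measurable_compose[OF measurable_pair_swap' l_meas']
    by (simp add: case_prod_unfold cong: measurable_cong_sets sets_pair_measure_cong)
  then have "(\<lambda>x. \<integral>\<^sup>+t. ennreal (l t x) \<partial>lborel) \<in> borel_measurable (volume A g)"
    by (rule lborel.borel_measurable_nn_integral)
  moreover have "\<phi> = (\<lambda>x. enn2real (\<integral>\<^sup>+t. ennreal (l t x) \<partial>lborel))"
    using \<phi>_pos by (simp add: fun_eq_iff \<phi>_eq[symmetric])
  ultimately have \<phi>_meas: "\<phi> \<in> borel_measurable (volume A g)" by simp
  have "(\<integral>\<^sup>+x. (\<integral>\<^sup>+t. ennreal (l t x) \<partial>lborel)\<^sup>2 \<partial>volume A g) \<le> (\<integral>\<^sup>+t. ennreal (L t) \<partial>lborel)\<^sup>2"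
    using L_meas by (intro nn_integral_square_le M.sigma_finite_measure_axioms l_meas') (auto simp: l_L)
  moreover have "ennreal (metric_path_length A \<gamma>) = (\<integral>\<^sup>+t. ennreal (L t) \<partial>lborel)"
    unfolding length by (rule L_int(2))
  ultimately have "(\<integral>\<^sup>+x. ennreal ((\<phi> x)\<^sup>2) \<partial>volume A g) \<le> ennreal ((metric_path_length A \<gamma>)\<^sup>2)"
    using length_pos \<phi>_pos by (simp add: \<phi>_eq[symmetric] flip: ennreal_power)
  moreover have "close_tensors (det (g x (chart_at A x))) (\<phi> x) (\<gamma> 0 x (chart_at A x)) (\<gamma> 1 x (chart_at A x))" for x
    unfolding \<phi>_def
  proof (rule path_close_tensors[OF T, where b = "\<lambda>t. velocity \<gamma> t x (chart_at A x)"])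
    show "continuous_on {0..1} (\<lambda>t. \<gamma> t x (chart_at A x))" by (rule cont[OF chart_at])
    show "pd_matrix (\<gamma> t x (chart_at A x))" if "t \<in> {0..1}" for t
      by (rule metric_pd[OF metric[OF that] chart_at])
    show "((\<lambda>t. \<gamma> t x (chart_at A x)) has_vector_derivative velocity \<gamma> t x (chart_at A x)) (at t)"
      if "t \<in> {0<..<1} - T" for t by (rule der[OF that chart_at])
    show "transpose (velocity \<gamma> t x (chart_at A x)) = velocity \<gamma> t x (chart_at A x)"
      if "t \<in> {0<..<1} - T" for t
      using smooth[OF that] chart_at by (intro sym_tensor_field_transpose) (auto simp: smooth_tensors_def)
    show "det (g x (chart_at A x)) > 0" by (rule metric_det_pos[OF g chart_at])
    show "l t x = sqrt (tensor_energy (det (g x (chart_at A x))) (\<gamma> t x (chart_at A x)) (velocity \<gamma> t x (chart_at A x)))"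
      if "t \<in> {0<..<1} - T" for t using that by (simp add: l_def U_def e_def energy_def Let_def)
  qed (use l_pos l_int(1) in auto)
  ultimately show thesis using that \<phi>_meas \<phi>_pos length_pos by blast
qed

lemma path_lengths_nonempty:
  assumes "g0 \<in> metrics A" "g1 \<in> metrics A"
  shows "{metric_path_length A \<gamma> | \<gamma>. metric_path A \<gamma> \<and> \<gamma> 0 = g0 \<and> \<gamma> 1 = g1} \<noteq> {}"
  using straight_metric_path[OF assms] by blast

lemma metric_path_length_nonneg:
  assumes "metric_path A \<gamma>"
  shows "metric_path_length A \<gamma> \<ge> 0"
proof -
  \<comment> \<open>The estimate needs some reference metric; the initial point of the path
    serves.\<close>
  have "\<gamma> 0 \<in> metrics A" using assms by (simp add: metric_path_def)
  from metric_path_estimate[OF this assms] show ?thesis by blast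
qed

lemma L2_dist_nonneg:
  assumes "g0 \<in> metrics A" "g1 \<in> metrics A"
  shows "L2_dist A g0 g1 \<ge> 0"
  unfolding L2_dist_def using path_lengths_nonempty[OF assms] metric_path_length_nonneg
  by (intro cInf_greatest) auto

lemma L2_dist_less_path:
  assumes "g0 \<in> metrics A" "g1 \<in> metrics A" "L2_dist A g0 g1 < e"
  obtains \<gamma> where "metric_path A \<gamma>" "\<gamma> 0 = g0" "\<gamma> 1 = g1" "metric_path_length A \<gamma> < e"
  using cInf_lessD[OF path_lengths_nonempty[OF assms(1,2)]] assms(3) unfolding L2_dist_def by blast

end


section \<open>The limit semimetric\<close>

lemma fast_subsequence:
  fixes d :: "'a \<Rightarrow> 'a \<Rightarrow> real" and \<epsilon> :: "nat \<Rightarrow> real"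
  assumes Cauchy: "\<forall>e>0. \<exists>N. \<forall>m\<ge>N. \<forall>n\<ge>N. d (x m) (x n) < e" and \<epsilon>: "\<And>k. \<epsilon> k > 0"
  obtains r :: "nat \<Rightarrow> nat" where "strict_mono r" "\<And>k. d (x (r k)) (x (r (Suc k))) < \<epsilon> k"
proof -
  have "\<forall>k. \<exists>N. \<forall>m\<ge>N. \<forall>n\<ge>N. d (x m) (x n) < \<epsilon> k" using Cauchy \<epsilon> by blast
  then obtain N where N: "\<And>k m n. m \<ge> N k \<Longrightarrow> n \<ge> N k \<Longrightarrow> d (x m) (x n) < \<epsilon> k"
    by metis
  have "\<exists>r. \<forall>k. r k \<ge> N k \<and> r k < r (Suc k)"
  proof (rule dependent_nat_choice)
    show "\<exists>n. n \<ge> N 0" by blast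
    show "\<exists>m. m \<ge> N (Suc k) \<and> n < m" for n k
      by (rule exI[of _ "max (Suc n) (N (Suc k))"]) simp
  qed
  then obtain r where r: "\<And>k. r k \<ge> N k" "\<And>k. r k < r (Suc k)" by auto
  show thesis
  proof (rule that[of r])
    show "strict_mono r" using r(2) by (simp add: strict_mono_Suc_iff)
    show "d (x (r k)) (x (r (Suc k))) < \<epsilon> k" for k
      using r(1)[of k] r(2)[of k] by (intro N) auto
  qed
qed

text \<open>Cauchy--Schwarz with the weights \<open>(1/2) ^ k\<close> and \<open>2 ^ k\<close>; the
  first weights sum to at most \<open>2\<close>, the factor on the right. A bound on weighted
  squares thus controls the sum and its square at once.\<close>

lemma weighted_square_sum:
  fixes \<phi> :: "nat \<Rightarrow> real"
  assumes "\<And>k. \<phi> k \<ge> 0" "\<And>m. (\<Sum>k<m. 2 ^ k * (\<phi> k)\<^sup>2) \<le> \<psi>"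
  shows "(\<Sum>k<m. \<phi> k)\<^sup>2 \<le> 2 * \<psi>" and "summable \<phi>"
proof -
  have bound: "(\<Sum>k<m. \<phi> k)\<^sup>2 \<le> 2 * \<psi>" for m
  proof -
    have "(\<Sum>k<m. \<phi> k) = (\<Sum>k<m. sqrt ((1/2) ^ k) * (sqrt (2 ^ k) * \<phi> k))"
      by (intro sum.cong refl) (simp add: real_sqrt_mult[symmetric] mult.assoc[symmetric] power_mult_distrib[symmetric])
    then have "(\<Sum>k<m. \<phi> k)\<^sup>2 \<le> (\<Sum>k<m. (sqrt ((1/2) ^ k))\<^sup>2) * (\<Sum>k<m. (sqrt (2 ^ k) * \<phi> k)\<^sup>2)"
      using Cauchy_Schwarz_ineq_sum[of "\<lambda>k. sqrt ((1/2) ^ k)" "\<lambda>k. sqrt (2 ^ k) * \<phi> k" "{..<m}"] by simp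
    also have "\<dots> = (\<Sum>k<m. (1/2) ^ k) * (\<Sum>k<m. 2 ^ k * (\<phi> k)\<^sup>2)"
      by (simp add: power_mult_distrib)
    also have "\<dots> \<le> 2 * \<psi>"
    proof (rule mult_mono)
      have "(\<Sum>k<m. (1/2 :: real) ^ k) = 2 - 2 * (1/2) ^ m"
        by (induction m) (auto simp: field_simps)
      then show "(\<Sum>k<m. (1/2 :: real) ^ k) \<le> 2" by simp
    qed (use assms in \<open>auto intro: sum_nonneg\<close>)
    finally show ?thesis .
  qed
  then show "(\<Sum>k<m. \<phi> k)\<^sup>2 \<le> 2 * \<psi>" .
  show "summable \<phi>"
    using assms(1) real_le_rsqrt[OF bound] by (intro summableI_nonneg_bounded[of \<phi> "sqrt (2 * \<psi>)"]) auto
qed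

lemma close_tensors_det_bound:
  fixes a :: "nat \<Rightarrow> real^'n^'n"
  assumes close: "\<And>k. close_tensors \<rho> (\<phi> k) (a k) (a (Suc k))"
  shows "det_root \<rho> (a k) \<le> det_root \<rho> (a 0) + sqrt CARD('n) / 4 * (\<Sum>j<k. \<phi> j)"
proof (induction k)
  case (Suc k)
  have "\<bar>det_root \<rho> (a (Suc k)) - det_root \<rho> (a k)\<bar> \<le> sqrt CARD('n) / 4 * \<phi> k"
    using close[of k] unfolding close_tensors_def by blast
  moreover have "sqrt CARD('n) / 4 * (\<Sum>j<Suc k. \<phi> j) = sqrt CARD('n) / 4 * (\<Sum>j<k. \<phi> j) + sqrt CARD('n) / 4 * \<phi> k"
    by (simp add: distrib_left)
  ultimately show ?case using Suc by linarith
qed simp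

context manifold
begin

text \<open>Off the deflated set the determinants at each point have a positive lower bound, and off
  \<open>N\<close> the pointwise lengths are summable; together this gives convergence to a definite
  limit. The exact form of the degenerate set is recorded for the comparison with other
  representatives.\<close>

lemma omega_limit_exists:
  assumes g: "g \<in> metrics A" and h: "\<And>k. h k \<in> metrics A"
    and fast: "\<And>k. L2_dist A (h k) (h (Suc k)) < (1/4) ^ k"
  obtains ginf N where "ginf \<in> finite_volume_semimetrics A" "N \<in> null_sets (volume A g)"
    "deflated_set A g h \<in> lebesgue_sets A"
    "degenerate_set A ginf = deflated_set A g h \<union> N"
    "\<And>x c. x \<notin> deflated_set A g h \<union> N \<Longrightarrow> c \<in> A \<Longrightarrow> x \<in> chart_dom c \<Longrightarrow> (\<lambda>k. h k x c) \<longlonglongrightarrow> ginf x c"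
proof -
  let ?c = "chart_at A"
  let ?C = "sqrt CARD('n) / 4"
  have "\<exists>\<phi>. \<phi> \<in> borel_measurable (volume A g) \<and> (\<forall>x. \<phi> x \<ge> 0) \<and>
    (\<integral>\<^sup>+x. ennreal ((\<phi> x)\<^sup>2) \<partial>volume A g) \<le> ennreal (((1/4) ^ k)\<^sup>2) \<and>
    (\<forall>x. close_tensors (det (g x (?c x))) (\<phi> x) (h k x (?c x)) (h (Suc k) x (?c x)))" for k
  proof -
    obtain \<gamma> where \<gamma>: "metric_path A \<gamma>" "\<gamma> 0 = h k" "\<gamma> 1 = h (Suc k)" "metric_path_length A \<gamma> < (1/4) ^ k"
      using L2_dist_less_path[OF h h fast] by metis
    obtain \<phi> where \<phi>: "\<phi> \<in> borel_measurable (volume A g)" "\<And>x. \<phi> x \<ge> 0" "metric_path_length A \<gamma> \<ge> 0"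
      "(\<integral>\<^sup>+x. ennreal ((\<phi> x)\<^sup>2) \<partial>volume A g) \<le> ennreal ((metric_path_length A \<gamma>)\<^sup>2)"
      "\<And>x. close_tensors (det (g x (?c x))) (\<phi> x) (\<gamma> 0 x (?c x)) (\<gamma> 1 x (?c x))"
      by (fact metric_path_estimate[OF g \<gamma>(1)])
    have "ennreal ((metric_path_length A \<gamma>)\<^sup>2) \<le> ennreal (((1/4) ^ k)\<^sup>2)"
      using \<phi>(3) \<gamma>(4) by (intro ennreal_leI power_mono) auto
    then show ?thesis using \<phi> \<gamma>(2,3) by (intro exI[of _ \<phi>]) (auto intro: order_trans)
  qed
  then obtain \<phi> where \<phi>_meas: "\<And>k. \<phi> k \<in> borel_measurable (volume A g)"
    and \<phi>_pos: "\<And>k x. \<phi> k x \<ge> 0"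
    and \<phi>_int: "\<And>k. (\<integral>\<^sup>+x. ennreal ((\<phi> k x)\<^sup>2) \<partial>volume A g) \<le> ennreal (((1/4) ^ k)\<^sup>2)"
    and close: "\<And>k x. close_tensors (det (g x (?c x))) (\<phi> k x) (h k x (?c x)) (h (Suc k) x (?c x))"
    by metis
  note [measurable] = \<phi>_meas
  \<comment> \<open>The weight \<open>2 ^ k\<close> against the squared rate
    \<open>(1/16) ^ k\<close> leaves \<open>(1/8) ^ k\<close>, so \<open>\<Psi>\<close> is
    integrable. Twice \<open>\<Psi>\<close> dominates the squared sum of the pointwise lengths,
    which serves both convergence and the volume bound.\<close>
  define \<Psi> where "\<Psi> x = (\<Sum>k. ennreal (2 ^ k * (\<phi> k x)\<^sup>2))" for x
  have \<Psi>_meas [measurable]: "\<Psi> \<in> borel_measurable (volume A g)" unfolding \<Psi>_def by measurable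
  have "(\<integral>\<^sup>+x. \<Psi> x \<partial>volume A g) = (\<Sum>k. \<integral>\<^sup>+x. ennreal (2 ^ k * (\<phi> k x)\<^sup>2) \<partial>volume A g)"
    unfolding \<Psi>_def by (rule nn_integral_suminf) measurable
  also have "\<dots> \<le> (\<Sum>k. ennreal ((1/8) ^ k))"
  proof (rule suminf_le)
    fix k
    have "(\<integral>\<^sup>+x. ennreal (2 ^ k * (\<phi> k x)\<^sup>2) \<partial>volume A g) = ennreal (2 ^ k) * (\<integral>\<^sup>+x. ennreal ((\<phi> k x)\<^sup>2) \<partial>volume A g)"
      by (subst nn_integral_cmult[symmetric]) (auto simp: ennreal_mult)
    also have "\<dots> \<le> ennreal (2 ^ k) * ennreal (((1/4) ^ k)\<^sup>2)" by (intro mult_left_mono \<phi>_int) simp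
    also have "\<dots> = ennreal ((1/8) ^ k)"
      by (simp add: ennreal_mult[symmetric] power2_eq_square power_mult_distrib[symmetric])
    finally show "(\<integral>\<^sup>+x. ennreal (2 ^ k * (\<phi> k x)\<^sup>2) \<partial>volume A g) \<le> ennreal ((1/8) ^ k)" .
  qed auto
  also have "\<dots> < \<infinity>"
  proof -
    have "(\<Sum>k. ennreal ((1/8) ^ k)) = ennreal (\<Sum>k. (1/8) ^ k)"
      by (intro suminf_ennreal2 summable_geometric) auto
    then show ?thesis by simp
  qed
  finally have \<Psi>_int: "(\<integral>\<^sup>+x. \<Psi> x \<partial>volume A g) < \<infinity>" .
  then have "AE x in volume A g. \<Psi> x \<noteq> \<infinity>"
    using \<Psi>_meas by (intro nn_integral_noteq_infinite) auto
  then obtain N where N: "{x \<in> space (volume A g). \<not> \<Psi> x \<noteq> \<infinity>} \<subseteq> N" "N \<in> null_sets (volume A g)"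
    by (auto elim!: AE_E simp: null_sets_def)
  define D where "D = deflated_set A g h"
  \<comment> \<open>The countably many thresholds \<open>1 / (m + 1)\<close> suffice, which makes
    \<open>D\<close> measurable.\<close>
  have "D = {x \<in> space (volume A g). \<forall>m. \<exists>k. rel_det A g (h k) x < 1 / real (Suc m)}"
  proof -
    have "(\<forall>\<delta>>0. \<exists>k. rel_det A g (h k) x < \<delta>) \<longleftrightarrow> (\<forall>m. \<exists>k. rel_det A g (h k) x < 1 / real (Suc m))" for x
    proof (intro iffI allI impI)
      fix \<delta> :: real assume *: "\<forall>m. \<exists>k. rel_det A g (h k) x < 1 / real (Suc m)" and "\<delta> > 0"
      then obtain m where "1 / real (Suc m) < \<delta>" using nat_approx_posE by blast
      then show "\<exists>k. rel_det A g (h k) x < \<delta>" using * by (meson less_trans)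
    qed auto
    then show ?thesis by (simp add: D_def deflated_set_def)
  qed
  also have "\<dots> \<in> sets (volume A g)"
  proof -
    have [measurable]: "rel_det A g (h k) \<in> borel_measurable (volume A g)" for k
      by (rule rel_det_measurable[OF g metric_in_measurable_semimetrics[OF h]])
    show ?thesis by measurable
  qed
  finally have D: "D \<in> lebesgue_sets A" by simp
  define E where "E = D \<union> N"
  have E: "E \<in> lebesgue_sets A"
    using D N(2) sets.Un[of D "volume A g" N] by (auto simp: E_def null_sets_def)
  have finite_\<Psi>: "\<Psi> x \<noteq> \<infinity>" if "x \<notin> E" for x using N(1) that by (auto simp: E_def)
  have partial: "(\<Sum>k<m. 2 ^ k * (\<phi> k x)\<^sup>2) \<le> enn2real (\<Psi> x)" if "x \<notin> E" for m x
  proof -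
    have "ennreal (\<Sum>k<m. 2 ^ k * (\<phi> k x)\<^sup>2) = (\<Sum>k<m. ennreal (2 ^ k * (\<phi> k x)\<^sup>2))"
      by (simp add: sum_ennreal)
    also have "\<dots> \<le> \<Psi> x" unfolding \<Psi>_def by (rule sum_le_suminf) auto
    also have "\<dots> = ennreal (enn2real (\<Psi> x))" using finite_\<Psi>[OF that] by (simp add: less_top)
    finally show ?thesis by simp
  qed
  note square_sum = weighted_square_sum[OF \<phi>_pos partial]
  have det_bound: "\<exists>\<epsilon>>0. \<forall>k. \<forall>c\<in>A. x \<in> chart_dom c \<longrightarrow> det (h k x c) / det (g x c) \<ge> \<epsilon>" if "x \<notin> E" for x
  proof -
    have "\<exists>\<epsilon>>0. \<forall>k. rel_det A g (h k) x \<ge> \<epsilon>"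
      using that by (auto simp: E_def D_def deflated_set_def not_less)
    then obtain \<epsilon> where "\<epsilon> > 0" "\<And>k. rel_det A g (h k) x \<ge> \<epsilon>" by blast
    then show ?thesis using rel_det_eq[OF g metric_sym[OF h]] by metis
  qed
  have convergent: "convergent (\<lambda>k. h k x c)" if x: "x \<notin> E" and c: "c \<in> A" "x \<in> chart_dom c" for x c
  proof -
    obtain \<epsilon> where \<epsilon>: "\<epsilon> > 0" "\<And>k. det (h k x (?c x)) / det (g x (?c x)) \<ge> \<epsilon>"
      using det_bound[OF x] chart_at by blast
    \<comment> \<open>Convergence is obtained in the chosen chart, in which the estimates
      \<open>close\<close> are stated, and then carried to \<open>c\<close> by the transformation
      law.\<close>
    obtain L where L: "(\<lambda>k. h k x (?c x)) \<longlonglongrightarrow> L"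
      by (rule close_tensors_convergent[OF metric_pd[OF h chart_at] metric_det_pos[OF g chart_at]
            square_sum(2)[OF x] close \<epsilon>])
    define J where "J = jacobian (transition c (?c x)) (at (chart_map c x))"
    have "(\<lambda>k. transpose J ** h k x (?c x) ** J) \<longlonglongrightarrow> transpose J ** L ** J"
      unfolding matrix_matrix_mult_def by (intro vec_tendstoI) (auto intro!: tendsto_intros L)
    moreover have "h k x c = transpose J ** h k x (?c x) ** J" for k
      unfolding J_def using chart_at c by (intro sym_tensor_transform metric_sym h) auto
    ultimately show ?thesis by (auto simp: convergent_def)
  qed
  \<comment> \<open>The value \<open>0\<close> on all of \<open>E\<close>, including the points of
    \<open>N\<close> outside \<open>D\<close>, makes the degenerate set exactly \<open>E\<close> and
    keeps the transformation law valid everywhere.\<close>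
  define ginf where "ginf x c = (if x \<notin> E \<and> c \<in> A \<and> x \<in> chart_dom c then lim (\<lambda>k. h k x c) else 0)" for x c
  have lim: "(\<lambda>k. h k x c) \<longlonglongrightarrow> ginf x c" if "x \<notin> E" "c \<in> A" "x \<in> chart_dom c" for x c
    using convergent[OF that] that by (simp add: ginf_def convergent_LIMSEQ_iff)
  have det_lim: "(\<lambda>k. det (h k x c)) \<longlonglongrightarrow> det (ginf x c)" if "x \<notin> E" "c \<in> A" "x \<in> chart_dom c" for x c
    using continuous_on_tendsto_compose[OF continuous_on_det[OF continuous_on_id] lim[OF that], of UNIV] by simp
  have zero: "ginf x c = 0" if "x \<in> E" for x c using that by (simp add: ginf_def)
  have sym: "sym_tensor_field A ginf"
    unfolding sym_tensor_field_def Let_def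
  proof (intro conjI allI ballI impI)
    show "ginf x c = 0" if "\<not> (c \<in> A \<and> x \<in> chart_dom c)" for x c using that by (auto simp: ginf_def)
    show "transpose (ginf x c) = ginf x c" if c: "c \<in> A" "x \<in> chart_dom c" for x c
    proof (cases "x \<in> E")
      case True
      then show ?thesis by (simp add: zero transpose_def vec_eq_iff)
    next
      case False
      have "(\<lambda>k. transpose (h k x c)) \<longlonglongrightarrow> transpose (ginf x c)"
        unfolding transpose_def by (intro vec_tendstoI) (auto intro!: tendsto_intros lim False c)
      then show ?thesis
        using lim[OF False c] sym_tensor_field_transpose[OF metric_sym[OF h] c] by (simp add: LIMSEQ_unique)
    qed
    show "ginf x c = transpose (jacobian (transition c c') (at (chart_map c x))) ** ginf x c' **
        jacobian (transition c c') (at (chart_map c x))"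
      if c: "c \<in> A" "c' \<in> A" "x \<in> chart_dom c \<inter> chart_dom c'" for x c c'
    proof (cases "x \<in> E")
      case True
      then show ?thesis by (simp add: zero matrix_matrix_mult_def vec_eq_iff)
    next
      case False
      let ?J = "jacobian (transition c c') (at (chart_map c x))"
      have "(\<lambda>k. transpose ?J ** h k x c' ** ?J) \<longlonglongrightarrow> transpose ?J ** ginf x c' ** ?J"
        unfolding matrix_matrix_mult_def using False c
        by (intro vec_tendstoI) (auto intro!: tendsto_intros lim)
      then have "(\<lambda>k. h k x c) \<longlonglongrightarrow> transpose ?J ** ginf x c' ** ?J"
        unfolding sym_tensor_transform[OF metric_sym[OF h] c, symmetric] .
      then show ?thesis using lim[OF False, of c] c LIMSEQ_unique by blast
    qed
  qed
  have psd: "v \<bullet> (ginf x c *v v) \<ge> 0" if c: "c \<in> A" "x \<in> chart_dom c" for x c and v :: "real^'n"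
  proof (cases "x \<in> E")
    case True
    then show ?thesis by (simp add: zero)
  next
    case False
    have "(\<lambda>k. v \<bullet> (h k x c *v v)) \<longlonglongrightarrow> v \<bullet> (ginf x c *v v)"
      unfolding inner_vec_def matrix_vector_mult_def by (auto intro!: tendsto_intros lim False c)
    then show ?thesis
      using pd_imp_psd[OF metric_pd[OF h c]] by (intro tendsto_lowerbound) (auto simp: psd_matrix_def)
  qed
  have psd_at: "psd_matrix (ginf x c)" if "c \<in> A" "x \<in> chart_dom c" for x c
    using psd[OF that] sym_tensor_field_transpose[OF sym that] by (simp add: psd_matrix_def)
  have pd: "pd_matrix (ginf x c)" if x: "x \<notin> E" and c: "c \<in> A" "x \<in> chart_dom c" for x c
  proof -
    obtain \<epsilon> where \<epsilon>: "\<epsilon> > 0" "\<And>k. det (h k x c) / det (g x c) \<ge> \<epsilon>"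
      using det_bound[OF x] c by blast
    have pos: "det (g x c) > 0" by (rule metric_det_pos[OF g c])
    \<comment> \<open>The lower bound for the determinants passes to the limit and excludes a
      degenerate one.\<close>
    have "\<epsilon> * det (g x c) \<le> det (ginf x c)"
      using \<epsilon>(2) pos by (intro tendsto_lowerbound[OF det_lim[OF x c]]) (auto simp: field_simps)
    then show ?thesis using psd_det_pos_imp_pd[OF psd_at[OF c]] mult_pos_pos[OF \<epsilon>(1) pos] by linarith
  qed
  have degenerate: "degenerate_set A ginf = E"
  proof (intro equalityI subsetI)
    fix x assume "x \<in> degenerate_set A ginf"
    then show "x \<in> E" using pd by (auto simp: degenerate_set_def pos_def_at_def pd_matrix_def)
  next
    fix x assume x: "x \<in> E"
    \<comment> \<open>The index type is nonempty, so there is a nonzero vector to witness that the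
      zero form is not positive definite.\<close>
    have "axis i 1 \<noteq> (0 :: real^'n)" for i by (simp add: axis_eq_0_iff)
    moreover have "\<not> v \<bullet> (ginf x (?c x) *v v) > 0" for v using zero[OF x] by simp
    ultimately show "x \<in> degenerate_set A ginf"
      unfolding degenerate_set_def pos_def_at_def using chart_at[of x] by blast
  qed
  have meas: "ginf \<in> measurable_semimetrics A"
  proof -
    have "coords c ginf \<in> borel_measurable (lebesgue_on (chart_img c))" if c: "c \<in> A" for c
    proof (rule borel_measurable_LIMSEQ_metric)
      have [measurable]: "chart_inv c \<in> measurable (lebesgue_on (chart_img c)) (volume A g)"
        by (rule measurable_chart_inv[OF c]) simp
      have [measurable]: "E \<in> sets (volume A g)" using E by simp
      have [measurable]: "coords c (h k) \<in> borel_measurable (lebesgue_on (chart_img c))" for k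
        using metric_in_measurable_semimetrics[OF h[of k]] c by (simp add: measurable_semimetrics_def)
      show "(\<lambda>y. if chart_inv c y \<in> E then 0 else coords c (h k) y) \<in> borel_measurable (lebesgue_on (chart_img c))" for k
        by measurable
      fix y assume "y \<in> space (lebesgue_on (chart_img c))"
      then have "chart_inv c y \<in> chart_dom c" using chart_inv_in_dom[OF c] by simp
      then show "(\<lambda>k. if chart_inv c y \<in> E then 0 else coords c (h k) y) \<longlonglongrightarrow> coords c ginf y"
        using lim[OF _ c] zero by (cases "chart_inv c y \<in> E") (auto simp: coords_def)
    qed
    then show ?thesis using sym psd by (auto simp: measurable_semimetrics_def pos_semidef_at_def)
  qed
  have volume_bound: "ennreal (sqrt (rel_det A g ginf x))
      \<le> 2 * ennreal (sqrt (rel_det A g (h 0) x)) + ennreal (4 * ?C\<^sup>2) * \<Psi> x" for x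
  proof (cases "x \<in> E")
    case True
    have "det (0 :: real^'n^'n) = 0" using det_0[where 'a = real and 'n = 'n] by (simp add: mat_0)
    then have "rel_det A g ginf x = 0" using rel_det_eq[OF g sym chart_at, of x] zero[OF True] by simp
    then show ?thesis by simp
  next
    case False
    let ?\<rho> = "det (g x (?c x))"
    have \<rho>: "?\<rho> > 0" by (rule metric_det_pos[OF g chart_at])
    have root: "det_root ?\<rho> (h k x (?c x)) \<ge> 0" "(det_root ?\<rho> (h k x (?c x)))\<^sup>2 = sqrt (det (h k x (?c x)) / ?\<rho>)" for k
      using metric_det_pos[OF h chart_at, of k x] \<rho> by (auto simp: det_root_def)
    have step: "sqrt (det (h k x (?c x)) / ?\<rho>) \<le> 2 * sqrt (rel_det A g (h 0) x) + 4 * ?C\<^sup>2 * enn2real (\<Psi> x)" for k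
    proof -
      \<comment> \<open>\<open>?s\<close> bounds the growth of the fourth root over the first
        \<open>k\<close> steps. The inequalities \<open>(a + s)^2 \<le> 2 a^2 + 2 s^2\<close> and
        \<open>(\<Sum> \<phi>)^2 \<le> 2 \<Psi>\<close> produce the constants \<open>2\<close> and
        \<open>4 * ?C^2\<close>. The bound does not depend on \<open>k\<close> and so survives the
        limit.\<close>
      let ?a = "det_root ?\<rho> (h 0 x (?c x))" and ?s = "?C * (\<Sum>j<k. \<phi> j x)"
      have "det_root ?\<rho> (h k x (?c x)) \<le> ?a + ?s"
        by (rule close_tensors_det_bound[where \<rho> = ?\<rho> and \<phi> = "\<lambda>k. \<phi> k x" and a = "\<lambda>k. h k x (?c x)", OF close])
      then have "(det_root ?\<rho> (h k x (?c x)))\<^sup>2 \<le> (?a + ?s)\<^sup>2" using root(1) by (intro power_mono) auto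
      also have "\<dots> \<le> 2 * ?a\<^sup>2 + 2 * ?s\<^sup>2"
        using sum_squares_bound[of ?a ?s] by (simp add: power2_sum)
      also have "?s\<^sup>2 \<le> ?C\<^sup>2 * (2 * enn2real (\<Psi> x))"
        unfolding power_mult_distrib by (intro mult_left_mono square_sum(1) False) auto
      finally show ?thesis by (simp add: root(2) rel_det_eq[OF g metric_sym[OF h] chart_at])
    qed
    have "(\<lambda>k. sqrt (det (h k x (?c x)) / ?\<rho>)) \<longlonglongrightarrow> sqrt (det (ginf x (?c x)) / ?\<rho>)"
      using \<rho> by (intro tendsto_intros det_lim False chart_at) auto
    then have "sqrt (det (ginf x (?c x)) / ?\<rho>) \<le> 2 * sqrt (rel_det A g (h 0) x) + 4 * ?C\<^sup>2 * enn2real (\<Psi> x)"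
      using step by (intro tendsto_upperbound) auto
    then have "ennreal (sqrt (rel_det A g ginf x)) \<le> ennreal (2 * sqrt (rel_det A g (h 0) x) + 4 * ?C\<^sup>2 * enn2real (\<Psi> x))"
      unfolding rel_det_eq[OF g sym chart_at, of x] by (rule ennreal_leI)
    also have "\<dots> = 2 * ennreal (sqrt (rel_det A g (h 0) x)) + ennreal (4 * ?C\<^sup>2) * ennreal (enn2real (\<Psi> x))"
    proof -
      have "rel_det A g (h 0) x \<ge> 0"
        using \<rho> metric_det_pos[OF h chart_at, of 0 x]
        by (simp add: rel_det_eq[OF g metric_sym[OF h] chart_at])
      then show ?thesis by (simp add: ennreal_mult)
    qed
    finally show ?thesis using finite_\<Psi>[OF False] by (simp add: less_top)
  qed
  have "ginf \<in> finite_volume_semimetrics A"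
  proof -
    have [measurable]: "rel_det A g k \<in> borel_measurable (volume A g)" if "k \<in> measurable_semimetrics A" for k
      by (rule rel_det_measurable[OF g that])
    have vol: "emeasure (volume A k) UNIV = (\<integral>\<^sup>+x. ennreal (sqrt (rel_det A g k x)) \<partial>volume A g)"
      if "k \<in> measurable_semimetrics A" for k
      using nn_integral_volume_density[OF g that, of "\<lambda>_. 1"] by simp
    note h0 = metric_in_measurable_semimetrics[OF h[of 0]]
    have "emeasure (volume A ginf) UNIV \<le> (\<integral>\<^sup>+x. 2 * ennreal (sqrt (rel_det A g (h 0) x)) + ennreal (4 * ?C\<^sup>2) * \<Psi> x \<partial>volume A g)"
      unfolding vol[OF meas] by (intro nn_integral_mono volume_bound)
    also have "\<dots> = 2 * emeasure (volume A (h 0)) UNIV + ennreal (4 * ?C\<^sup>2) * (\<integral>\<^sup>+x. \<Psi> x \<partial>volume A g)"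
      using h0 by (simp add: vol[OF h0] nn_integral_add nn_integral_cmult)
    also have "\<dots> < \<infinity>"
      using finite_volume_metric[OF h[of 0]] \<Psi>_int by (simp add: ennreal_mult_less_top ennreal_mult_eq_top_iff less_top)
    finally show ?thesis using meas by (simp add: finite_volume_semimetrics_def)
  qed
  then show thesis
    using that[of ginf N] N(2) D degenerate lim by (auto simp: D_def E_def)
qed

text \<open>Omega convergence is demanded for every representative of the class. Representatives may
  differ where one of them degenerates, but their degenerate sets differ by a null set; off
  \<open>D\<close> and a further null set, both are therefore definite and agree.\<close>

lemma representative_omega_limit:
  assumes ginf: "degenerate_set A ginf = D \<union> N" and N: "N \<in> null_sets (volume A g)" and D: "D \<in> lebesgue_sets A"
    and lim: "\<And>x c. x \<notin> D \<union> N \<Longrightarrow> c \<in> A \<Longrightarrow> x \<in> chart_dom c \<Longrightarrow> (\<lambda>k. h k x c) \<longlonglongrightarrow> ginf x c"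
    and p: "(ginf, p) \<in> semimetric_rel A g"
  shows "differ_by_nullset A g (degenerate_set A p) D"
    and "AE x in volume A g. x \<notin> D \<longrightarrow> (\<forall>c\<in>A. x \<in> chart_dom c \<longrightarrow> (\<lambda>k. h k x c) \<longlonglongrightarrow> p x c)"
proof -
  define X where "X = degenerate_set A p"
  define Z where "Z = (D \<union> N - X) \<union> (X - (D \<union> N))"
  have Z: "Z \<in> null_sets (volume A g)"
    using p ginf by (simp add: semimetric_rel_def differ_by_nullset_def Z_def X_def)
  have sets: "N \<in> sets (volume A g)" "Z \<in> sets (volume A g)" "D \<in> sets (volume A g)"
    using N Z D by auto
  \<comment> \<open>\<open>X\<close> is the symmetric difference of \<open>D \<union> N\<close> and
    the null set \<open>Z\<close>, which yields its measurability.\<close>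
  have "X = (D \<union> N - Z) \<union> (Z - (D \<union> N))" by (auto simp: Z_def)
  then have "X \<in> sets (volume A g)" using sets by (metis sets.Diff sets.Un)
  then have "(X - D) \<union> (D - X) \<in> sets (volume A g)" using sets by blast
  moreover have "(X - D) \<union> (D - X) \<subseteq> Z \<union> N" by (auto simp: Z_def)
  ultimately show "differ_by_nullset A g (degenerate_set A p) D"
    unfolding differ_by_nullset_def X_def[symmetric] using null_sets.Un[OF Z N] by (metis null_sets_subset)
  have "AE x in volume A g. x \<notin> D \<union> N \<union> X \<longrightarrow> ginf x = p x"
    using p ginf by (simp add: semimetric_rel_def X_def)
  moreover have "AE x in volume A g. x \<notin> N" "AE x in volume A g. x \<notin> Z"
    using N Z by (auto intro: AE_not_in)
  ultimately show "AE x in volume A g. x \<notin> D \<longrightarrow> (\<forall>c\<in>A. x \<in> chart_dom c \<longrightarrow> (\<lambda>k. h k x c) \<longlonglongrightarrow> p x c)"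
  proof eventually_elim
    case (elim x)
    show ?case
    proof (intro impI ballI)
      fix c assume x: "x \<notin> D" and c: "c \<in> A" "x \<in> chart_dom c"
      then have "ginf x = p x" using elim by (auto simp: Z_def)
      then show "(\<lambda>k. h k x c) \<longlonglongrightarrow> p x c" using lim[of x c] x c elim by auto
    qed
  qed
qed

end

theorem theorem4p27:
  fixes A :: "('m::t2_space, 'n::finite) chart set"
    and g :: "('m, 'n) tensor_field"
    and gs :: "nat \<Rightarrow> ('m, 'n) tensor_field"
  assumes "closed_oriented_manifold A"
    and "g \<in> metrics A"
    and "\<And>k. gs k \<in> metrics A"
    and "L2_Cauchy A gs"
  shows "\<exists>cls \<in> Mf_hat A g. omega_subconverges A g gs cls"
proof -
  interpret manifold A by standard (rule assms(1))
  obtain r where r: "strict_mono r" "\<And>k. L2_dist A (gs (r k)) (gs (r (Suc k))) < (1/4) ^ k"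
    by (rule fast_subsequence[OF assms(4)[unfolded L2_Cauchy_def], of "\<lambda>k. (1/4) ^ k"]) auto
  define h where "h = gs \<circ> r"
  have h: "h k \<in> metrics A" for k by (simp add: h_def assms(3))
  have fast: "L2_dist A (h k) (h (Suc k)) < (1/4) ^ k" for k using r(2) by (simp add: h_def)
  obtain ginf N where ginf: "ginf \<in> finite_volume_semimetrics A" "N \<in> null_sets (volume A g)"
    "deflated_set A g h \<in> lebesgue_sets A"
    "degenerate_set A ginf = deflated_set A g h \<union> N"
    "\<And>x c. x \<notin> deflated_set A g h \<union> N \<Longrightarrow> c \<in> A \<Longrightarrow> x \<in> chart_dom c \<Longrightarrow> (\<lambda>k. h k x c) \<longlonglongrightarrow> ginf x c"
    by (fact omega_limit_exists[OF assms(2) h fast])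
  let ?R = "semimetric_rel A g \<inter> finite_volume_semimetrics A \<times> finite_volume_semimetrics A"
  have Cauchy: "L2_Cauchy A h"
    unfolding L2_Cauchy_def
  proof (intro allI impI)
    fix e :: real assume "e > 0"
    then obtain M where M: "\<forall>m\<ge>M. \<forall>n\<ge>M. L2_dist A (gs m) (gs n) < e"
      using assms(4) unfolding L2_Cauchy_def by blast
    have "r n \<ge> M" if "n \<ge> M" for n using seq_suble[OF r(1), of n] that by linarith
    then show "\<exists>M. \<forall>m\<ge>M. \<forall>n\<ge>M. L2_dist A (h m) (h n) < e"
      using M by (intro exI[of _ M]) (simp add: h_def)
  qed
  \<comment> \<open>The geometric rate chosen for the pointwise argument also dominates the
    nonnegative distances of consecutive terms.\<close>
  have summable: "summable (\<lambda>k. L2_dist A (h k) (h (Suc k)))"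
  proof (rule summable_comparison_test')
    show "summable (\<lambda>k. (1/4 :: real) ^ k)" by (rule summable_geometric) simp
    show "norm (L2_dist A (h k) (h (Suc k))) \<le> (1/4) ^ k" for k
      using fast[of k] L2_dist_nonneg[OF h h, of k "Suc k"] by simp
  qed
  have "omega_converges A g h (?R `` {ginf})"
    unfolding omega_converges_def
  proof (intro ballI conjI Cauchy summable)
    fix p assume "p \<in> ?R `` {ginf}"
    then have "(ginf, p) \<in> semimetric_rel A g" by auto
    from representative_omega_limit[where D = "deflated_set A g h", OF ginf(4,2,3,5) this]
    show "differ_by_nullset A g (degenerate_set A p) (deflated_set A g h)"
      "AE x in volume A g. x \<notin> deflated_set A g h \<longrightarrow> (\<forall>c\<in>A. x \<in> chart_dom c \<longrightarrow> (\<lambda>k. h k x c) \<longlonglongrightarrow> p x c)"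
      by blast+
  qed
  then have "omega_subconverges A g gs (?R `` {ginf})"
    unfolding omega_subconverges_def using r(1) by (auto simp: h_def)
  moreover have "?R `` {ginf} \<in> Mf_hat A g"
    unfolding Mf_hat_def by (rule quotientI[OF ginf(1)])
  ultimately show ?thesis by blast
qed

end
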